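(* Let $T$ be a thick positive theory (working in a monster model of $T$). Let $(a_{i,j})_{i,j<\omega}$ be an array of tuples all of the same length and let $C$ be any (small) set of parameters. Then there is an array $(b_{i,j})_{i,j<\omega}$ that is array-indiscernible over $C$ and $\mathrm{EM}_{\mathrm{ar}}$-based on $(a_{i,j})_{i,j<\omega}$ over $C$.
   Context: Positive logic: a positive formula is built from atomic formulas using $\wedge,\vee,\top,\bot,\exists$; a positive theory is a set of h-inductive sentences $\forall x(\phi(x)\to\psi(x))$ with $\phi,\psi$ positive existential. A model $M$ is existentially closed if whenever $M\not\models\phi(a)$ for positive $\phi$, there is positive $\psi$ with $T\models\neg\exists x(\phi\wedge\psi)$ and $M\models\psi(a)$. One works in a monster model (e.c., very homogeneous, very saturated). Formulas in the monster are positive; $\mathrm{tp}(a/C)$ is the set of positive formulas over $C$ true of $a$, and $a\equiv_C b$ means equal types over $C$. A sequence is $C$-indiscernible if increasing tuples of equal length have the same type over $C$. $T$ is thick if being an indiscernible sequence is type-definable (there is a partial type $\Theta((x_i)_{i<\omega})$ satisfied exactly by indiscernible sequences). The array $\omega\times\omega$ is a structure in the language $\mathcal{L}_{\mathrm{ar}}=\{<_1,<_2\}$ with $(i,j)<_1(s,t)$ iff $i<s$, and $(i,j)<_2(s,t)$ iff $i=s$ and $j<t$. For an $\mathcal{L}$-structure $I$ and finite tuple $\bar\eta=(\eta_1,\dots,\eta_n)$ in $I$, $a_{\bar\eta}=(a_{\eta_1},\dots,a_{\eta_n})$ and $\mathrm{qftp}_{\mathcal{L}}(\bar\eta)$ is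 its quantifier-free $\mathcal{L}$-type (full first-order sense, with negations). $(a_i)_{i\in I}$ is $I$-indiscernible over $C$ if $\mathrm{qftp}_{\mathcal{L}}(\bar\eta)=\mathrm{qftp}_{\mathcal{L}}(\bar\nu)$ implies $a_{\bar\eta}\equiv_C a_{\bar\nu}$; for the array this is called array-indiscernible. $\mathrm{EM}_{\mathcal{L}}((a_i)_{i\in I}/C)$ is the set of positive formulas $\phi(x_{\bar\eta})$ over $C$ such that $\models\phi(a_{\bar\nu})$ for all $\bar\nu$ in $I$ with $\mathrm{qftp}_{\mathcal{L}}(\bar\nu)=\mathrm{qftp}_{\mathcal{L}}(\bar\eta)$ (the associated qf type). $(b_i)_{i\in I'}$ is $\mathrm{EM}_{\mathcal{L}}$-based on $(a_i)_{i\in I}$ over $C$ if for every such $\phi$ with associated qf type $\Delta$ and every $\bar\eta$ in $I'$ realising $\Delta$, $\models\phi(b_{\bar\eta})$. $\mathrm{EM}_{\mathrm{ar}}$-based means $\mathrm{EM}_{\mathcal{L}_{\mathrm{ar}}}$-based. *)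

theory Defs
  imports Main
begin

unbundle cardinal_syntax

section \<open>Positive logic\<close>

record ('f, 'r) lang =
  funs :: "'f set"
  rels :: "'r set"
  farity :: "'f \<Rightarrow> nat"
  rarity :: "'r \<Rightarrow> nat"

datatype ('f, 'v) tm = Var 'v | Fn 'f "('f, 'v) tm list"

primrec wf_tm :: "('f, 'r) lang \<Rightarrow> ('f, 'v) tm \<Rightarrow> bool" where
  "wf_tm L (Var x) \<longleftrightarrow> True"
| "wf_tm L (Fn f ts) \<longleftrightarrow> f \<in> funs L \<and> length ts = farity L f \<and> list_all (wf_tm L) ts"

primrec fv_tm :: "('f, 'v) tm \<Rightarrow> 'v set" where
  "fv_tm (Var x) = {x}"
| "fv_tm (Fn f ts) = \<Union> (set (map fv_tm ts))"

datatype ('f, 'r, 'v) fm =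
    Rel 'r "('f, 'v) tm list"
  | Eq "('f, 'v) tm" "('f, 'v) tm"
  | Top
  | Bot
  | And "('f, 'r, 'v) fm" "('f, 'r, 'v) fm"
  | Or "('f, 'r, 'v) fm" "('f, 'r, 'v) fm"
  | Ex 'v "('f, 'r, 'v) fm"

primrec wf_fm :: "('f, 'r) lang \<Rightarrow> ('f, 'r, 'v) fm \<Rightarrow> bool" where
  "wf_fm L (Rel r ts) \<longleftrightarrow> r \<in> rels L \<and> length ts = rarity L r \<and> list_all (wf_tm L) ts"
| "wf_fm L (Eq s t) \<longleftrightarrow> wf_tm L s \<and> wf_tm L t"
| "wf_fm L Top \<longleftrightarrow> True"
| "wf_fm L Bot \<longleftrightarrow> True"
| "wf_fm L (And p q) \<longleftrightarrow> wf_fm L p \<and> wf_fm L q"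
| "wf_fm L (Or p q) \<longleftrightarrow> wf_fm L p \<and> wf_fm L q"
| "wf_fm L (Ex x p) \<longleftrightarrow> wf_fm L p"

primrec fv :: "('f, 'r, 'v) fm \<Rightarrow> 'v set" where
  "fv (Rel r ts) = \<Union> (set (map fv_tm ts))"
| "fv (Eq s t) = fv_tm s \<union> fv_tm t"
| "fv Top = {}"
| "fv Bot = {}"
| "fv (And p q) = fv p \<union> fv q"
| "fv (Or p q) = fv p \<union> fv q"
| "fv (Ex x p) = fv p - {x}"

record ('f, 'r, 'm) struct =
  univ :: "'m set"
  fint :: "'f \<Rightarrow> 'm list \<Rightarrow> 'm"
  rint :: "'r \<Rightarrow> 'm list \<Rightarrow> bool"

definition is_struct :: "('f, 'r) lang \<Rightarrow> ('f, 'r, 'm) struct \<Rightarrow> bool" where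
  "is_struct L M \<longleftrightarrow> univ M \<noteq> {} \<and>
     (\<forall>f\<in>funs L. \<forall>xs\<in>lists (univ M). length xs = farity L f \<longrightarrow> fint M f xs \<in> univ M)"

primrec tval :: "('f, 'r, 'm) struct \<Rightarrow> ('v \<Rightarrow> 'm) \<Rightarrow> ('f, 'v) tm \<Rightarrow> 'm" where
  "tval M e (Var x) = e x"
| "tval M e (Fn f ts) = fint M f (map (tval M e) ts)"

primrec sat :: "('f, 'r, 'm) struct \<Rightarrow> ('v \<Rightarrow> 'm) \<Rightarrow> ('f, 'r, 'v) fm \<Rightarrow> bool" where
  "sat M e (Rel r ts) \<longleftrightarrow> rint M r (map (tval M e) ts)"
| "sat M e (Eq s t) \<longleftrightarrow> tval M e s = tval M e t"
| "sat M e Top \<longleftrightarrow> True"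
| "sat M e Bot \<longleftrightarrow> False"
| "sat M e (And p q) \<longleftrightarrow> sat M e p \<and> sat M e q"
| "sat M e (Or p q) \<longleftrightarrow> sat M e p \<or> sat M e q"
| "sat M e (Ex x p) \<longleftrightarrow> (\<exists>m\<in>univ M. sat M (e(x := m)) p)"

text \<open>The pair \<open>(p, q)\<close> stands for the h-inductive sentence \<open>\<forall>x (p(x) \<longrightarrow> q(x))\<close>, where \<open>x\<close>
  lists all the free variables.\<close>

type_synonym ('f, 'r) hsentence = "('f, 'r, nat) fm \<times> ('f, 'r, nat) fm"

definition positive_theory :: "('f, 'r) lang \<Rightarrow> ('f, 'r) hsentence set \<Rightarrow> bool" where
  "positive_theory L T \<longleftrightarrow> (\<forall>(p, q)\<in>T. wf_fm L p \<and> wf_fm L q)"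

definition holds :: "('f, 'r, 'm) struct \<Rightarrow> ('f, 'r) hsentence \<Rightarrow> bool" where
  "holds M s \<longleftrightarrow> (\<forall>e. range e \<subseteq> univ M \<longrightarrow> sat M e (fst s) \<longrightarrow> sat M e (snd s))"

definition is_model ::
    "('f, 'r) lang \<Rightarrow> ('f, 'r) hsentence set \<Rightarrow> ('f, 'r, 'm) struct \<Rightarrow> bool" where
  "is_model L T M \<longleftrightarrow> is_struct L M \<and> (\<forall>s\<in>T. holds M s)"

text \<open>HOL cannot quantify over models living in all types at once. The type of formulas is
  infinite and at least as large as the language, so by the downward Loewenheim-Skolem theorem
  every \<open>L\<close>-structure is elementarily equivalent to one whose universe is a set of formulas;
  hence quantifying over the latter gives the usual consequence relation.\<close>

definition entails ::
    "('f, 'r) lang \<Rightarrow> ('f, 'r) hsentence set \<Rightarrow> ('f, 'r) hsentence \<Rightarrow> bool" where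
  "entails L T s \<longleftrightarrow>
     (\<forall>N :: ('f, 'r, ('f, 'r, nat) fm) struct. is_model L T N \<longrightarrow> holds N s)"

text \<open>Below, \<open>\<not>\<exists>x (p \<and> q)\<close> is the h-inductive sentence \<open>\<forall>x (p \<and> q \<longrightarrow> \<bottom>)\<close>.\<close>

definition ec_model ::
    "('f, 'r) lang \<Rightarrow> ('f, 'r) hsentence set \<Rightarrow> ('f, 'r, 'm) struct \<Rightarrow> bool" where
  "ec_model L T M \<longleftrightarrow> is_model L T M \<and>
     (\<forall>p e. wf_fm L p \<longrightarrow> range e \<subseteq> univ M \<longrightarrow> \<not> sat M e p \<longrightarrow>
       (\<exists>q. wf_fm L q \<and> fv q \<subseteq> fv p \<and> entails L T (And p q, Bot) \<and> sat M e q))"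


section \<open>Types\<close>

text \<open>A formula over \<open>C\<close> in the variables \<open>V\<close> is a formula whose free variables are of the form
  \<open>Inl v\<close> with \<open>v \<in> V\<close> (a variable) or \<open>Inr c\<close> with \<open>c \<in> C\<close> (a parameter, always evaluated
  as \<open>c\<close>).\<close>

definition fm_over :: "('f, 'r) lang \<Rightarrow> 'v set \<Rightarrow> 'm set \<Rightarrow> ('f, 'r, 'v + 'm) fm set" where
  "fm_over L V C = {p. wf_fm L p \<and> fv p \<subseteq> V <+> C}"

definition satp :: "('f, 'r, 'm) struct \<Rightarrow> ('v \<Rightarrow> 'm) \<Rightarrow> ('f, 'r, 'v + 'm) fm \<Rightarrow> bool" where
  "satp M a p \<longleftrightarrow> sat M (case_sum a id) p"

definition tp ::
    "('f, 'r) lang \<Rightarrow> ('f, 'r, 'm) struct \<Rightarrow> 'm set \<Rightarrow> 'v set \<Rightarrow> ('v \<Rightarrow> 'm) \<Rightarrow> ('f, 'r, 'v + 'm) fm set"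
  where
  "tp L M C V a = {p \<in> fm_over L V C. satp M a p}"

text \<open>A family of tuples of the same (possibly infinite) length is a function
  \<open>a :: 'i \<Rightarrow> 'x \<Rightarrow> 'm\<close> together with a set \<open>X\<close> of coordinates. The concatenation
  \<open>a\<^bsub>\<eta>\<^esub>\<close> for a finite tuple \<open>\<eta>\<close> of indices has its coordinates in \<open>{..<length \<eta>} \<times> X\<close>.\<close>

definition tuple_at :: "('i \<Rightarrow> 'x \<Rightarrow> 'm) \<Rightarrow> 'i list \<Rightarrow> nat \<times> 'x \<Rightarrow> 'm" where
  "tuple_at a \<eta> = (\<lambda>(k, x). a (\<eta> ! k) x)"

definition tp_at ::
    "('f, 'r) lang \<Rightarrow> ('f, 'r, 'm) struct \<Rightarrow> 'm set \<Rightarrow> 'x set \<Rightarrow> ('i \<Rightarrow> 'x \<Rightarrow> 'm) \<Rightarrow> 'i list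
      \<Rightarrow> ('f, 'r, (nat \<times> 'x) + 'm) fm set" where
  "tp_at L M C X a \<eta> = tp L M C ({..<length \<eta>} \<times> X) (tuple_at a \<eta>)"

definition family_in :: "('f, 'r, 'm) struct \<Rightarrow> 'x set \<Rightarrow> ('i \<Rightarrow> 'x \<Rightarrow> 'm) \<Rightarrow> 'i set \<Rightarrow> bool" where
  "family_in M X a I \<longleftrightarrow> (\<forall>i\<in>I. \<forall>x\<in>X. a i x \<in> univ M)"

definition indiscernible_seq ::
    "('f, 'r) lang \<Rightarrow> ('f, 'r, 'm) struct \<Rightarrow> 'm set \<Rightarrow> 'x set \<Rightarrow> (nat \<Rightarrow> 'x \<Rightarrow> 'm) \<Rightarrow> bool" where
  "indiscernible_seq L M C X a \<longleftrightarrow>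
     (\<forall>is js. length is = length js \<longrightarrow> sorted_wrt (<) is \<longrightarrow> sorted_wrt (<) js \<longrightarrow>
        tp_at L M C X a is = tp_at L M C X a js)"


section \<open>The monster model and thickness\<close>

text \<open>For an uncountable cardinal \<open>r\<close> this says \<open>\<beth>\<^sub>r \<le> \<kappa>\<close>: a family \<open>B\<close> as below has
  \<open>|\<Union>j<\<omega>+\<alpha>. B j| \<ge> \<beth>\<^sub>\<alpha>\<close> for all limit ordinals \<open>\<alpha>\<close>, and \<open>\<omega> + r = r\<close>; conversely sets
  \<open>B i\<close> of size \<open>\<beth>\<close> of \<open>i + 1\<close> are as required.\<close>

definition beth_le :: "'i rel \<Rightarrow> 'k rel \<Rightarrow> bool" where
  "beth_le r \<kappa> \<longleftrightarrow> (\<exists>B :: 'i \<Rightarrow> 'k set. \<forall>i\<in>Field r.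
     B i \<subseteq> Field \<kappa> \<and> |Pow (\<Union>j\<in>underS r i. B j)| \<le>o |B i| )"

text \<open>The size of a monster model: an uncountable cardinal \<open>\<kappa>\<close> such that the cardinal
  \<open>\<beth>\<close> of \<open>(2\<^sup>\<lambda>)\<^sup>+\<close>, which governs the extraction of indiscernible sequences, is at most \<open>\<kappa>\<close>
  for all \<open>\<lambda> < \<kappa>\<close>. There are arbitrarily large such \<open>\<kappa>\<close> in ZFC; every strongly inaccessible
  cardinal is one. "Small" means of cardinality less than \<open>\<kappa>\<close>.\<close>

definition large_card :: "'k rel \<Rightarrow> bool" where
  "large_card \<kappa> \<longleftrightarrow> Card_order \<kappa> \<and> natLeq <o \<kappa> \<and>
     (\<forall>A \<subseteq> Field \<kappa>. |A| <o \<kappa> \<longrightarrow> beth_le (cardSuc |Pow A| ) \<kappa>)"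

definition saturated :: "('f, 'r) lang \<Rightarrow> 'k rel \<Rightarrow> ('f, 'r, 'm) struct \<Rightarrow> bool" where
  "saturated L \<kappa> M \<longleftrightarrow>
     (\<forall>A \<subseteq> univ M. |A| <o \<kappa> \<longrightarrow> (\<forall>\<Sigma> \<subseteq> fm_over L (UNIV :: nat set) A.
        (\<forall>\<Sigma>' \<subseteq> \<Sigma>. finite \<Sigma>' \<longrightarrow> (\<exists>e. range e \<subseteq> univ M \<and> (\<forall>p\<in>\<Sigma>'. satp M e p))) \<longrightarrow>
        (\<exists>e. range e \<subseteq> univ M \<and> (\<forall>p\<in>\<Sigma>. satp M e p))))"

definition automorphism :: "('f, 'r) lang \<Rightarrow> ('f, 'r, 'm) struct \<Rightarrow> ('m \<Rightarrow> 'm) \<Rightarrow> bool" where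
  "automorphism L M \<sigma> \<longleftrightarrow> bij_betw \<sigma> (univ M) (univ M) \<and>
     (\<forall>f\<in>funs L. \<forall>xs\<in>lists (univ M). length xs = farity L f \<longrightarrow>
        \<sigma> (fint M f xs) = fint M f (map \<sigma> xs)) \<and>
     (\<forall>r\<in>rels L. \<forall>xs\<in>lists (univ M). length xs = rarity L r \<longrightarrow>
        (rint M r (map \<sigma> xs) \<longleftrightarrow> rint M r xs))"

text \<open>The premise on \<open>f\<close> says that the small tuples \<open>(c)\<^bsub>c \<in> A\<^esub>\<close> and \<open>(f c)\<^bsub>c \<in> A\<^esub>\<close> have the same
  type over the empty set.\<close>

definition homogeneous :: "('f, 'r) lang \<Rightarrow> 'k rel \<Rightarrow> ('f, 'r, 'm) struct \<Rightarrow> bool" where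
  "homogeneous L \<kappa> M \<longleftrightarrow>
     (\<forall>A \<subseteq> univ M. \<forall>f. |A| <o \<kappa> \<longrightarrow> f ` A \<subseteq> univ M \<longrightarrow>
        (\<forall>(p :: ('f, 'r, nat) fm) e. wf_fm L p \<longrightarrow> range e \<subseteq> A \<longrightarrow>
           (sat M e p \<longleftrightarrow> sat M (f \<circ> e) p)) \<longrightarrow>
        (\<exists>\<sigma>. automorphism L M \<sigma> \<and> (\<forall>c\<in>A. \<sigma> c = f c)))"

definition monster ::
    "('f, 'r) lang \<Rightarrow> ('f, 'r) hsentence set \<Rightarrow> 'k rel \<Rightarrow> ('f, 'r, 'm) struct \<Rightarrow> bool" where
  "monster L T \<kappa> M \<longleftrightarrow> large_card \<kappa> \<and> |funs L| <o \<kappa> \<and> |rels L| <o \<kappa> \<and>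
     ec_model L T M \<and> saturated L \<kappa> M \<and> homogeneous L \<kappa> M"

text \<open>Every small length of tuples occurs as a set of coordinates \<open>X \<subseteq> Field \<kappa>\<close>. The partial
  type \<open>\<Theta>\<close> has variables \<open>(i, x)\<close> for \<open>i < \<omega>\<close> and \<open>x \<in> X\<close>, and no parameters.\<close>

definition thick :: "('f, 'r) lang \<Rightarrow> 'k rel \<Rightarrow> ('f, 'r, 'm) struct \<Rightarrow> bool" where
  "thick L \<kappa> M \<longleftrightarrow>
     (\<forall>X \<subseteq> Field \<kappa>. |X| <o \<kappa> \<longrightarrow>
       (\<exists>\<Theta> \<subseteq> fm_over L ((UNIV :: nat set) \<times> X) {}.
          \<forall>a. family_in M X a UNIV \<longrightarrow>
            ((\<forall>p\<in>\<Theta>. satp M (\<lambda>(i, x). a i x) p) \<longleftrightarrow> indiscernible_seq L M {} X a)))"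


section \<open>Indiscernibles indexed by a structure\<close>

datatype ('f, 'r, 'v) qf =
    QRel 'r "('f, 'v) tm list"
  | QEq "('f, 'v) tm" "('f, 'v) tm"
  | QTop
  | QNot "('f, 'r, 'v) qf"
  | QAnd "('f, 'r, 'v) qf" "('f, 'r, 'v) qf"
  | QOr "('f, 'r, 'v) qf" "('f, 'r, 'v) qf"

primrec wf_qf :: "('f, 'r) lang \<Rightarrow> ('f, 'r, 'v) qf \<Rightarrow> bool" where
  "wf_qf L (QRel r ts) \<longleftrightarrow> r \<in> rels L \<and> length ts = rarity L r \<and> list_all (wf_tm L) ts"
| "wf_qf L (QEq s t) \<longleftrightarrow> wf_tm L s \<and> wf_tm L t"
| "wf_qf L QTop \<longleftrightarrow> True"
| "wf_qf L (QNot p) \<longleftrightarrow> wf_qf L p"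
| "wf_qf L (QAnd p q) \<longleftrightarrow> wf_qf L p \<and> wf_qf L q"
| "wf_qf L (QOr p q) \<longleftrightarrow> wf_qf L p \<and> wf_qf L q"

primrec vars_qf :: "('f, 'r, 'v) qf \<Rightarrow> 'v set" where
  "vars_qf (QRel r ts) = \<Union> (set (map fv_tm ts))"
| "vars_qf (QEq s t) = fv_tm s \<union> fv_tm t"
| "vars_qf QTop = {}"
| "vars_qf (QNot p) = vars_qf p"
| "vars_qf (QAnd p q) = vars_qf p \<union> vars_qf q"
| "vars_qf (QOr p q) = vars_qf p \<union> vars_qf q"

primrec sat_qf :: "('f, 'r, 'i) struct \<Rightarrow> ('v \<Rightarrow> 'i) \<Rightarrow> ('f, 'r, 'v) qf \<Rightarrow> bool" where
  "sat_qf I e (QRel r ts) \<longleftrightarrow> rint I r (map (tval I e) ts)"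
| "sat_qf I e (QEq s t) \<longleftrightarrow> tval I e s = tval I e t"
| "sat_qf I e QTop \<longleftrightarrow> True"
| "sat_qf I e (QNot p) \<longleftrightarrow> \<not> sat_qf I e p"
| "sat_qf I e (QAnd p q) \<longleftrightarrow> sat_qf I e p \<and> sat_qf I e q"
| "sat_qf I e (QOr p q) \<longleftrightarrow> sat_qf I e p \<or> sat_qf I e q"

text \<open>The formulas \<open>x\<^sub>k = x\<^sub>k\<close> make the length of \<open>\<eta>\<close> part of its quantifier-free type.\<close>

definition qftp :: "('g, 's) lang \<Rightarrow> ('g, 's, 'i) struct \<Rightarrow> 'i list \<Rightarrow> ('g, 's, nat) qf set" where
  "qftp J I \<eta> = {p. wf_qf J p \<and> vars_qf p \<subseteq> {..<length \<eta>} \<and> sat_qf I (nth \<eta>) p}"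

definition indiscernible ::
    "('g, 's) lang \<Rightarrow> ('g, 's, 'i) struct \<Rightarrow> ('f, 'r) lang \<Rightarrow> ('f, 'r, 'm) struct
      \<Rightarrow> 'm set \<Rightarrow> 'x set \<Rightarrow> ('i \<Rightarrow> 'x \<Rightarrow> 'm) \<Rightarrow> bool" where
  "indiscernible J I L M C X a \<longleftrightarrow>
     (\<forall>\<eta>\<in>lists (univ I). \<forall>\<nu>\<in>lists (univ I).
        qftp J I \<eta> = qftp J I \<nu> \<longrightarrow> tp_at L M C X a \<eta> = tp_at L M C X a \<nu>)"

text \<open>The formulas of the EM-type are paired with their associated quantifier-free types.\<close>

definition EM ::
    "('g, 's) lang \<Rightarrow> ('g, 's, 'i) struct \<Rightarrow> ('f, 'r) lang \<Rightarrow> ('f, 'r, 'm) struct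
      \<Rightarrow> 'm set \<Rightarrow> 'x set \<Rightarrow> ('i \<Rightarrow> 'x \<Rightarrow> 'm)
      \<Rightarrow> (('g, 's, nat) qf set \<times> ('f, 'r, (nat \<times> 'x) + 'm) fm) set" where
  "EM J I L M C X a =
     {(qftp J I \<eta>, p) | \<eta> p. \<eta> \<in> lists (univ I) \<and> p \<in> fm_over L ({..<length \<eta>} \<times> X) C \<and>
        (\<forall>\<nu>\<in>lists (univ I). qftp J I \<nu> = qftp J I \<eta> \<longrightarrow> satp M (tuple_at a \<nu>) p)}"

definition EM_based ::
    "('g, 's) lang \<Rightarrow> ('g, 's, 'i) struct \<Rightarrow> ('g, 's, 'j) struct \<Rightarrow> ('f, 'r) lang
      \<Rightarrow> ('f, 'r, 'm) struct \<Rightarrow> 'm set \<Rightarrow> 'x set \<Rightarrow> ('i \<Rightarrow> 'x \<Rightarrow> 'm) \<Rightarrow> ('j \<Rightarrow> 'x \<Rightarrow> 'm) \<Rightarrow> bool" where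
  "EM_based J I I' L M C X a b \<longleftrightarrow>
     (\<forall>(\<Delta>, p)\<in>EM J I L M C X a. \<forall>\<eta>\<in>lists (univ I').
        qftp J I' \<eta> = \<Delta> \<longrightarrow> satp M (tuple_at b \<eta>) p)"


section \<open>Arrays\<close>

datatype ar_rel = Less1 | Less2

text \<open>The language has no function symbols; \<open>unit\<close> is a dummy.\<close>

definition L_ar :: "(unit, ar_rel) lang" where
  "L_ar = \<lparr>funs = {}, rels = {Less1, Less2}, farity = (\<lambda>_. 0), rarity = (\<lambda>_. 2)\<rparr>"

definition array :: "(unit, ar_rel, nat \<times> nat) struct" where
  "array = \<lparr>univ = UNIV, fint = (\<lambda>_ _. undefined),
     rint = (\<lambda>r ps. case (r, ps) of
         (Less1, [(i, j), (s, t)]) \<Rightarrow> i < s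
       | (Less2, [(i, j), (s, t)]) \<Rightarrow> i = s \<and> j < t
       | _ \<Rightarrow> False)\<rparr>"

abbreviation array_indiscernible ::
    "('f, 'r) lang \<Rightarrow> ('f, 'r, 'm) struct \<Rightarrow> 'm set \<Rightarrow> 'x set \<Rightarrow> (nat \<times> nat \<Rightarrow> 'x \<Rightarrow> 'm) \<Rightarrow> bool"
  where
  "array_indiscernible \<equiv> indiscernible L_ar array"

abbreviation EM_ar_based ::
    "('f, 'r) lang \<Rightarrow> ('f, 'r, 'm) struct \<Rightarrow> 'm set \<Rightarrow> 'x set
      \<Rightarrow> (nat \<times> nat \<Rightarrow> 'x \<Rightarrow> 'm) \<Rightarrow> (nat \<times> nat \<Rightarrow> 'x \<Rightarrow> 'm) \<Rightarrow> bool" where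
  "EM_ar_based \<equiv> EM_based L_ar array array"

end

theory Submission
  imports Defs
begin

text \<open>Morley's argument, an iterated Erdoes-Rado theorem applied to sequences whose length is a large
  beth number, extracts from any sequence an indiscernible one in which all positive formulas true of
  the increasing tuples of the given sequence remain true; negations do not survive. Apply this to one
  row of the array at a time, over all other entries and \<open>C\<close>. By thickness, "row \<open>i\<close> is
  indiscernible over \<open>C\<close> and the other rows" is given by a set of positive formulas. It is inherited by
  the arrays obtained by thinning out another row, so it survives the extraction in that row, and
  compactness gives an array in which every row is indiscernible over \<open>C\<close> and the other rows. This
  condition is also inherited by arrays obtained by omitting rows, hence it survives a last extraction
  which makes the sequence of rows indiscernible over \<open>C\<close>. Both properties together are
  array-indiscernibility: first move the rows, then the columns inside each row.\<close>

section \<open>Renaming of variables\<close>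

text \<open>Compactness can impose positive formulas only, so it cannot demand directly that two
  tuples have the same type; Ramsey's theorem for finitely many formulas at a time is therefore not
  enough. The way out is that types realised in an existentially closed model are maximal: a tuple
  satisfying every formula of a realised type has exactly that type. It thus suffices to find, for
  each N, a sequence of length N in which all increasing n-tuples have one and the same type,
  depending on n but not on N. Colouring by whole types is what calls for Erdos-Rado. If \<lambda>
  bounds the language and the coordinates, there are at most 2^\<lambda> colours, and fixing one
  colour for each n uses that the successor of 2^\<lambda> is regular; this is where the beth number
  in \<open>large_card\<close> comes from. The order of the two kinds of extraction matters:
  omitting rows moves row \<open>g i\<close> to place \<open>i\<close>, so the last extraction can
  keep row \<open>i\<close> indiscernible only if all rows were made so before.\<close>

lemma finite_fv_tm [simp]: "finite (fv_tm t)"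
  by (induction t) auto

lemma finite_fv [simp]: "finite (fv p)"
  by (induction p) auto

lemma tval_cong: "(\<And>x. x \<in> fv_tm t \<Longrightarrow> e x = e' x) \<Longrightarrow> tval M e t = tval M e' t"
proof (induction t)
  case (Fn f ts)
  have "map (tval M e) ts = map (tval M e') ts"
    using Fn.prems by (intro map_cong refl Fn.IH) auto
  then show ?case by (simp del: map_eq_conv)
qed simp

lemma sat_cong: "(\<And>x. x \<in> fv p \<Longrightarrow> e x = e' x) \<Longrightarrow> sat M e p \<longleftrightarrow> sat M e' p"
proof (induction p arbitrary: e e')
  case (Rel r ts)
  then have "map (tval M e) ts = map (tval M e') ts"
    by (intro map_cong refl tval_cong) auto
  then show ?case by (simp del: map_eq_conv)
next
  case (Eq s t)
  have "tval M e s = tval M e' s" "tval M e t = tval M e' t"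
    by (rule tval_cong, rule Eq.prems, simp)+
  then show ?case by simp
next
  case (And p q)
  have "sat M e p = sat M e' p" "sat M e q = sat M e' q"
    by (rule And.IH, rule And.prems, simp)+
  then show ?case by simp
next
  case (Or p q)
  have "sat M e p = sat M e' p" "sat M e q = sat M e' q"
    by (rule Or.IH, rule Or.prems, simp)+
  then show ?case by simp
next
  case (Ex x p)
  have "sat M (e(x := m)) p \<longleftrightarrow> sat M (e'(x := m)) p" for m
    using Ex.prems by (intro Ex.IH) auto
  then show ?case by auto
qed simp_all

abbreviation ren_tm :: "('v \<Rightarrow> 'w) \<Rightarrow> ('f, 'v) tm \<Rightarrow> ('f, 'w) tm" where
  "ren_tm \<equiv> map_tm (\<lambda>f. f)"

lemma fv_ren_tm: "fv_tm (ren_tm \<rho> t) = \<rho> ` fv_tm t"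
  by (induction t) auto

lemma wf_ren_tm: "wf_tm L (ren_tm \<rho> t) = wf_tm L t"
  by (induction t) (auto simp: list_all_iff)

lemma tval_ren_tm: "tval M e (ren_tm \<rho> t) = tval M (\<lambda>x. e (\<rho> x)) t"
proof (induction t)
  case (Fn f ts)
  then have "map (\<lambda>t. tval M e (ren_tm \<rho> t)) ts = map (tval M (\<lambda>x. e (\<rho> x))) ts"
    by (intro map_cong refl)
  then show ?case by (simp add: comp_def del: map_eq_conv)
qed simp

text \<open>\<open>\<rho>\<close> may identify free variables, so bound variables have to be kept apart from its values.\<close>

primrec ren :: "('f, 'r, 'v) fm \<Rightarrow> ('v \<Rightarrow> 'w) \<Rightarrow> ('f, 'r, 'w) fm" where
  "ren (Rel r ts) \<rho> = Rel r (map (ren_tm \<rho>) ts)"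
| "ren (Eq s t) \<rho> = Eq (ren_tm \<rho> s) (ren_tm \<rho> t)"
| "ren Top \<rho> = Top"
| "ren Bot \<rho> = Bot"
| "ren (And p q) \<rho> = And (ren p \<rho>) (ren q \<rho>)"
| "ren (Or p q) \<rho> = Or (ren p \<rho>) (ren q \<rho>)"
| "ren (Ex x p) \<rho> = (let y = (SOME y. y \<notin> \<rho> ` (fv p - {x})) in Ex y (ren p (\<rho>(x := y))))"

lemma wf_ren [simp]: "wf_fm L (ren p \<rho>) = wf_fm L p"
  by (induction p arbitrary: \<rho>) (auto simp: list_all_iff wf_ren_tm Let_def)

lemma fv_ren: "fv (ren p \<rho>) \<subseteq> \<rho> ` fv p"
proof (induction p arbitrary: \<rho>)
  case (Ex x p)
  define y where "y = (SOME y. y \<notin> \<rho> ` (fv p - {x}))"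
  have "fv (ren p (\<rho>(x := y))) \<subseteq> (\<rho>(x := y)) ` fv p" by (rule Ex.IH)
  then show ?case by (auto simp: Let_def y_def[symmetric] split: if_splits)
qed (fastforce simp: fv_ren_tm)+

text \<open>Only the finitely many values of \<open>\<rho>\<close> at the remaining free variables
  must be avoided, so an infinite target type always has a fresh name for the bound variable and
  nothing is captured.\<close>

lemma sat_ren:
  fixes \<rho> :: "'v \<Rightarrow> 'w"
  assumes "infinite (UNIV :: 'w set)"
  shows "sat M e (ren p \<rho>) \<longleftrightarrow> sat M (\<lambda>x. e (\<rho> x)) p"
proof (induction p arbitrary: \<rho> e)
  case (Rel r ts)
  have "map (\<lambda>t. tval M e (ren_tm \<rho> t)) ts = map (tval M (\<lambda>x. e (\<rho> x))) ts"
    by (intro map_cong refl tval_ren_tm)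
  then show ?case by (simp add: comp_def del: map_eq_conv)
next
  case (Ex x p)
  define y where "y = (SOME y. y \<notin> \<rho> ` (fv p - {x}))"
  have "\<exists>y. y \<notin> \<rho> ` (fv p - {x})"
    using assms by (intro ex_new_if_finite) auto
  then have y: "y \<notin> \<rho> ` (fv p - {x})" unfolding y_def by (rule someI_ex)
  have "sat M (e(y := m)) (ren p (\<rho>(x := y))) \<longleftrightarrow> sat M ((\<lambda>x. e (\<rho> x))(x := m)) p" for m
    unfolding Ex.IH using y by (intro sat_cong) auto
  then show ?case by (simp add: Let_def y_def[symmetric])
qed (auto simp: tval_ren_tm)


section \<open>Types in the language of countably many variables\<close>

text \<open>\<open>fm_over\<close> is not a small set, since its bound variables range over a whole type. Types are
  therefore also recorded by formulas in the variables \<open>nat\<close> together with lists of values for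
  these variables. As the lists may have repetitions, this is stable under all reindexings.\<close>

definition fm_list :: "('f, 'r) lang \<Rightarrow> 'w set \<Rightarrow> (('f, 'r, nat) fm \<times> 'w list) set" where
  "fm_list L W = {(p, l). wf_fm L p \<and> l \<in> lists W \<and> fv p \<subseteq> {..<length l}}"

text \<open>The type of the family \<open>e\<close> over the empty set. Parameters get no separate
  treatment: they are put into \<open>W\<close> as indices with a fixed value.\<close>

definition color ::
    "('f, 'r) lang \<Rightarrow> ('f, 'r, 'm) struct \<Rightarrow> 'w set \<Rightarrow> ('w \<Rightarrow> 'm) \<Rightarrow> (('f, 'r, nat) fm \<times> 'w list) set" where
  "color L M W e = {(p, l) \<in> fm_list L W. sat M (\<lambda>k. e (l ! k)) p}"

definition param_val :: "('v \<Rightarrow> 'm) \<Rightarrow> 'v + 'm \<Rightarrow> 'm" where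
  "param_val a = case_sum a id"

lemma param_val_simps [simp]: "param_val a (Inl x) = a x" "param_val a (Inr c) = c"
  by (auto simp: param_val_def)

lemma satp_alt: "satp M a p \<longleftrightarrow> sat M (param_val a) p"
  by (simp add: satp_def param_val_def)

lemma nth_mem_fv: "fv p \<subseteq> {..<length l} \<Longrightarrow> set l \<subseteq> W \<Longrightarrow> k \<in> fv p \<Longrightarrow> k < length l \<and> l ! k \<in> W"
  by (meson lessThan_iff nth_mem subsetD)

lemma color_eqI:
  assumes "\<And>p l. wf_fm L p \<Longrightarrow> set l \<subseteq> W \<Longrightarrow> fv p \<subseteq> {..<length l} \<Longrightarrow>
    sat M (\<lambda>k. e (l ! k)) p \<longleftrightarrow> sat M (\<lambda>k. e' (l ! k)) p"
  shows "color L M W e = color L M W e'"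
  using assms unfolding color_def fm_list_def by (auto simp: lists_eq_set)

lemma color_eqD:
  assumes "color L M W e = color L M W e'" "wf_fm L p" "set l \<subseteq> W" "fv p \<subseteq> {..<length l}"
  shows "sat M (\<lambda>k. e (l ! k)) p \<longleftrightarrow> sat M (\<lambda>k. e' (l ! k)) p"
proof -
  have "(p, l) \<in> color L M W e \<longleftrightarrow> (p, l) \<in> color L M W e'" using assms(1) by simp
  then show ?thesis using assms(2-4) by (simp add: color_def fm_list_def lists_eq_set)
qed

lemma color_cong:
  assumes "\<And>w. w \<in> W \<Longrightarrow> e w = e' w"
  shows "color L M W e = color L M W e'"
proof (rule color_eqI, goal_cases)
  case (1 p l)
  then have "e (l ! k) = e' (l ! k)" if "k \<in> fv p" for k
    using nth_mem_fv[OF 1(3,2) that] assms by blast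
  then show ?case by (intro sat_cong)
qed

text \<open>A list over \<open>W'\<close> is mapped to a list over \<open>W\<close>, where
  repetitions are harmless, so \<open>\<rho>\<close> need not be injective. All later changes of
  coordinates go through this lemma.\<close>

lemma color_reindex:
  assumes "color L M W e = color L M W e'" "\<rho> ` W' \<subseteq> W"
    and u: "\<And>w. w \<in> W' \<Longrightarrow> u w = e (\<rho> w)" and u': "\<And>w. w \<in> W' \<Longrightarrow> u' w = e' (\<rho> w)"
  shows "color L M W' u = color L M W' u'"
proof (rule color_eqI, goal_cases)
  case p: (1 p l)
  have l: "l ! k \<in> W'" "map \<rho> l ! k = \<rho> (l ! k)" if "k \<in> fv p" for k
    using nth_mem_fv[OF p(3,2) that] by auto
  have "sat M (\<lambda>k. u (l ! k)) p \<longleftrightarrow> sat M (\<lambda>k. e (map \<rho> l ! k)) p"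
    by (intro sat_cong) (use l u in auto)
  also have "\<dots> \<longleftrightarrow> sat M (\<lambda>k. e' (map \<rho> l ! k)) p"
    by (rule color_eqD[OF assms(1)]) (use assms(2) p in auto)
  also have "\<dots> \<longleftrightarrow> sat M (\<lambda>k. u' (l ! k)) p"
    by (intro sat_cong) (use l u' in auto)
  finally show ?case .
qed

text \<open>Replacing each free variable of \<open>p\<close> by its place in a list of them gives a
  formula in the variables \<open>nat\<close>, and this one the colour does decide.\<close>

lemma color_sat:
  assumes "color L M W e = color L M W e'" "wf_fm L p" "fv p \<subseteq> W"
  shows "sat M e p \<longleftrightarrow> sat M e' p"
proof -
  obtain l where l: "set l = fv p" using finite_list[OF finite_fv[of p]] by auto
  define idx where "idx = (\<lambda>v. SOME k. k < length l \<and> l ! k = v)"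
  have idx: "idx v < length l \<and> l ! idx v = v" if "v \<in> fv p" for v
    unfolding idx_def by (rule someI_ex) (use that l in \<open>auto simp: in_set_conv_nth\<close>)
  have *: "sat M (\<lambda>k. g (l ! k)) (ren p idx) \<longleftrightarrow> sat M g p" for g
    unfolding sat_ren[OF infinite_UNIV_nat] by (intro sat_cong) (use idx in auto)
  have "sat M (\<lambda>k. e (l ! k)) (ren p idx) \<longleftrightarrow> sat M (\<lambda>k. e' (l ! k)) (ren p idx)"
    by (rule color_eqD[OF assms(1)]) (use assms l idx in \<open>auto dest!: subsetD[OF fv_ren]\<close>)
  then show ?thesis by (simp only: *)
qed

text \<open>From left to right, the entries of the list are substituted for the variables
  \<open>nat\<close>, which needs infinitely many names to keep bound variables fresh; the converse
  is \<open>color_sat\<close>.\<close>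

lemma tp_eq_iff_color:
  fixes a :: "'v \<Rightarrow> 'm"
  assumes inf: "infinite (UNIV :: 'v set)"
  shows "tp L M C V a = tp L M C V a' \<longleftrightarrow>
    color L M (V <+> C) (param_val a) = color L M (V <+> C) (param_val a')"
proof
  assume *: "tp L M C V a = tp L M C V a'"
  show "color L M (V <+> C) (param_val a) = color L M (V <+> C) (param_val a')"
  proof (rule color_eqI, goal_cases)
    case p: (1 p l)
    have "(!) l ` fv p \<subseteq> V <+> C" using nth_mem_fv[OF p(3,2)] by blast
    then have "ren p ((!) l) \<in> fm_over L V C"
      using p(1) subset_trans[OF fv_ren] by (simp add: fm_over_def)
    then have "satp M a (ren p ((!) l)) \<longleftrightarrow> satp M a' (ren p ((!) l))"
      using * unfolding tp_def by blast
    moreover have "infinite (UNIV :: ('v + 'm) set)" using inf by simp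
    ultimately show ?case
      by (simp add: satp_alt sat_ren)
  qed
next
  assume "color L M (V <+> C) (param_val a) = color L M (V <+> C) (param_val a')"
  from color_sat[OF this] show "tp L M C V a = tp L M C V a'"
    unfolding tp_def fm_over_def satp_alt by blast
qed

section \<open>The Erdoes-Rado theorem and Morley's extraction of colours\<close>

lemma card_of_Pow_mono:
  assumes "|A| \<le>o |B|"
  shows "|Pow A| \<le>o |Pow B|"
proof -
  obtain h where "inj_on h A" "h ` A \<subseteq> B" using assms card_of_ordLeq[of A B] by blast
  then have "inj_on (image h) (Pow A)" "image h ` Pow A \<subseteq> Pow B"
    by (auto simp: inj_on_image_Pow)
  then show ?thesis using card_of_ordLeq by blast
qed

lemma card_of_Times_ordLeq:
  assumes "infinite A" "|B| \<le>o |A|" "|C| \<le>o |A|"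
  shows "|B \<times> C| \<le>o |A|"
  using assms by (intro card_of_Times_ordLeq_infinite_Field) (simp_all add: Field_card_of card_of_card_order_on)

lemma card_of_lists_ordLeq:
  assumes A: "infinite A" and B: "|B| \<le>o |A|"
  shows "|lists B| \<le>o |A|"
proof -
  have len: "|{l \<in> lists B. length l = n}| \<le>o |A|" for n
  proof (induction n)
    case 0
    have "{l \<in> lists B. length l = 0} = {[]}" by auto
    then show ?case using A by (simp add: card_of_singl_ordLeq infinite_imp_nonempty)
  next
    case (Suc n)
    have "{l \<in> lists B. length l = Suc n} = (\<lambda>(x, l). x # l) ` (B \<times> {l \<in> lists B. length l = n})"
      by (auto simp: length_Suc_conv image_iff)
    moreover have "|B \<times> {l \<in> lists B. length l = n}| \<le>o |A|"
      using Suc B A by (intro card_of_Times_ordLeq)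
    ultimately show ?case using ordLeq_transitive[OF card_of_image] by simp
  qed
  have "lists B = (\<Union>n. {l \<in> lists B. length l = n})" by auto
  moreover have "|\<Union>n. {l \<in> lists B. length l = n}| \<le>o |A|"
    using len A infinite_iff_card_of_nat by (intro card_of_UNION_ordLeq_infinite) auto
  ultimately show ?thesis by simp
qed

lemma finite_has_max:
  assumes "wo_rel r" "finite K" "K \<noteq> {}" "K \<subseteq> Field r"
  shows "\<exists>m\<in>K. \<forall>k\<in>K. (k, m) \<in> r"
  using assms(2-4)
proof (induction K rule: finite_ne_induct)
  case (singleton x)
  then show ?case using wo_rel.REFL[OF assms(1)] by (auto simp: refl_on_def)
next
  case (insert x K)
  then obtain m where m: "m \<in> K" "\<forall>k\<in>K. (k, m) \<in> r" by auto
  consider "(x, m) \<in> r" | "(m, x) \<in> r"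
    using insert.prems m wo_rel.TOTALS[OF assms(1)] by blast
  then show ?case
  proof cases
    case 2
    then have "(k, x) \<in> r" if "k \<in> K" for k
      using m that wo_rel.TRANS[OF assms(1)] by (meson transD)
    moreover have "(x, x) \<in> r" using wo_rel.REFL[OF assms(1)] insert.prems by (auto simp: refl_on_def)
    ultimately show ?thesis by auto
  qed (use m in auto)
qed

text \<open>Each \<open>y\<close> determines a sequence \<open>x y\<close> along \<open>E\<close> whose terms look like \<open>y\<close> over the
  preceding ones. If every \<open>y\<close> occurred in its own sequence, it would be determined by its place and
  the colours seen before, and there are only \<open>|Pow E|\<close> possibilities for those.\<close>

lemma end_homogeneous:
  fixes f :: "'a set \<Rightarrow> 'c" and E :: "'e set"
  assumes E: "infinite E" and Col: "|Col| \<le>o |E|" and Y: "\<not> |Y| \<le>o |Pow E|"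
    and f: "\<And>S. finite S \<Longrightarrow> S \<subseteq> Y \<Longrightarrow> f S \<in> Col"
  shows "\<exists>H g. H \<subseteq> Y \<and> |E| \<le>o |H| \<and> (\<forall>S. finite S \<longrightarrow> S \<subseteq> Y \<longrightarrow> g S \<in> Col) \<and>
    (\<forall>S. finite S \<longrightarrow> S \<subseteq> H \<longrightarrow> S \<noteq> {} \<longrightarrow> (\<exists>x\<in>S. f S = g (S - {x})))"
proof -
  define r where "r = |E|"
  have wo: "wo_rel r" unfolding r_def wo_rel_def by (rule card_of_Well_order)
  have Fr: "Field r = E" unfolding r_def by (rule Field_card_of)
  have wf: "wf (r - Id)" using wo by (rule wo_rel.WF)
  have US: "underS r \<xi> \<subseteq> E" for \<xi> using Fr unfolding underS_def Field_def by auto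
  have "Y \<noteq> {}" using Y card_of_empty by auto
  then obtain d where d: "d \<in> Y" by blast
  define cand where "cand y Z z \<longleftrightarrow> z \<in> Y - Z \<and>
    (\<forall>S. finite S \<longrightarrow> S \<subseteq> Z \<longrightarrow> f (insert z S) = f (insert y S))" for y Z z
  \<comment> \<open>As long as \<open>y\<close> itself has not occurred, \<open>y\<close> is a
    candidate; for \<open>y\<close> in \<open>Y\<close> the default \<open>d\<close> is thus taken
    only after \<open>y\<close> has been reached.\<close>
  define nxt where "nxt y Z = (if \<exists>z. cand y Z z then SOME z. cand y Z z else d)" for y Z
  have nxt_cand: "cand y Z (nxt y Z)" if "\<exists>z. cand y Z z" for y Z
    unfolding nxt_def using that someI_ex[OF that] by simp
  have nxt_Y: "nxt y Z \<in> Y" for y Z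
    using nxt_cand[of y Z] d by (cases "\<exists>z. cand y Z z") (auto simp: cand_def nxt_def)
  define x where "x y = wfrec (r - Id) (\<lambda>h \<xi>. nxt y (h ` underS r \<xi>))" for y
  have x: "x y \<xi> = nxt y (x y ` underS r \<xi>)" for y \<xi>
  proof -
    have "cut (x y) (r - Id) \<xi> ` underS r \<xi> = x y ` underS r \<xi>"
      by (intro image_cong refl) (auto simp: underS_def cut_apply)
    then show ?thesis unfolding x_def using wfrec[OF wf, of "\<lambda>h \<xi>. nxt y (h ` underS r \<xi>)"]
      by simp
  qed
  have x_Y: "x y \<xi> \<in> Y" for y \<xi> by (subst x) (rule nxt_Y)
  \<comment> \<open>The colours of \<open>y\<close> together with finite sets of earlier terms. The
    table is indexed by positions instead of terms, so that tables of different \<open>y\<close> can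
    be compared before their sequences are known to agree.\<close>
  define T where "T y \<xi> = {(l, c). l \<in> lists (underS r \<xi>) \<and> c = f (insert y (x y ` set l))}" for y \<xi>
  have determined: "x y \<eta> = x y' \<eta>" if T: "T y \<xi> = T y' \<xi>" and "(\<eta>, \<xi>) \<in> r" for y y' \<xi> \<eta>
    using \<open>(\<eta>, \<xi>) \<in> r\<close>
  proof (induction \<eta> rule: wf_induct_rule[OF wf])
    case (1 \<eta>)
    have trans: "(\<zeta>, \<xi>) \<in> r \<and> \<zeta> \<noteq> \<xi>" if "\<zeta> \<in> underS r \<eta>" for \<zeta>
      using that 1(2) wo_rel.TRANS[OF wo] wo_rel.ANTISYM[OF wo]
      unfolding underS_def trans_def antisym_def by blast
    have eq: "x y \<zeta> = x y' \<zeta>" if "\<zeta> \<in> underS r \<eta>" for \<zeta>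
      using that trans[OF that] by (intro 1(1)) (auto simp: underS_def)
    then have Z: "x y ` underS r \<eta> = x y' ` underS r \<eta>" by (intro image_cong refl)
    have "f (insert y S) = f (insert y' S)" if S: "finite S" "S \<subseteq> x y ` underS r \<eta>" for S
    proof -
      obtain K where K: "finite K" "K \<subseteq> underS r \<eta>" "S = x y ` K"
        using finite_subset_image[OF S] by blast
      obtain l where l: "set l = K" using finite_list[OF K(1)] by auto
      have "(l, f (insert y (x y ` set l))) \<in> T y \<xi>"
        unfolding T_def using l K trans by (auto simp: underS_def)
      then have "f (insert y (x y ` set l)) = f (insert y' (x y' ` set l))"
        unfolding T by (auto simp: T_def)
      moreover have "x y ` K = x y' ` K" using eq K by (intro image_cong) auto
      ultimately show ?thesis using l K by simp
    qed
    then have "cand y (x y ` underS r \<eta>) = cand y' (x y ` underS r \<eta>)"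
      unfolding cand_def by (intro ext) auto
    then have "nxt y (x y ` underS r \<eta>) = nxt y' (x y ` underS r \<eta>)" by (simp add: nxt_def)
    then show ?case unfolding x[of y \<eta>] x[of y' \<eta>] using Z by simp
  qed
  have "\<exists>y\<in>Y. \<forall>\<xi>\<in>E. y \<noteq> x y \<xi>"
  proof (rule ccontr)
    assume "\<not> ?thesis"
    then have ex: "\<exists>\<xi>. \<xi> \<in> E \<and> y = x y \<xi>" if "y \<in> Y" for y using that by blast
    define pos where "pos y = (SOME \<xi>. \<xi> \<in> E \<and> y = x y \<xi>)" for y
    have pos: "pos y \<in> E \<and> y = x y (pos y)" if "y \<in> Y" for y
      unfolding pos_def by (rule someI_ex[OF ex[OF that]])
    note pos = conjunct1[OF pos] conjunct2[OF pos]
    have inj: "inj_on (\<lambda>y. (pos y, T y (pos y))) Y"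
    proof (rule inj_onI)
      fix y y' assume y: "y \<in> Y" "y' \<in> Y" and eq: "(pos y, T y (pos y)) = (pos y', T y' (pos y'))"
      have *: "pos y' = pos y" using eq by (metis prod.inject)
      have **: "T y (pos y) = T y' (pos y)" using eq unfolding * by (metis prod.inject)
      have "(pos y, pos y) \<in> r" using pos(1)[OF y(1)] wo_rel.REFL[OF wo] unfolding Fr refl_on_def by blast
      have "y = x y (pos y)" by (rule pos(2)[OF y(1)])
      also have "\<dots> = x y' (pos y')" using determined[OF ** \<open>(pos y, pos y) \<in> r\<close>] * by simp
      also have "\<dots> = y'" by (rule pos(2)[OF y(2), symmetric])
      finally show "y = y'" .
    qed
    have "T y (pos y) \<subseteq> lists E \<times> Col" if "y \<in> Y" for y
    proof
      fix q assume "q \<in> T y (pos y)"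
      then obtain l where l: "q = (l, f (insert y (x y ` set l)))" "set l \<subseteq> underS r (pos y)"
        unfolding T_def by auto
      have "x y ` set l \<subseteq> Y" using x_Y by auto
      then show "q \<in> lists E \<times> Col" using l US that by (auto intro!: f)
    qed
    then have "(\<lambda>y. (pos y, T y (pos y))) ` Y \<subseteq> E \<times> Pow (lists E \<times> Col)" using pos(1) by auto
    with inj have "|Y| \<le>o |E \<times> Pow (lists E \<times> Col)|" using card_of_ordLeq by blast
    also have "|E \<times> Pow (lists E \<times> Col)| \<le>o |Pow E|"
    proof -
      have "|lists E| \<le>o |E|" using E by (intro card_of_lists_ordLeq ordLeq_refl) (auto simp: card_of_Card_order)
      then have "|lists E \<times> Col| \<le>o |E|"
        using Col E by (intro card_of_Times_ordLeq)
      then have "|Pow (lists E \<times> Col)| \<le>o |Pow E|" by (rule card_of_Pow_mono)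
      moreover have "|E| \<le>o |Pow E|" using card_of_Pow ordLess_imp_ordLeq by blast
      ultimately show ?thesis
        using E by (intro card_of_Times_ordLeq) auto
    qed
    finally show False using Y by simp
  qed
  then obtain y where y: "y \<in> Y" "\<And>\<xi>. \<xi> \<in> E \<Longrightarrow> y \<noteq> x y \<xi>" by blast
  have spec: "x y \<xi> \<in> Y - x y ` underS r \<xi> \<and> (\<forall>S. finite S \<longrightarrow> S \<subseteq> x y ` underS r \<xi> \<longrightarrow>
    f (insert (x y \<xi>) S) = f (insert y S))" for \<xi>
  proof -
    have "y \<in> Y - x y ` underS r \<xi>" using y US by auto
    then have "cand y (x y ` underS r \<xi>) y" by (simp add: cand_def)
    then have "cand y (x y ` underS r \<xi>) (x y \<xi>)" unfolding x[of y \<xi>] by (intro nxt_cand) auto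
    then show ?thesis by (simp add: cand_def)
  qed
  have neq: "x y \<eta> \<noteq> x y \<xi>" if "(\<eta>, \<xi>) \<in> r" "\<eta> \<noteq> \<xi>" for \<eta> \<xi>
  proof -
    have "x y \<eta> \<in> x y ` underS r \<xi>" using that by (intro imageI) (auto simp: underS_def)
    moreover have "x y \<xi> \<notin> x y ` underS r \<xi>" using spec[of \<xi>] by blast
    ultimately show ?thesis by metis
  qed
  have inj: "inj_on (x y) E"
  proof (rule inj_onI, rule ccontr)
    fix \<eta> \<xi> assume *: "\<eta> \<in> E" "\<xi> \<in> E" "x y \<eta> = x y \<xi>" "\<eta> \<noteq> \<xi>"
    then have "(\<eta>, \<xi>) \<in> r \<or> (\<xi>, \<eta>) \<in> r" using wo_rel.TOTALS[OF wo] Fr by blast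
    then show False using neq[of \<eta> \<xi>] neq[of \<xi> \<eta>] * by metis
  qed
  \<comment> \<open>A \<open>y\<close> that is never reached acts as a point beyond its whole
    sequence: replacing the last element of a finite set of terms by \<open>y\<close> keeps the
    colour.\<close>
  define g where "g S = f (insert y S)" for S
  have "|E| \<le>o |x y ` E|" using inj card_of_ordLeq by blast
  moreover have "x y ` E \<subseteq> Y" using spec by auto
  moreover have "g S \<in> Col" if "finite S" "S \<subseteq> Y" for S unfolding g_def using that y by (intro f) auto
  moreover have "\<exists>z\<in>S. f S = g (S - {z})" if S: "finite S" "S \<subseteq> x y ` E" "S \<noteq> {}" for S
  proof -
    obtain K where K: "finite K" "K \<subseteq> E" "S = x y ` K" using finite_subset_image[OF S(1,2)] by blast
    then obtain m where m: "m \<in> K" "\<forall>k\<in>K. (k, m) \<in> r"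
      using finite_has_max[OF wo, of K] Fr S by blast
    have "S - {x y m} \<subseteq> x y ` underS r m" using K m by (auto simp: underS_def)
    then have "f (insert (x y m) (S - {x y m})) = g (S - {x y m})"
      unfolding g_def using spec[of m] S by auto
    then show ?thesis using K m by (auto simp: insert_absorb)
  qed
  ultimately show ?thesis by blast
qed


text \<open>\<open>j\<close> lies \<open>2 n\<close> steps above \<open>i\<close> in the sequence of cardinals \<open>|B i|\<close>.\<close>

lemma erdos_rado:
  fixes B :: "'i \<Rightarrow> 'k set"
  assumes r: "Card_order r" "infinite (Field r)"
    and B: "\<And>i. i \<in> Field r \<Longrightarrow> |Pow (\<Union>j\<in>underS r i. B j)| \<le>o |B i|"
    and i: "i \<in> Field r" "infinite (B i)" "|Col| \<le>o |B i|"
  shows "\<exists>j\<in>Field r. (i, j) \<in> r \<and> (\<forall>(Y :: 'a set) (f :: 'a set \<Rightarrow> 'c). |B j| \<le>o |Y| \<longrightarrow>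
    (\<forall>S. finite S \<longrightarrow> S \<subseteq> Y \<longrightarrow> f S \<in> Col) \<longrightarrow>
    (\<exists>H c. H \<subseteq> Y \<and> |B i| \<le>o |H| \<and> c \<in> Col \<and> (\<forall>S\<subseteq>H. finite S \<longrightarrow> card S = n \<longrightarrow> f S = c)))"
proof -
  have wo: "wo_rel r" using r(1) unfolding wo_rel_def card_order_on_def by blast
  have succ: "\<exists>j\<in>Field r. (i, j) \<in> r \<and> |Pow (B i)| \<le>o |B j|" if i: "i \<in> Field r" for i
  proof -
    obtain j where j: "j \<in> Field r" "i \<noteq> j" "(i, j) \<in> r"
      using infinite_Card_order_limit[OF r i] by blast
    have "Pow (B i) \<subseteq> Pow (\<Union>j\<in>underS r j. B j)" using j by (auto simp: underS_def)
    then have "|Pow (B i)| \<le>o |B j|" by (rule ordLeq_transitive[OF card_of_mono1 B[OF j(1)]])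
    with j show ?thesis by blast
  qed
  show ?thesis
  proof (induction n)
    case 0
    \<comment> \<open>Only the empty set has size 0, so its colour is the constant.\<close>
    have "(i, i) \<in> r" using wo_rel.REFL[OF wo] i by (auto simp: refl_on_def)
    then show ?case using i(1) by (intro bexI[of _ i] conjI allI impI) (auto intro: exI[of _ "_ {}"])
  next
    case (Suc n)
    then obtain j where j: "j \<in> Field r" "(i, j) \<in> r" and
      IH: "\<And>(Y :: 'a set) (f :: 'a set \<Rightarrow> 'c). |B j| \<le>o |Y| \<Longrightarrow>
        (\<forall>S. finite S \<longrightarrow> S \<subseteq> Y \<longrightarrow> f S \<in> Col) \<Longrightarrow>
        (\<exists>H c. H \<subseteq> Y \<and> |B i| \<le>o |H| \<and> c \<in> Col \<and> (\<forall>S\<subseteq>H. finite S \<longrightarrow> card S = n \<longrightarrow> f S = c))"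
      by blast
    have Bij: "|B i| \<le>o |B j|"
    proof (cases "i = j")
      case False
      then have "B i \<subseteq> (\<Union>j\<in>underS r j. B j)" using j by (auto simp: underS_def)
      then have "|B i| \<le>o |Pow (\<Union>j\<in>underS r j. B j)|"
        by (rule ordLeq_transitive[OF card_of_mono1 ordLess_imp_ordLeq[OF card_of_Pow]])
      then show ?thesis using B[OF j(1)] by (rule ordLeq_transitive)
    qed (simp add: card_of_Card_order ordLeq_refl)
    \<comment> \<open>One step gives only \<open>|Pow (B j)| \<le>o |B j'|\<close>, but
      \<open>end_homogeneous\<close> needs a strictly larger set; Cantor's theorem at the second
      step supplies the strictness.\<close>
    obtain j' where j': "j' \<in> Field r" "(j, j') \<in> r" "|Pow (B j)| \<le>o |B j'|" using succ[OF j(1)] by blast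
    obtain k where k: "k \<in> Field r" "(j', k) \<in> r" "|Pow (B j')| \<le>o |B k|" using succ[OF j'(1)] by blast
    have "(i, k) \<in> r" using j j' k wo_rel.TRANS[OF wo] by (meson transD)
    moreover have "\<exists>H c. H \<subseteq> Y \<and> |B i| \<le>o |H| \<and> c \<in> Col \<and>
      (\<forall>S\<subseteq>H. finite S \<longrightarrow> card S = Suc n \<longrightarrow> f S = c)"
      if Y: "|B k| \<le>o |Y|" and f: "\<forall>S. finite S \<longrightarrow> S \<subseteq> Y \<longrightarrow> f S \<in> Col"
      for Y :: "'a set" and f :: "'a set \<Rightarrow> 'c"
    proof -
      have "|Pow (B j)| <o |Pow (B j')|" using j'(3) card_of_Pow ordLeq_ordLess_trans by blast
      then have "|Pow (B j)| <o |Y|" using ordLess_ordLeq_trans ordLeq_transitive[OF k(3) Y] by blast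
      then have "\<not> |Y| \<le>o |Pow (B j)|" using not_ordLess_ordLeq by blast
      moreover have "infinite (B j)" by (rule card_of_ordLeq_infinite[OF Bij i(2)])
      moreover have "|Col| \<le>o |B j|" by (rule ordLeq_transitive[OF i(3) Bij])
      ultimately obtain H g where H: "H \<subseteq> Y" "|B j| \<le>o |H|" "\<And>S. finite S \<Longrightarrow> S \<subseteq> Y \<Longrightarrow> g S \<in> Col"
        "\<And>S. finite S \<Longrightarrow> S \<subseteq> H \<Longrightarrow> S \<noteq> {} \<Longrightarrow> \<exists>x\<in>S. f S = g (S - {x})"
        using end_homogeneous[of "B j" Col Y f] f by blast
      obtain H' c where H': "H' \<subseteq> H" "|B i| \<le>o |H'|" "c \<in> Col"
        "\<And>S. S \<subseteq> H' \<Longrightarrow> finite S \<Longrightarrow> card S = n \<Longrightarrow> g S = c"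
        using IH[OF H(2), of g] H(1,3) by (meson subset_trans)
      have fc: "f S = c" if S: "S \<subseteq> H'" "finite S" "card S = Suc n" for S
      proof -
        obtain x where x: "x \<in> S" "f S = g (S - {x})" using H(4)[of S] S H' by fastforce
        then show ?thesis using H'(4)[of "S - {x}"] S by auto
      qed
      show ?thesis
        using subset_trans[OF H'(1) H(1)] H'(2,3) fc by (intro exI[of _ H'] exI[of _ c]) simp
    qed
    ultimately show ?case using k(1) by (intro bexI[of _ k]) simp_all
  qed
qed

text \<open>Erdos-Rado fixes the colour of n-sets inside each large set, but that colour may vary
  with the index. There are at most \<open>|P|\<close> colours and the indices form a regular
  cardinal above \<open>|P|\<close>, so one colour occurs cofinally; keeping only those indices and
  repeating this for n = 0, 1, 2, ... defines \<open>c\<close>. Each finite size needs only finitely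
  many of these rounds.\<close>

lemma morley_extraction:
  fixes B :: "'p set \<Rightarrow> 'k set" and f :: "'p set \<Rightarrow> 'k set \<Rightarrow> 'c"
  assumes P: "infinite P"
    and B: "\<And>i. i \<in> Field (cardSuc |P| ) \<Longrightarrow> |Pow (\<Union>j\<in>underS (cardSuc |P| ) i. B j)| \<le>o |B i|"
    and Col: "|Col| \<le>o |P|"
    and f: "\<And>i S. i \<in> Field (cardSuc |P| ) \<Longrightarrow> finite S \<Longrightarrow> S \<subseteq> B i \<Longrightarrow> f i S \<in> Col"
  shows "\<exists>c. \<forall>N. \<exists>i\<in>Field (cardSuc |P| ). \<exists>S\<subseteq>B i. finite S \<and> card S = N \<and> (\<forall>T\<subseteq>S. f i T = c (card T))"
proof -
  define r where "r = cardSuc |P|"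
  have r: "Card_order r" "infinite (Field r)"
    unfolding r_def using P by (auto simp: cardSuc_Card_order card_of_Card_order card_of_cardSuc_finite)
  have wo: "wo_rel r" using r(1) unfolding wo_rel_def card_order_on_def by blast
  have Pr: "|P| <o r" unfolding r_def by (simp add: cardSuc_greater card_of_Card_order)
  have reg: "regularCard r"
    unfolding r_def using P by (intro regularCard_cardSuc) (simp add: cinfinite_def card_of_card_order_on Field_card_of)
  note B = B[folded r_def] and f = f[folded r_def]
  have mono: "|B i| \<le>o |B j|" if "(i, j) \<in> r" for i j
  proof (cases "i = j")
    case False
    then have "B i \<subseteq> (\<Union>j\<in>underS r j. B j)" using that by (auto simp: underS_def)
    then have "|B i| \<le>o |Pow (\<Union>j\<in>underS r j. B j)|"
      by (rule ordLeq_transitive[OF card_of_mono1 ordLess_imp_ordLeq[OF card_of_Pow]])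
    moreover have "j \<in> Field r" using that by (auto simp: Field_def)
    ultimately show ?thesis using ordLeq_transitive[OF _ B[of j]] by simp
  qed (simp add: card_of_Card_order ordLeq_refl)
  \<comment> \<open>Every \<open>B i\<close> has an element outside all earlier ones, so the union
    along an initial segment of type \<open>|P|\<close> has at least \<open>|P|\<close> elements.
    From \<open>i0\<close> on the sets are infinite and at least as large as
    \<open>Col\<close>.\<close>
  obtain i0 where i0: "i0 \<in> Field r" "|P| \<le>o |B i0|"
  proof -
    have "\<exists>x. x \<in> B i - (\<Union>j\<in>underS r i. B j)" if "i \<in> Field r" for i
    proof (rule ccontr)
      assume "\<not> ?thesis"
      then have "|B i| \<le>o |\<Union>j\<in>underS r i. B j|" by (intro card_of_mono1) blast
      with B[OF that] have "|Pow (\<Union>j\<in>underS r i. B j)| \<le>o |\<Union>j\<in>underS r i. B j|"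
        by (rule ordLeq_transitive)
      then show False using card_of_Pow not_ordLess_ordLeq by blast
    qed
    then obtain b where b: "\<And>i. i \<in> Field r \<Longrightarrow> b i \<in> B i - (\<Union>j\<in>underS r i. B j)" by metis
    have inj: "inj_on b (Field r)"
    proof (rule inj_onI, rule ccontr)
      fix i j assume ij: "i \<in> Field r" "j \<in> Field r" "b i = b j" "i \<noteq> j"
      then have "i \<in> underS r j \<or> j \<in> underS r i"
        using wo_rel.TOTALS[OF wo] by (auto simp: underS_def)
      then show False using b[of i] b[of j] ij by auto
    qed
    obtain i where i: "i \<in> Field r" "|P| =o Restr r (underS r i)"
      using Pr ordLess_iff_ordIso_Restr[of r "|P|"] wo by (auto simp: card_of_Well_order wo_rel_def)
    have U: "underS r i \<subseteq> Field r" by (auto simp: underS_def Field_def)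
    have "|P| =o |Field (Restr r (underS r i))|"
      using card_of_cong[OF i(2)] by (simp add: Field_card_of)
    also have "|Field (Restr r (underS r i))| \<le>o |underS r i|"
      by (intro card_of_mono1) (auto simp: Field_def)
    also have "|underS r i| \<le>o |\<Union>j\<in>underS r i. B j|"
      using inj_on_subset[OF inj U] b U by (intro card_of_ordLeqI[of b]) auto
    also have "|\<Union>j\<in>underS r i. B j| \<le>o |Pow (\<Union>j\<in>underS r i. B j)|"
      using card_of_Pow ordLess_imp_ordLeq by blast
    also have "|Pow (\<Union>j\<in>underS r i. B j)| \<le>o |B i|" using B i by blast
    finally show ?thesis using i that by blast
  qed
  \<comment> \<open>The sets obeying \<open>c\<close> below size \<open>n\<close> must still come in
    all cardinalities \<open>|B i|\<close>, since the next round applies Erdos-Rado inside one of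
    them. The set may lie in any \<open>B i'\<close>; only its size is controlled.\<close>
  define Q where "Q n c \<longleftrightarrow> (\<forall>i. (i0, i) \<in> r \<longrightarrow> (\<exists>i'\<in>Field r. \<exists>Y\<subseteq>B i'. |B i| \<le>o |Y| \<and>
    (\<forall>T\<subseteq>Y. finite T \<longrightarrow> card T < n \<longrightarrow> f i' T = c (card T))))" for n c
  have Q0: "Q 0 c" for c
    unfolding Q_def by (auto simp: Field_def intro!: bexI exI conjI card_of_Card_order ordLeq_refl)
  have QSuc: "\<exists>x. Q (Suc n) (c(n := x))" if Q: "Q n c" for n c
  proof -
    have "\<exists>x i' Y. x \<in> Col \<and> i' \<in> Field r \<and> Y \<subseteq> B i' \<and> |B i| \<le>o |Y| \<and>
      (\<forall>T\<subseteq>Y. finite T \<longrightarrow> card T < Suc n \<longrightarrow> f i' T = (c(n := x)) (card T))" if i: "(i0, i) \<in> r" for i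
    proof -
      have "i \<in> Field r" using i by (auto simp: Field_def)
      moreover have Pi: "|P| \<le>o |B i|" by (rule ordLeq_transitive[OF i0(2) mono[OF i]])
      moreover have "infinite (B i)" by (rule card_of_ordLeq_infinite[OF Pi P])
      moreover have "|Col| \<le>o |B i|" by (rule ordLeq_transitive[OF Col Pi])
      ultimately obtain j where j: "j \<in> Field r" "(i, j) \<in> r" and
        ER: "\<And>(Y :: 'k set) (f :: 'k set \<Rightarrow> 'c). |B j| \<le>o |Y| \<Longrightarrow>
          (\<forall>S. finite S \<longrightarrow> S \<subseteq> Y \<longrightarrow> f S \<in> Col) \<Longrightarrow>
          (\<exists>H c. H \<subseteq> Y \<and> |B i| \<le>o |H| \<and> c \<in> Col \<and> (\<forall>S\<subseteq>H. finite S \<longrightarrow> card S = n \<longrightarrow> f S = c))"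
        using erdos_rado[OF r B, of i Col n] by blast
      have "(i0, j) \<in> r" using i j wo_rel.TRANS[OF wo] by (meson transD)
      then obtain i' Y where Y: "i' \<in> Field r" "Y \<subseteq> B i'" "|B j| \<le>o |Y|"
        "\<And>T. T \<subseteq> Y \<Longrightarrow> finite T \<Longrightarrow> card T < n \<Longrightarrow> f i' T = c (card T)"
        using Q unfolding Q_def by metis
      obtain H x where H: "H \<subseteq> Y" "|B i| \<le>o |H|" "x \<in> Col"
        "\<And>S. S \<subseteq> H \<Longrightarrow> finite S \<Longrightarrow> card S = n \<Longrightarrow> f i' S = x"
        using ER[OF Y(3), of "f i'"] f[OF Y(1)] Y(2) by (meson subset_trans)
      have "f i' T = (c(n := x)) (card T)" if T: "T \<subseteq> H" "finite T" "card T < Suc n" for T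
      proof (cases "card T = n")
        case False
        then show ?thesis using Y(4)[OF subset_trans[OF T(1) H(1)] T(2)] T(3) by simp
      qed (use H(4)[OF T(1,2)] in simp)
      then show ?thesis
        using H(2,3) Y(1) subset_trans[OF H(1) Y(2)]
        by (intro exI[of _ x] exI[of _ i'] exI[of _ H]) simp
    qed
    then obtain x where x: "\<And>i. (i0, i) \<in> r \<Longrightarrow> x i \<in> Col \<and> (\<exists>i' Y. i' \<in> Field r \<and> Y \<subseteq> B i' \<and> |B i| \<le>o |Y| \<and>
      (\<forall>T\<subseteq>Y. finite T \<longrightarrow> card T < Suc n \<longrightarrow> f i' T = (c(n := x i)) (card T)))"
      by metis
    \<comment> \<open>Otherwise each colour \<open>y\<close> stops occurring from some index
      \<open>bd y\<close> on. By regularity the at most \<open>|P|\<close> many bounds have a common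
      upper bound \<open>i\<close>, and the colour \<open>x i\<close> occurs at \<open>i\<close>
      against its own bound.\<close>
    have "\<exists>y. \<forall>i\<in>Field r. \<exists>j. (i, j) \<in> r \<and> (i0, j) \<in> r \<and> x j = y"
    proof (rule ccontr)
      assume "\<not> ?thesis"
      then obtain bd where bd: "\<And>y. bd y \<in> Field r"
        "\<And>y j. (bd y, j) \<in> r \<Longrightarrow> (i0, j) \<in> r \<Longrightarrow> x j \<noteq> y" by metis
      define K where "K = insert i0 (bd ` Col)"
      have "|K| \<le>o |P|"
      proof -
        have "|bd ` Col| \<le>o |P|" by (rule ordLeq_transitive[OF card_of_image Col])
        moreover have "|{i0}| \<le>o |P|" using P by (intro card_of_singl_ordLeq) auto
        ultimately have "|{i0} \<union> bd ` Col| \<le>o |P|"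
          using P by (intro card_of_Un_ordLeq_infinite_Field) (auto simp: Field_card_of card_of_card_order_on)
        then show ?thesis unfolding K_def by simp
      qed
      then have "|K| <o r" using Pr ordLeq_ordLess_trans by blast
      then have "\<not> |K| =o r" using not_ordLess_ordIso by blast
      moreover have "K \<subseteq> Field r" unfolding K_def using i0 bd by auto
      ultimately have "\<not> cofinal K r" using reg unfolding regularCard_def by blast
      then obtain i where i: "i \<in> Field r" "\<And>k. k \<in> K \<Longrightarrow> k = i \<or> (i, k) \<notin> r"
        unfolding cofinal_def by blast
      have "(k, i) \<in> r" if "k \<in> K" for k
        using i(2)[OF that] wo_rel.TOTALS[OF wo] i(1) \<open>K \<subseteq> Field r\<close> that by blast
      then have "(i0, i) \<in> r" "(bd (x i), i) \<in> r" using x[of i] unfolding K_def by auto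
      then show False using bd(2) by blast
    qed
    then obtain y where y: "\<And>i. i \<in> Field r \<Longrightarrow> \<exists>j. (i, j) \<in> r \<and> (i0, j) \<in> r \<and> x j = y" by blast
    have "Q (Suc n) (c(n := y))"
      unfolding Q_def
    proof (intro allI impI)
      fix i assume "(i0, i) \<in> r"
      then have "i \<in> Field r" by (auto simp: Field_def)
      then obtain j where j: "(i, j) \<in> r" "(i0, j) \<in> r" "x j = y" using y by blast
      obtain i' Y where *: "i' \<in> Field r" "Y \<subseteq> B i'" "|B j| \<le>o |Y|"
        "\<forall>T\<subseteq>Y. finite T \<longrightarrow> card T < Suc n \<longrightarrow> f i' T = (c(n := y)) (card T)"
        using x[OF j(2)] j(3) by blast
      then have "|B i| \<le>o |Y|" using ordLeq_transitive[OF mono[OF j(1)]] by blast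
      then show "\<exists>i'\<in>Field r. \<exists>Y\<subseteq>B i'. |B i| \<le>o |Y| \<and>
        (\<forall>T\<subseteq>Y. finite T \<longrightarrow> card T < Suc n \<longrightarrow> f i' T = (c(n := y)) (card T))"
        using * by blast
    qed
    then show ?thesis by blast
  qed
  obtain cs where cs: "\<And>n. Q n (cs n)" "\<And>n. \<exists>x. cs (Suc n) = (cs n)(n := x)"
    using dependent_nat_choice[of Q "\<lambda>n c c'. \<exists>x. c' = c(n := x)"] Q0 QSuc by metis
  \<comment> \<open>Round \<open>n\<close> changes the value at \<open>n\<close> only, so the
    diagonal \<open>cs (Suc n) n\<close> collects the final values.\<close>
  have stable: "cs m k = cs (Suc k) k" if "k < m" for m k
    using that
  proof (induction m)
    case (Suc m)
    then show ?case using cs(2)[of m] by (cases "k = m") (auto simp: fun_upd_def)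
  qed simp
  show ?thesis
  proof (intro exI allI)
    fix N
    have "(i0, i0) \<in> r" using wo_rel.REFL[OF wo] i0 by (auto simp: refl_on_def)
    then obtain i Y where Y: "i \<in> Field r" "Y \<subseteq> B i" "|B i0| \<le>o |Y|"
      "\<And>T. T \<subseteq> Y \<Longrightarrow> finite T \<Longrightarrow> card T < Suc N \<Longrightarrow> f i T = cs (Suc N) (card T)"
      using cs(1)[of "Suc N"] unfolding Q_def by metis
    have "infinite Y" by (rule card_of_ordLeq_infinite[OF ordLeq_transitive[OF i0(2) Y(3)] P])
    then obtain S where S: "S \<subseteq> Y" "finite S" "card S = N" using infinite_arbitrarily_large by metis
    have fT: "f i T = cs (Suc (card T)) (card T)" if T: "T \<subseteq> S" for T
    proof -
      have "finite T" by (rule finite_subset[OF T S(2)])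
      moreover have "card T < Suc N" using card_mono[OF S(2) T] S(3) by simp
      ultimately show ?thesis
        using Y(4)[OF subset_trans[OF T S(1)]] stable[of "card T" "Suc N"] by simp
    qed
    show "\<exists>i\<in>Field (cardSuc |P| ). \<exists>S\<subseteq>B i. finite S \<and> card S = N \<and>
      (\<forall>T\<subseteq>S. f i T = (\<lambda>n. cs (Suc n) n) (card T))"
      using Y(1) subset_trans[OF S(1) Y(2)] S(2,3) fT unfolding r_def
      by (intro bexI[of _ i] exI[of _ S]) simp_all
  qed
qed

section \<open>Downward Loewenheim-Skolem and existentially closed models\<close>

lemma infinite_UNIV_fm: "infinite (UNIV :: ('f, 'r, nat) fm set)"
proof -
  have "inj (\<lambda>n. Eq (Var n) (Var n) :: ('f, 'r, nat) fm)" by (simp add: inj_def)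
  then show ?thesis using finite_imageD infinite_UNIV_nat by (metis finite_subset subset_UNIV)
qed

lemma card_nat_ordLeq_fm: "|UNIV :: nat set| \<le>o |UNIV :: ('f, 'r, nat) fm set|"
  using infinite_UNIV_fm infinite_iff_card_of_nat by blast

text \<open>The Tarski-Vaught criterion for positive formulas.\<close>

definition elementary_in :: "('f, 'r) lang \<Rightarrow> ('f, 'r, 'm) struct \<Rightarrow> 'm set \<Rightarrow> bool" where
  "elementary_in L M N \<longleftrightarrow> N \<subseteq> univ M \<and> (\<forall>(p :: ('f, 'r, nat) fm) x e. wf_fm L p \<longrightarrow> range e \<subseteq> N \<longrightarrow>
    (\<exists>m\<in>univ M. sat M (e(x := m)) p) \<longrightarrow> (\<exists>m\<in>N. sat M (e(x := m)) p))"

text \<open>A formula uses only finitely many values of an assignment, so witness functions on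
  finite lists suffice and \<omega> rounds of closing under them reach a fixed point. The witnesses
  are indexed by formulas, variables and lists, whence the bound by the type of formulas.\<close>

lemma ex_elementary:
  fixes M :: "('f, 'r, 'm) struct" and S :: "'m set"
  assumes S: "S \<subseteq> univ M" "S \<noteq> {}" "|S| \<le>o |UNIV :: ('f, 'r, nat) fm set|"
  shows "\<exists>N. S \<subseteq> N \<and> elementary_in L M N \<and> |N| \<le>o |UNIV :: ('f, 'r, nat) fm set|"
proof -
  let ?U = "UNIV :: ('f, 'r, nat) fm set"
  obtain d where d: "d \<in> S" using S by blast
  define wit where "wit = (\<lambda>(p :: ('f, 'r, nat) fm, x, l).
    if \<exists>m\<in>univ M. sat M ((\<lambda>k. l ! k)(x := m)) p
    then SOME m. m \<in> univ M \<and> sat M ((\<lambda>k. l ! k)(x := m)) p else d)"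
  have wit: "wit (p, x, l) \<in> univ M \<and> sat M ((\<lambda>k. l ! k)(x := wit (p, x, l))) p"
    if "\<exists>m\<in>univ M. sat M ((\<lambda>k. l ! k)(x := m)) p" for p x l
  proof -
    have "\<exists>m. m \<in> univ M \<and> sat M ((\<lambda>k. l ! k)(x := m)) p" using that by blast
    from someI_ex[OF this] show ?thesis using that unfolding wit_def by simp
  qed
  have wit_univ: "wit q \<in> univ M" for q
  proof (cases q)
    case (fields p x l)
    show ?thesis
    proof (cases "\<exists>m\<in>univ M. sat M ((\<lambda>k. l ! k)(x := m)) p")
      case True
      then show ?thesis using wit fields by blast
    next
      case False
      then show ?thesis using d S(1) fields by (auto simp: wit_def)
    qed
  qed
  define G where "G S = S \<union> wit ` (UNIV \<times> UNIV \<times> lists S)" for S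
  define N where "N = (\<Union>n. (G ^^ n) S)"
  have G_Suc: "(G ^^ Suc n) S = (G ^^ n) S \<union> wit ` (UNIV \<times> UNIV \<times> lists ((G ^^ n) S))" for n
    unfolding funpow.simps comp_def by (rule G_def)
  have card: "|(G ^^ n) S| \<le>o |?U|" for n
  proof (induction n)
    case (Suc n)
    have "|(UNIV :: nat set) \<times> lists ((G ^^ n) S)| \<le>o |?U|"
      by (intro card_of_Times_ordLeq card_of_lists_ordLeq infinite_UNIV_fm card_nat_ordLeq_fm Suc)
    then have "|?U \<times> (UNIV :: nat set) \<times> lists ((G ^^ n) S)| \<le>o |?U|"
      by (rule card_of_Times_ordLeq[OF infinite_UNIV_fm card_of_mono1[OF subset_UNIV]])
    then have "|wit ` (?U \<times> (UNIV :: nat set) \<times> lists ((G ^^ n) S))| \<le>o |?U|"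
      by (rule ordLeq_transitive[OF card_of_image])
    then show ?case unfolding G_Suc
      by (intro card_of_Un_ordLeq_infinite_Field[OF _ Suc])
        (simp_all add: Field_card_of card_of_card_order_on infinite_UNIV_fm)
  qed (use S in simp)
  have "|N| \<le>o |?U|"
    unfolding N_def by (intro card_of_UNION_ordLeq_infinite infinite_UNIV_fm card_nat_ordLeq_fm) (simp add: card)
  moreover have "S \<subseteq> N" unfolding N_def by (rule subset_trans[OF _ UN_upper[of 0]]) auto
  moreover have "elementary_in L M N"
    unfolding elementary_in_def
  proof (intro conjI allI impI)
    have "(G ^^ n) S \<subseteq> univ M" for n
    proof (induction n)
      case (Suc n)
      then show ?case using wit_univ unfolding G_Suc by blast
    qed (use S in simp)
    then show "N \<subseteq> univ M" unfolding N_def by blast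
    have mono: "(G ^^ n) S \<subseteq> (G ^^ (n + k)) S" for n k
    proof (induction k)
      case (Suc k)
      then show ?case unfolding add_Suc_right G_Suc by blast
    qed simp
    fix p :: "('f, 'r, nat) fm" and x e
    assume e: "range e \<subseteq> N" and ex: "\<exists>m\<in>univ M. sat M (e(x := m)) p"
    obtain K where K: "\<And>k. k \<in> fv p \<Longrightarrow> k < K"
      using finite_nat_set_iff_bounded[of "fv p"] by auto
    have eq: "sat M (e(x := m)) p \<longleftrightarrow> sat M ((\<lambda>k. map e [0..<K] ! k)(x := m)) p" for m
      by (intro sat_cong) (use K in auto)
    have "\<exists>n. e k \<in> (G ^^ n) S" for k using range_subsetD[OF e, of k] unfolding N_def by blast
    then obtain lev where lev: "\<And>k. e k \<in> (G ^^ lev k) S" by metis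
    define n where "n = Max (insert 0 (lev ` {..<K}))"
    have "e k \<in> (G ^^ n) S" if "k < K" for k
    proof -
      have "lev k \<le> n" unfolding n_def using that by (intro Max_ge) auto
      then show ?thesis using lev[of k] mono[of "lev k" "n - lev k"] by auto
    qed
    then have "map e [0..<K] \<in> lists ((G ^^ n) S)" by auto
    then have "wit (p, x, map e [0..<K]) \<in> (G ^^ Suc n) S" unfolding G_Suc by blast
    then have "wit (p, x, map e [0..<K]) \<in> N" unfolding N_def by blast
    moreover have "sat M (e(x := wit (p, x, map e [0..<K]))) p"
      using wit[of "map e [0..<K]" x p] ex unfolding eq by blast
    ultimately show "\<exists>m\<in>N. sat M (e(x := m)) p" by blast
  qed
  ultimately show ?thesis by blast
qed

text \<open>\<open>entails\<close> speaks only of models made of formulas. An assignment in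
  \<open>M\<close> lies in an elementary substructure small enough to be copied into that type; the
  copy is a model of \<open>T\<close>, so the sentence holds there and can be carried back.\<close>

lemma entails_holds:
  fixes M :: "('f, 'r, 'm) struct"
  assumes ent: "entails L T s" and M: "is_model L T M" and T: "positive_theory L T"
    and s: "wf_fm L (fst s)" "wf_fm L (snd s)"
  shows "holds M s"
  unfolding holds_def
proof (intro allI impI)
  fix e :: "nat \<Rightarrow> 'm"
  assume e: "range e \<subseteq> univ M" "sat M e (fst s)"
  have "|range e| \<le>o |UNIV :: ('f, 'r, nat) fm set|"
    by (rule ordLeq_transitive[OF card_of_image card_nat_ordLeq_fm])
  then obtain N where N: "range e \<subseteq> N" "elementary_in L M N" "|N| \<le>o |UNIV :: ('f, 'r, nat) fm set|"
    using ex_elementary[OF e(1), of L] by blast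
  obtain h :: "'m \<Rightarrow> ('f, 'r, nat) fm" where h: "inj_on h N" using N(3) card_of_ordLeq by metis
  define j where "j = inv_into N h"
  have jh: "j (h m) = m" if "m \<in> N" for m using h that unfolding j_def by simp
  have NM: "N \<subseteq> univ M" using N(2) unfolding elementary_in_def by blast
  have elem: "\<exists>m\<in>N. sat M (e(x := m)) p" if "wf_fm L p" "range e \<subseteq> N" "\<exists>m\<in>univ M. sat M (e(x := m)) p"
    for p :: "('f, 'r, nat) fm" and x e using N(2) that unfolding elementary_in_def by blast
  have fint: "fint M f xs \<in> N" if f: "f \<in> funs L" "length xs = farity L f" "set xs \<subseteq> N" for f xs
  proof -
    define n where "n = length xs"
    define e' where "e' k = (if k < n then xs ! k else e 0)" for k
    \<comment> \<open>The existential criterion for this equation says that \<open>N\<close> is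
      closed under \<open>f\<close>.\<close>
    define p :: "('f, 'r, nat) fm" where "p = Eq (Var n) (Fn f (map Var [0..<n]))"
    have "map (tval M (e'(n := m))) (map Var [0..<n]) = xs" for m
      by (rule nth_equalityI) (auto simp: n_def e'_def)
    then have sat: "sat M (e'(n := m)) p \<longleftrightarrow> m = fint M f xs" for m
      by (simp only: p_def sat.simps tval.simps fun_upd_same)
    have "wf_fm L p" unfolding p_def using f by (auto simp: n_def list_all_iff)
    moreover have "range e' \<subseteq> N" using f(3) N(1) by (auto simp: e'_def n_def)
    moreover have "fint M f xs \<in> univ M"
      using M f NM unfolding is_model_def is_struct_def by (auto simp: lists_eq_set)
    ultimately show ?thesis using elem[of p e' n] unfolding sat by blast
  qed
  define N' :: "('f, 'r, ('f, 'r, nat) fm) struct" where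
    "N' = \<lparr>univ = h ` N, fint = (\<lambda>f xs. h (fint M f (map j xs))), rint = (\<lambda>r xs. rint M r (map j xs))\<rparr>"
  have tval: "tval N' u t \<in> h ` N \<and> j (tval N' u t) = tval M (\<lambda>k. j (u k)) t"
    if u: "range u \<subseteq> h ` N" and t: "wf_tm L t" for u and t :: "('f, nat) tm"
    using t
  proof (induction t)
    case (Var x)
    then show ?case using u by auto
  next
    case (Fn f ts)
    have IH: "tval N' u t \<in> h ` N \<and> j (tval N' u t) = tval M (\<lambda>k. j (u k)) t" if "t \<in> set ts" for t
      using Fn that by (auto simp: list_all_iff)
    then have "map (j \<circ> tval N' u) ts = map (tval M (\<lambda>k. j (u k))) ts" by (intro map_cong) auto
    moreover have "set (map (tval M (\<lambda>k. j (u k))) ts) \<subseteq> N"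
    proof -
      have "tval M (\<lambda>k. j (u k)) t \<in> N" if "t \<in> set ts" for t using IH[OF that] jh by fastforce
      then show ?thesis by auto
    qed
    then have "fint M f (map (tval M (\<lambda>k. j (u k))) ts) \<in> N" using Fn.prems by (intro fint) auto
    ultimately show ?case by (simp add: N'_def[THEN arg_cong[of _ _ "struct.fint"]] jh del: map_eq_conv)
  qed
  have sat: "sat N' u p \<longleftrightarrow> sat M (\<lambda>k. j (u k)) p" if "range u \<subseteq> h ` N" and "wf_fm L p"
    for u and p :: "('f, 'r, nat) fm"
    using that
  proof (induction p arbitrary: u)
    case (Rel r ts)
    have "map (j \<circ> tval N' u) ts = map (tval M (\<lambda>k. j (u k))) ts"
      using Rel tval by (intro map_cong) (auto simp: list_all_iff)
    then show ?case by (simp add: N'_def[THEN arg_cong[of _ _ "struct.rint"]] del: map_eq_conv)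
  next
    case (Eq s t)
    then have "tval N' u s \<in> h ` N" "tval N' u t \<in> h ` N" using tval by auto
    then have "tval N' u s = tval N' u t \<longleftrightarrow> j (tval N' u s) = j (tval N' u t)"
      using jh by fastforce
    then show ?case using tval[of u s] tval[of u t] Eq by simp
  next
    case (Ex x p)
    have *: "sat N' (u(x := h m)) p \<longleftrightarrow> sat M ((\<lambda>k. j (u k))(x := m)) p" if m: "m \<in> N" for m
    proof -
      have "sat N' (u(x := h m)) p \<longleftrightarrow> sat M (\<lambda>k. j ((u(x := h m)) k)) p"
        using Ex.prems m by (intro Ex.IH) auto
      moreover have "(\<lambda>k. j ((u(x := h m)) k)) = (\<lambda>k. j (u k))(x := m)" using jh[OF m] by auto
      ultimately show ?thesis by simp
    qed
    have ran: "range (\<lambda>k. j (u k)) \<subseteq> N" using Ex.prems(1) jh by fastforce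
    have "sat N' u (fm.Ex x p) \<longleftrightarrow> (\<exists>m\<in>N. sat M ((\<lambda>k. j (u k))(x := m)) p)"
      using * by (simp add: N'_def[THEN arg_cong[of _ _ "struct.univ"]])
    also have "\<dots> \<longleftrightarrow> (\<exists>m\<in>univ M. sat M ((\<lambda>k. j (u k))(x := m)) p)"
    proof
      show "\<exists>m\<in>N. sat M ((\<lambda>k. j (u k))(x := m)) p" if "\<exists>m\<in>univ M. sat M ((\<lambda>k. j (u k))(x := m)) p"
        using Ex.prems(2) ran that by (intro elem) auto
    qed (use NM in blast)
    finally show ?case by simp
  qed simp_all
  have holds: "holds N' q \<longleftrightarrow> (\<forall>u. range u \<subseteq> N \<longrightarrow> sat M u (fst q) \<longrightarrow> sat M u (snd q))"
    if q: "wf_fm L (fst q)" "wf_fm L (snd q)" for q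
  proof
    assume *: "holds N' q"
    show "\<forall>u. range u \<subseteq> N \<longrightarrow> sat M u (fst q) \<longrightarrow> sat M u (snd q)"
    proof (intro allI impI)
      fix u :: "nat \<Rightarrow> 'm" assume u: "range u \<subseteq> N" "sat M u (fst q)"
      have ju: "(\<lambda>k. j (h (u k))) = u" using u(1) jh by auto
      have ran: "range (\<lambda>k. h (u k)) \<subseteq> h ` N" using u(1) by auto
      have "range (\<lambda>k. h (u k)) \<subseteq> univ N'" using ran by (simp add: N'_def)
      then show "sat M u (snd q)"
        using * u(2) sat[OF ran q(1)] sat[OF ran q(2)] unfolding holds_def ju by blast
    qed
  next
    assume *: "\<forall>u. range u \<subseteq> N \<longrightarrow> sat M u (fst q) \<longrightarrow> sat M u (snd q)"
    show "holds N' q"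
      unfolding holds_def
    proof (intro allI impI)
      fix u assume u: "range u \<subseteq> univ N'" "sat N' u (fst q)"
      have ran: "range u \<subseteq> h ` N" using u(1) by (simp add: N'_def)
      moreover have "range (\<lambda>k. j (u k)) \<subseteq> N" using ran jh by fastforce
      ultimately show "sat N' u (snd q)" using * u(2) sat[OF ran q(1)] sat[OF ran q(2)] by blast
    qed
  qed
  have "is_model L T N'"
    unfolding is_model_def
  proof (intro conjI ballI)
    show "is_struct L N'"
      unfolding is_struct_def
    proof (intro conjI ballI impI)
      show "univ N' \<noteq> {}" using N(1) by (auto simp: N'_def)
      fix f xs assume f: "f \<in> funs L" and "xs \<in> lists (univ N')" "length xs = farity L f"
      then have "set (map j xs) \<subseteq> N" "length (map j xs) = farity L f" using jh by (auto simp: N'_def)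
      then show "struct.fint N' f xs \<in> univ N'" using fint[OF f] by (simp add: N'_def)
    qed
    fix q assume q: "q \<in> T"
    then have "wf_fm L (fst q)" "wf_fm L (snd q)" using T unfolding positive_theory_def by auto
    moreover have "holds M q" using M q unfolding is_model_def by blast
    ultimately show "holds N' q" using holds NM unfolding holds_def[of M] by (meson subset_trans)
  qed
  then have "holds N' s" using ent unfolding entails_def by blast
  then show "sat M e (snd s)" using holds[OF s] N(1) e(2) by blast
qed

text \<open>If \<open>p\<close> holds at \<open>e'\<close> but not at \<open>e\<close>, existential
  closedness gives a positive \<open>q\<close> true at \<open>e\<close> and contradicting
  \<open>p\<close>. By the inclusion \<open>q\<close> also holds at \<open>e'\<close>, which is
  absurd. This substitutes for the missing negations whenever compactness has to produce a
  prescribed type.\<close>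

lemma ec_color_maximal:
  fixes M :: "('f, 'r, 'm) struct"
  assumes ec: "ec_model L T M" and T: "positive_theory L T"
    and e: "e ` W \<subseteq> univ M" "e' ` W \<subseteq> univ M" and sub: "color L M W e \<subseteq> color L M W e'"
  shows "color L M W e' = color L M W e"
proof (rule subset_antisym[OF _ sub], rule ccontr)
  assume "\<not> color L M W e' \<subseteq> color L M W e"
  then obtain p l where pl: "(p, l) \<in> fm_list L W" "sat M (\<lambda>k. e' (l ! k)) p" "\<not> sat M (\<lambda>k. e (l ! k)) p"
    unfolding color_def by blast
  then have p: "wf_fm L p" "set l \<subseteq> W" "fv p \<subseteq> {..<length l}" unfolding fm_list_def by (auto simp: lists_eq_set)
  have M: "is_model L T M" using ec unfolding ec_model_def by blast
  then obtain d where d: "d \<in> univ M" unfolding is_model_def is_struct_def by blast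
  \<comment> \<open>Existential closedness is stated for assignments with all values in the
    universe, hence the padding by \<open>d\<close>.\<close>
  define E where "E g k = (if k < length l then g (l ! k) else d)" for g :: "'a \<Rightarrow> 'm" and k
  have ran: "range (E g) \<subseteq> univ M" if "g ` W \<subseteq> univ M" for g
  proof -
    have "g (l ! k) \<in> univ M" if "k < length l" for k using that p(2) \<open>g ` W \<subseteq> univ M\<close> nth_mem by blast
    then show ?thesis using d by (auto simp: E_def)
  qed
  have sat: "sat M (E g) q \<longleftrightarrow> sat M (\<lambda>k. g (l ! k)) q" if "fv q \<subseteq> fv p" for g q
    by (intro sat_cong) (use that p(3) in \<open>auto simp: E_def\<close>)
  obtain q where q: "wf_fm L q" "fv q \<subseteq> fv p" "entails L T (And p q, Bot)" "sat M (E e) q"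
    using ec p(1) ran[OF e(1)] pl(3) sat[OF order_refl] unfolding ec_model_def by metis
  have "(q, l) \<in> color L M W e"
    using q sat[OF q(2)] p unfolding color_def fm_list_def by (auto simp: lists_eq_set)
  then have "sat M (\<lambda>k. e' (l ! k)) q" using sub unfolding color_def by blast
  then have "sat M (E e') (And p q)" using sat[OF q(2)] sat[OF order_refl] pl(2) by simp
  moreover have "holds M (And p q, Bot)"
    by (rule entails_holds[OF q(3) M T]) (use p q in simp_all)
  ultimately show False using ran[OF e(2)] unfolding holds_def by fastforce
qed

section \<open>Saturation for small tuples of variables\<close>

lemma sat_foldr_Ex:
  "sat M e (foldr fm.Ex xs p) \<longleftrightarrow>
    (\<exists>e'. (\<forall>x. x \<notin> set xs \<longrightarrow> e' x = e x) \<and> e' ` set xs \<subseteq> univ M \<and> sat M e' p)"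
proof (induction xs arbitrary: e)
  case Nil
  have "e' = e" if "\<forall>x. e' x = e x" for e' using that by blast
  then show ?case by auto
next
  case (Cons y ys)
  show ?case
  proof
    assume "sat M e (foldr fm.Ex (y # ys) p)"
    then obtain m where m: "m \<in> univ M" "sat M (e(y := m)) (foldr fm.Ex ys p)" by auto
    then obtain e' where e': "\<And>x. x \<notin> set ys \<Longrightarrow> e' x = (e(y := m)) x" "e' ` set ys \<subseteq> univ M" "sat M e' p"
      using Cons.IH by blast
    have "e' y \<in> univ M" using e'(1)[of y] e'(2) m(1) by (cases "y \<in> set ys") auto
    moreover have "e' x = e x" if "x \<notin> set (y # ys)" for x using e'(1)[of x] that by auto
    ultimately show "\<exists>e'. (\<forall>x. x \<notin> set (y # ys) \<longrightarrow> e' x = e x) \<and> e' ` set (y # ys) \<subseteq> univ M \<and> sat M e' p"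
      using e'(2,3) by (intro exI[of _ e']) auto
  next
    assume "\<exists>e'. (\<forall>x. x \<notin> set (y # ys) \<longrightarrow> e' x = e x) \<and> e' ` set (y # ys) \<subseteq> univ M \<and> sat M e' p"
    then obtain e' where e': "\<And>x. x \<notin> set (y # ys) \<Longrightarrow> e' x = e x" "e' ` set (y # ys) \<subseteq> univ M" "sat M e' p"
      by blast
    have "sat M (e(y := e' y)) (foldr fm.Ex ys p)"
      unfolding Cons.IH using e' by (intro exI[of _ e']) auto
    then show "sat M e (foldr fm.Ex (y # ys) p)" using e'(2) by auto
  qed
qed

lemma fv_foldr_Ex: "fv (foldr fm.Ex xs p) = fv p - set xs"
  by (induction xs) auto

lemma wf_foldr_Ex: "wf_fm L (foldr fm.Ex xs p) = wf_fm L p"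
  by (induction xs) auto

lemma sat_foldr_And: "sat M e (foldr And ps Top) \<longleftrightarrow> (\<forall>p\<in>set ps. sat M e p)"
  by (induction ps) auto

lemma fv_foldr_And: "fv (foldr And ps Top) = (\<Union>p\<in>set ps. fv p)"
  by (induction ps) auto

lemma wf_foldr_And: "wf_fm L (foldr And ps Top) \<longleftrightarrow> (\<forall>p\<in>set ps. wf_fm L p)"
  by (induction ps) auto

lemma satp_cong:
  assumes "\<And>v. Inl v \<in> fv p \<Longrightarrow> a v = a' v"
  shows "satp M a p \<longleftrightarrow> satp M a' p"
  unfolding satp_alt
proof (rule sat_cong)
  fix x assume "x \<in> fv p"
  then show "param_val a x = param_val a' x" using assms by (cases x) auto
qed

text \<open>The conjunction of \<open>S\<close> with the variables in \<open>D\<close> replaced by the values of \<open>g\<close> and all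
  others except \<open>v\<close> quantified; \<open>v\<close> becomes the variable \<open>0\<close>.\<close>

lemma ex_projection:
  fixes M :: "('f, 'r, 'm) struct" and S :: "('f, 'r, 'v + 'm) fm set"
  assumes d: "d \<in> univ M" and S: "finite S" "S \<subseteq> fm_over L V A"
    and v: "v \<in> V - D" and g: "g ` D \<subseteq> univ M"
  shows "\<exists>q \<in> fm_over L (UNIV :: nat set) (A \<union> g ` D). \<forall>e. range e \<subseteq> univ M \<longrightarrow>
    (satp M e q \<longleftrightarrow> (\<exists>e'. e' ` V \<subseteq> univ M \<and> (\<forall>u\<in>D. e' u = g u) \<and> e' v = e 0 \<and> (\<forall>p\<in>S. satp M e' p)))"
proof -
  obtain ps where ps: "set ps = S" using finite_list[OF S(1)] by auto
  define P where "P = foldr And ps Top"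
  have P: "wf_fm L P" "fv P \<subseteq> V <+> A"
    using S(2) unfolding P_def wf_foldr_And fv_foldr_And ps fm_over_def by auto
  have satP: "satp M e P \<longleftrightarrow> (\<forall>p\<in>S. satp M e p)" for e unfolding P_def satp_alt sat_foldr_And ps ..
  define K where "K = {u. Inl u \<in> fv P \<and> u \<notin> D \<and> u \<noteq> v}"
  have "finite K" unfolding K_def by (rule finite_subset[OF _ finite_vimageI[of "fv P" Inl]]) auto
  then obtain ks where ks: "set ks = K" using finite_list by auto
  define idx where "idx u = (SOME k. k < length ks \<and> ks ! k = u)" for u
  have idx: "idx u < length ks \<and> ks ! idx u = u" if "u \<in> K" for u
    unfolding idx_def by (rule someI_ex) (use that ks in \<open>auto simp: in_set_conv_nth\<close>)
  define \<rho> where "\<rho> = case_sum (\<lambda>u. if u \<in> D then Inr (g u) else if u = v then Inl 0 else Inl (Suc (idx u))) Inr"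
  define xs :: "(nat + 'm) list" where "xs = map (\<lambda>k. Inl (Suc k)) [0..<length ks]"
  define q where "q = foldr fm.Ex xs (ren P \<rho>)"
  have inf: "infinite (UNIV :: (nat + 'm) set)" by simp
  have "fv q \<subseteq> UNIV <+> (A \<union> g ` D)"
  proof
    fix z assume "z \<in> fv q"
    then have "z \<in> fv (ren P \<rho>)" unfolding q_def fv_foldr_Ex by blast
    then obtain w where w: "w \<in> fv P" "z = \<rho> w" using fv_ren[of P \<rho>] by blast
    then show "z \<in> UNIV <+> (A \<union> g ` D)" using P(2) by (cases w) (auto simp: \<rho>_def)
  qed
  then have "q \<in> fm_over L UNIV (A \<union> g ` D)" using P(1) by (simp add: fm_over_def q_def wf_foldr_Ex)
  moreover have "satp M e q \<longleftrightarrow>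
    (\<exists>e'. e' ` V \<subseteq> univ M \<and> (\<forall>u\<in>D. e' u = g u) \<and> e' v = e 0 \<and> (\<forall>p\<in>S. satp M e' p))"
    (is "_ \<longleftrightarrow> ?R") if e: "range e \<subseteq> univ M" for e
  proof
    assume "satp M e q"
    then obtain E where E: "\<And>x. x \<notin> set xs \<Longrightarrow> E x = param_val e x" "E ` set xs \<subseteq> univ M"
      "sat M (\<lambda>x. E (\<rho> x)) P"
      unfolding satp_alt q_def sat_foldr_Ex sat_ren[OF inf] by blast
    define e' where "e' u = (if u \<in> D then g u else if u = v then e 0
      else if u \<in> K then E (Inl (Suc (idx u))) else d)" for u
    have e'_univ: "e' u \<in> univ M" for u
    proof -
      have "E (Inl (Suc (idx u))) \<in> univ M" if "u \<in> K"
        using E(2) idx[OF that] by (auto simp: xs_def)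
      then show ?thesis using e g d by (auto simp: e'_def)
    qed
    have "satp M e' P"
    proof -
      have "param_val e' x = E (\<rho> x)" if x: "x \<in> fv P" for x
      proof (cases x)
        case (Inl u)
        have "Inl 0 \<notin> set xs" "Inr c \<notin> set xs" for c by (auto simp: xs_def)
        then have "E (Inl 0) = e 0" "E (Inr (g u)) = g u" using E(1) by auto
        then show ?thesis using Inl x by (auto simp: e'_def \<rho>_def K_def)
      next
        case (Inr c)
        have "Inr c \<notin> set xs" by (auto simp: xs_def)
        then show ?thesis using Inr E(1) by (auto simp: \<rho>_def)
      qed
      then have "sat M (param_val e') P \<longleftrightarrow> sat M (\<lambda>x. E (\<rho> x)) P" by (rule sat_cong)
      then show ?thesis using E(3) unfolding satp_alt by blast
    qed
    moreover have "e' ` V \<subseteq> univ M" "\<forall>u\<in>D. e' u = g u" using e'_univ by (blast, simp add: e'_def)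
    moreover have "e' v = e 0" using v by (simp add: e'_def)
    ultimately show ?R unfolding satP by blast
  next
    assume ?R
    then obtain e' where e': "e' ` V \<subseteq> univ M" "\<And>u. u \<in> D \<Longrightarrow> e' u = g u" "e' v = e 0" "satp M e' P"
      unfolding satP by blast
    define E where "E x = (if x \<in> set xs then (case x of Inl k \<Rightarrow> e' (ks ! (k - 1)) | Inr c \<Rightarrow> c)
      else param_val e x)" for x
    have "E ` set xs \<subseteq> univ M"
    proof -
      have "K \<subseteq> V" using P(2) by (auto simp: K_def)
      then have "e' (ks ! k) \<in> univ M" if "k < length ks" for k
        using e'(1) nth_mem[OF that] ks by blast
      then show ?thesis by (auto simp: E_def xs_def)
    qed
    moreover have "sat M (\<lambda>x. E (\<rho> x)) P"
    proof -
      have "E (\<rho> x) = param_val e' x" if x: "x \<in> fv P" for x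
      proof (cases x)
        case (Inl u)
        consider "u \<in> D" | "u = v" | "u \<in> K" using x Inl by (auto simp: K_def)
        then show ?thesis
        proof cases
          case 3
          then have "\<rho> x = Inl (Suc (idx u))" using Inl by (auto simp: \<rho>_def K_def)
          moreover have "Inl (Suc (idx u)) \<in> set xs" using idx[OF 3] by (auto simp: xs_def)
          ultimately show ?thesis using Inl idx[OF 3] by (simp add: E_def)
        qed (use Inl e' v in \<open>auto simp: \<rho>_def E_def xs_def\<close>)
      next
        case (Inr c)
        then show ?thesis by (auto simp: \<rho>_def E_def xs_def)
      qed
      then have "sat M (\<lambda>x. E (\<rho> x)) P \<longleftrightarrow> sat M (param_val e') P" by (rule sat_cong)
      then show ?thesis using e'(4) unfolding satp_alt by blast
    qed
    ultimately show "satp M e q"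
      unfolding satp_alt q_def sat_foldr_Ex sat_ren[OF inf] by (intro exI[of _ E]) (auto simp: E_def)
  qed
  ultimately show ?thesis by blast
qed

text \<open>\<open>saturated\<close> covers only the variables \<open>nat\<close>. A small set of
  variables is handled one variable at a time: by Zorn's lemma take a maximal partial assignment
  consistent with every finite part of \<open>\<Sigma>\<close>. A variable \<open>v\<close> outside
  its domain has, over the values already assigned, the small type consisting of all projections to
  \<open>v\<close>; saturation realises it, contradicting maximality.\<close>

lemma saturated_small_vars:
  fixes M :: "('f, 'r, 'm) struct" and \<Sigma> :: "('f, 'r, 'v + 'm) fm set"
  assumes \<kappa>: "Card_order \<kappa>" "infinite (Field \<kappa>)" and sat: "saturated L \<kappa> M"
    and V: "|V| <o \<kappa>" and A: "A \<subseteq> univ M" "|A| <o \<kappa>" and \<Sigma>: "\<Sigma> \<subseteq> fm_over L V A" and d: "d \<in> univ M"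
    and fin: "\<And>S. finite S \<Longrightarrow> S \<subseteq> \<Sigma> \<Longrightarrow> \<exists>e. e ` V \<subseteq> univ M \<and> (\<forall>p\<in>S. satp M e p)"
  shows "\<exists>e. e ` V \<subseteq> univ M \<and> (\<forall>p\<in>\<Sigma>. satp M e p)"
proof -
  define ok where "ok G \<longleftrightarrow> G \<subseteq> V \<times> univ M \<and> (\<forall>S. finite S \<longrightarrow> S \<subseteq> \<Sigma> \<longrightarrow>
    (\<exists>e. e ` V \<subseteq> univ M \<and> (\<forall>(v, m)\<in>G. e v = m) \<and> (\<forall>p\<in>S. satp M e p)))" for G
  have okI: "ok G" if "G \<subseteq> V \<times> univ M"
    "\<And>S. finite S \<Longrightarrow> S \<subseteq> \<Sigma> \<Longrightarrow> \<exists>e. e ` V \<subseteq> univ M \<and> (\<forall>(v, m)\<in>G. e v = m) \<and> (\<forall>p\<in>S. satp M e p)" for G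
    using that unfolding ok_def by blast
  have okD: "\<exists>e. e ` V \<subseteq> univ M \<and> (\<forall>(v, m)\<in>G. e v = m) \<and> (\<forall>p\<in>S. satp M e p)"
    if "ok G" "finite S" "S \<subseteq> \<Sigma>" for G S using that unfolding ok_def by blast
  have single: "m = m'" if vm: "ok G" "(v, m) \<in> G" "(v, m') \<in> G" for G v m m'
  proof -
    obtain e where "\<forall>(v, m)\<in>G. e v = m" using okD[OF vm(1), of "{}"] by auto
    from bspec[OF this vm(2)] bspec[OF this vm(3)] show ?thesis by simp
  qed
  have "\<exists>G\<in>Collect ok. \<forall>G'\<in>Collect ok. G \<subseteq> G' \<longrightarrow> G' = G"
  proof (rule subset_Zorn_nonempty)
    have "ok {}" by (rule okI) (use fin in auto)
    then show "Collect ok \<noteq> {}" by blast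
    fix \<C> assume \<C>: "\<C> \<noteq> {}" "subset.chain (Collect ok) \<C>"
    have ok\<C>: "ok G" if "G \<in> \<C>" for G using \<C>(2) that unfolding subset.chain_def by blast
    have lift: "\<exists>G\<in>\<C>. F \<subseteq> G" if "finite F" "F \<subseteq> \<Union>\<C>" for F
      using finite_subset_Union_chain[OF that \<C>] by blast
    have single: "m = m'" if vm: "(v, m) \<in> \<Union>\<C>" "(v, m') \<in> \<Union>\<C>" for v m m'
    proof -
      obtain G where "G \<in> \<C>" "{(v, m), (v, m')} \<subseteq> G" using lift[of "{(v, m), (v, m')}"] vm by blast
      then show ?thesis using single[OF ok\<C>] by blast
    qed
    define g where "g v = (THE m. (v, m) \<in> \<Union>\<C>)" for v
    have g: "g v = m" if "(v, m) \<in> \<Union>\<C>" for v m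
      unfolding g_def using that single by (intro the_equality)
    have "ok (\<Union>\<C>)"
    proof (rule okI)
      show sub: "\<Union>\<C> \<subseteq> V \<times> univ M" using ok\<C> unfolding ok_def by blast
      fix S assume S: "finite S" "S \<subseteq> \<Sigma>"
      \<comment> \<open>Only the finitely many pairs whose variable occurs in \<open>S\<close>
        matter, and they all lie in a single member of the chain.\<close>
      define F where "F = {(v, m) \<in> \<Union>\<C>. Inl v \<in> (\<Union>p\<in>S. fv p)}"
      have "F \<subseteq> (\<lambda>v. (v, g v)) ` (Inl -` (\<Union>p\<in>S. fv p))" using g by (auto simp: F_def)
      moreover have "finite (Inl -` (\<Union>p\<in>S. fv p) :: 'v set)" using S(1) by (intro finite_vimageI) auto
      ultimately have "finite F" using finite_subset by blast
      moreover have "F \<subseteq> \<Union>\<C>" by (auto simp: F_def)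
      ultimately obtain G where G: "G \<in> \<C>" "F \<subseteq> G" using lift by blast
      from okD[OF ok\<C>[OF G(1)] S] obtain e
        where e: "e ` V \<subseteq> univ M" "\<forall>(v, m)\<in>G. e v = m" "\<forall>p\<in>S. satp M e p" by (elim exE conjE)
      define e' where "e' v = (if v \<in> Domain (\<Union>\<C>) then g v else e v)" for v
      have "satp M e' p" if p: "p \<in> S" for p
      proof -
        have "e' v = e v" if v: "Inl v \<in> fv p" for v
        proof (cases "v \<in> Domain (\<Union>\<C>)")
          case True
          then obtain m where m: "(v, m) \<in> \<Union>\<C>" by blast
          then have "(v, m) \<in> F" using v p by (auto simp: F_def)
          then have "(v, m) \<in> G" using G(2) by blast
          from bspec[OF e(2) this] have "e v = m" by simp
          then show ?thesis using True g[OF m] by (simp add: e'_def)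
        qed (simp add: e'_def)
        then have "satp M e' p \<longleftrightarrow> satp M e p" by (rule satp_cong)
        then show ?thesis using bspec[OF e(3) p] by simp
      qed
      moreover have "e' ` V \<subseteq> univ M"
      proof -
        have "g v \<in> univ M" if "v \<in> Domain (\<Union>\<C>)" for v
        proof -
          obtain m where m: "(v, m) \<in> \<Union>\<C>" using \<open>v \<in> Domain (\<Union>\<C>)\<close> by blast
          then show ?thesis using sub g[OF m] by blast
        qed
        then show ?thesis using e(1) by (auto simp: e'_def)
      qed
      moreover have "\<forall>(v, m)\<in>\<Union>\<C>. e' v = m"
      proof (clarify)
        fix v m G assume "G \<in> \<C>" "(v, m) \<in> G"
        then have vm: "(v, m) \<in> \<Union>\<C>" by blast
        then have "v \<in> Domain (\<Union>\<C>)" by blast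
        then show "e' v = m" using g[OF vm] by (simp add: e'_def)
      qed
      ultimately show "\<exists>e. e ` V \<subseteq> univ M \<and> (\<forall>(v, m)\<in>\<Union>\<C>. e v = m) \<and> (\<forall>p\<in>S. satp M e p)"
        by (intro exI[of _ e']) simp
    qed
    then show "\<Union>\<C> \<in> Collect ok" by simp
  qed
  then obtain G where G: "ok G" and max: "\<And>G'. ok G' \<Longrightarrow> G \<subseteq> G' \<Longrightarrow> G' = G" by blast
  define D where "D = Domain G"
  define g where "g v = (THE m. (v, m) \<in> G)" for v
  have g: "g v = m" if "(v, m) \<in> G" for v m
    unfolding g_def using that single[OF G] by (intro the_equality)
  have Gg: "G = (\<lambda>v. (v, g v)) ` D"
    using g unfolding D_def by (auto simp: image_iff)
  have GV: "G \<subseteq> V \<times> univ M" using G unfolding ok_def by blast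
  have DV: "D \<subseteq> V" using GV unfolding D_def by blast
  have gD: "g ` D \<subseteq> univ M" using GV Gg by blast
  have agree: "(\<forall>(v, m)\<in>G. e v = m) \<longleftrightarrow> (\<forall>u\<in>D. e u = g u)" for e :: "'v \<Rightarrow> 'm"
    unfolding Gg by auto
  have "V \<subseteq> D"
  proof
    fix v assume vV: "v \<in> V"
    show "v \<in> D"
    proof (rule ccontr)
      assume vD: "v \<notin> D"
      define R where "R e S \<longleftrightarrow> (\<exists>e'. e' ` V \<subseteq> univ M \<and> (\<forall>u\<in>D. e' u = g u) \<and> e' v = e 0 \<and> (\<forall>p\<in>S. satp M e' p))"
        for e :: "nat \<Rightarrow> 'm" and S
      have "\<exists>q. q \<in> fm_over L (UNIV :: nat set) (A \<union> g ` D) \<and> (\<forall>e. range e \<subseteq> univ M \<longrightarrow> (satp M e q \<longleftrightarrow> R e S))"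
        if "finite S" "S \<subseteq> \<Sigma>" for S
        using ex_projection[OF d that(1) subset_trans[OF that(2) \<Sigma>], of v D g] vV vD gD
        unfolding R_def by blast
      then obtain Q where Q: "\<And>S. finite S \<Longrightarrow> S \<subseteq> \<Sigma> \<Longrightarrow> Q S \<in> fm_over L UNIV (A \<union> g ` D)"
        "\<And>S e. finite S \<Longrightarrow> S \<subseteq> \<Sigma> \<Longrightarrow> range e \<subseteq> univ M \<Longrightarrow> satp M e (Q S) \<longleftrightarrow> R e S"
        by metis
      let ?\<Sigma> = "Q ` {S. finite S \<and> S \<subseteq> \<Sigma>}"
      have "|g ` D| <o \<kappa>"
        using ordLeq_ordLess_trans[OF ordLeq_transitive[OF card_of_image card_of_mono1[OF DV]] V] .
      then have small: "|A \<union> g ` D| <o \<kappa>" by (rule card_of_Un_ordLess_infinite_Field[OF \<kappa>(2,1) A(2)])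
      have AD: "A \<union> g ` D \<subseteq> univ M" using A(1) gD by simp
      have over: "?\<Sigma> \<subseteq> fm_over L UNIV (A \<union> g ` D)" using Q(1) by blast
      have fin_sat: "\<exists>e. range e \<subseteq> univ M \<and> (\<forall>q\<in>\<Sigma>'. satp M e q)" if \<Sigma>': "\<Sigma>' \<subseteq> ?\<Sigma>" "finite \<Sigma>'" for \<Sigma>'
      proof -
        obtain SS where SS: "SS \<subseteq> {S. finite S \<and> S \<subseteq> \<Sigma>}" "finite SS" "\<Sigma>' = Q ` SS"
          using finite_subset_image[OF \<Sigma>'(2,1)] by blast
        \<comment> \<open>One assignment for the union of the finite sets yields a single value at
          \<open>v\<close> that satisfies all their projections at once.\<close>
        have "finite (\<Union>SS)" "\<Union>SS \<subseteq> \<Sigma>" using SS by auto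
        from okD[OF G this] obtain e
          where e: "e ` V \<subseteq> univ M" "\<forall>(v, m)\<in>G. e v = m" "\<forall>p\<in>\<Union>SS. satp M e p"
          by (elim exE conjE)
        have R: "R (\<lambda>_. e v) S" if "S \<in> SS" for S
          unfolding R_def using e that unfolding agree by (intro exI[of _ e]) auto
        have ran: "range (\<lambda>_. e v) \<subseteq> univ M" using e(1) vV by auto
        have "satp M (\<lambda>_. e v) (Q S)" if "S \<in> SS" for S
        proof -
          have "finite S" "S \<subseteq> \<Sigma>" using SS(1) that by auto
          from Q(2)[OF this ran] show ?thesis using R[OF that] by simp
        qed
        then show ?thesis using ran SS(3) by (intro exI[of _ "\<lambda>_. e v"]) auto
      qed
      have "\<forall>\<Sigma>'\<subseteq>?\<Sigma>. finite \<Sigma>' \<longrightarrow> (\<exists>e. range e \<subseteq> univ M \<and> (\<forall>q\<in>\<Sigma>'. satp M e q))"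
        by (intro allI impI) (rule fin_sat)
      from sat[unfolded saturated_def, THEN spec, THEN mp, OF AD, THEN mp, OF small,
          THEN spec, THEN mp, OF over, THEN mp, OF this]
      obtain e where e: "range e \<subseteq> univ M" "\<forall>q\<in>?\<Sigma>. satp M e q" by (elim exE conjE)
      have "ok (insert (v, e 0) G)"
      proof (rule okI)
        show "insert (v, e 0) G \<subseteq> V \<times> univ M" using GV vV e(1) by blast
        fix S assume S: "finite S" "S \<subseteq> \<Sigma>"
        then have "satp M e (Q S)" using e(2) by blast
        then have "R e S" using Q(2)[OF S e(1)] by simp
        then obtain e' where e': "e' ` V \<subseteq> univ M" "\<forall>u\<in>D. e' u = g u" "e' v = e 0" "\<forall>p\<in>S. satp M e' p"
          unfolding R_def by blast
        have "\<forall>(v, m)\<in>G. e' v = m" using e'(2) unfolding agree .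
        then show "\<exists>e'. e' ` V \<subseteq> univ M \<and> (\<forall>(v, m)\<in>insert (v, e 0) G. e' v = m) \<and> (\<forall>p\<in>S. satp M e' p)"
          using e' by (intro exI[of _ e']) simp
      qed
      then have "insert (v, e 0) G = G" by (rule max) blast
      then show False using vD unfolding D_def by blast
    qed
  qed
  have "satp M g p" if p: "p \<in> \<Sigma>" for p
  proof -
    have "finite {p}" "{p} \<subseteq> \<Sigma>" using p by auto
    from okD[OF G this] obtain e where e: "\<forall>(v, m)\<in>G. e v = m" "\<forall>q\<in>{p}. satp M e q"
      by (elim exE conjE)
    have "fv p \<subseteq> V <+> A" using \<Sigma> p unfolding fm_over_def by blast
    then have "g v = e v" if "Inl v \<in> fv p" for v
      using that e(1) \<open>V \<subseteq> D\<close> unfolding agree by auto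
    then have "satp M g p \<longleftrightarrow> satp M e p" by (rule satp_cong)
    then show ?thesis using e(2) by simp
  qed
  moreover have "g ` V \<subseteq> univ M" using gD \<open>V \<subseteq> D\<close> by blast
  ultimately show ?thesis by blast
qed

section \<open>Counting formulas\<close>

lemma card_of_Un_ordLeq:
  assumes "infinite Q" "|A| \<le>o |Q|" "|B| \<le>o |Q|"
  shows "|A \<union> B| \<le>o |Q|"
  using assms by (intro card_of_Un_ordLeq_infinite_Field) (simp_all add: Field_card_of card_of_card_order_on)

text \<open>A countable union of levels of size at most \<open>|Q|\<close> is no larger than
  \<open>Q\<close>; with \<open>size\<close> as measure this counts terms and formulas by
  recursion.\<close>

lemma card_of_by_measure:
  fixes m :: "'a \<Rightarrow> nat"
  assumes Q: "infinite Q"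
    and step: "\<And>n. |{x \<in> S. m x < n}| \<le>o |Q| \<Longrightarrow> |{x \<in> S. m x < Suc n}| \<le>o |Q|"
  shows "|S| \<le>o |Q|"
proof -
  have "|{x \<in> S. m x < n}| \<le>o |Q|" for n
  proof (induction n)
    case (Suc n)
    then show ?case by (rule step)
  qed (simp add: card_of_empty)
  then have "|\<Union>n. {x \<in> S. m x < n}| \<le>o |Q|"
    using Q infinite_iff_card_of_nat by (intro card_of_UNION_ordLeq_infinite) auto
  moreover have "S = (\<Union>n. {x \<in> S. m x < n})" by auto
  ultimately show ?thesis by simp
qed

lemma card_of_wf_tm:
  fixes L :: "('f, 'r) lang"
  assumes Q: "infinite Q" "|funs L| \<le>o |Q|"
  shows "|{t :: ('f, nat) tm. wf_tm L t}| \<le>o |Q|"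
proof (rule card_of_by_measure[where m = size, OF Q(1)])
  fix n
  let ?T = "{t \<in> {t :: ('f, nat) tm. wf_tm L t}. size t < n}"
  assume T: "|?T| \<le>o |Q|"
  have "{t \<in> {t :: ('f, nat) tm. wf_tm L t}. size t < Suc n} \<subseteq>
    range Var \<union> (\<lambda>(f, ts). Fn f ts) ` (funs L \<times> lists ?T)"
  proof
    fix t :: "('f, nat) tm" assume t: "t \<in> {t \<in> {t. wf_tm L t}. size t < Suc n}"
    show "t \<in> range Var \<union> (\<lambda>(f, ts). Fn f ts) ` (funs L \<times> lists ?T)"
    proof (cases t)
      case (Fn f ts)
      have "size u < n" if "u \<in> set ts" for u
        using size_list_estimation'[OF that, of "size u" size] t Fn by simp
      then have "ts \<in> lists ?T" using t Fn by (auto simp: list_all_iff)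
      then show ?thesis using t Fn by auto
    qed simp
  qed
  moreover have "|range Var \<union> (\<lambda>(f, ts). Fn f ts) ` (funs L \<times> lists ?T)| \<le>o |Q|"
    using Q T infinite_iff_card_of_nat
    by (intro card_of_Un_ordLeq ordLeq_transitive[OF card_of_image] card_of_Times_ordLeq card_of_lists_ordLeq) auto
  ultimately show "|{t \<in> {t :: ('f, nat) tm. wf_tm L t}. size t < Suc n}| \<le>o |Q|"
    by (rule ordLeq_transitive[OF card_of_mono1])
qed

lemma card_of_wf_fm:
  fixes L :: "('f, 'r) lang"
  assumes Q: "infinite Q" "|funs L| \<le>o |Q|" "|rels L| \<le>o |Q|"
  shows "|{p :: ('f, 'r, nat) fm. wf_fm L p}| \<le>o |Q|"
proof (rule card_of_by_measure[where m = size, OF Q(1)])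
  fix n
  let ?T = "{t :: ('f, nat) tm. wf_tm L t}"
  let ?F = "{p \<in> {p :: ('f, 'r, nat) fm. wf_fm L p}. size p < n}"
  assume F: "|?F| \<le>o |Q|"
  let ?G = "(\<lambda>(r, ts). Rel r ts) ` (rels L \<times> lists ?T) \<union> (\<lambda>(s, t). Eq s t) ` (?T \<times> ?T) \<union>
    {Top} \<union> {Bot} \<union> (\<lambda>(p, q). And p q) ` (?F \<times> ?F) \<union> (\<lambda>(p, q). Or p q) ` (?F \<times> ?F) \<union>
    (\<lambda>(x, p). fm.Ex x p) ` (UNIV \<times> ?F)"
  have "{p \<in> {p :: ('f, 'r, nat) fm. wf_fm L p}. size p < Suc n} \<subseteq> ?G"
  proof
    fix p :: "('f, 'r, nat) fm" assume "p \<in> {p \<in> {p. wf_fm L p}. size p < Suc n}"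
    then show "p \<in> ?G" by (cases p) (auto simp: list_all_iff image_iff)
  qed
  moreover have "|?G| \<le>o |Q|"
    using Q F infinite_iff_card_of_nat card_of_wf_tm[OF Q(1,2)] infinite_imp_nonempty[OF Q(1)]
    by (intro card_of_Un_ordLeq ordLeq_transitive[OF card_of_image] card_of_Times_ordLeq
        card_of_lists_ordLeq card_of_singl_ordLeq) auto
  ultimately show "|{p \<in> {p :: ('f, 'r, nat) fm. wf_fm L p}. size p < Suc n}| \<le>o |Q|"
    by (rule ordLeq_transitive[OF card_of_mono1])
qed

lemma card_of_fm_list:
  assumes Q: "infinite Q" "|funs L| \<le>o |Q|" "|rels L| \<le>o |Q|" and W: "|W| \<le>o |Q|"
  shows "|fm_list L W| \<le>o |Q|"
proof -
  have "fm_list L W \<subseteq> {p. wf_fm L p} \<times> lists W" by (auto simp: fm_list_def)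
  then show ?thesis
    by (rule ordLeq_transitive[OF card_of_mono1
          card_of_Times_ordLeq[OF Q(1) card_of_wf_fm[OF Q] card_of_lists_ordLeq[OF Q(1) W]]])
qed


section \<open>Strictly sorted lists\<close>

lemma sorted_wrt_unique:
  assumes asym: "\<And>x y. R x y \<Longrightarrow> \<not> R y x"
    and "sorted_wrt R xs" "sorted_wrt R ys" "set xs = set ys"
  shows "xs = ys"
  using assms(2-)
proof (induction xs arbitrary: ys)
  case (Cons x xs)
  then obtain y ys' where ys: "ys = y # ys'" by (cases ys) auto
  have notin: "x \<notin> set xs" "y \<notin> set ys'" using Cons.prems(1,2) ys asym[of x x] asym[of y y] by auto
  have "x = y"
  proof (rule ccontr)
    assume "x \<noteq> y"
    then have "x \<in> set ys'" "y \<in> set xs" using Cons.prems(3) ys by auto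
    then have "R y x" "R x y" using Cons.prems(1,2) ys by auto
    then show False using asym by blast
  qed
  moreover have "set xs = set ys'" using Cons.prems(3) ys notin \<open>x = y\<close> by auto
  ultimately show ?case using Cons ys by auto
qed simp

lemma ex_sorted_wrt:
  assumes wo: "wo_rel r" and S: "finite S" "S \<subseteq> Field r"
  shows "\<exists>l. sorted_wrt (\<lambda>x y. (x, y) \<in> r \<and> x \<noteq> y) l \<and> set l = S"
  using S
proof (induction "card S" arbitrary: S)
  case (Suc n)
  then have "S \<noteq> {}" by auto
  then obtain m where m: "m \<in> S" "\<forall>k\<in>S. (k, m) \<in> r" using finite_has_max[OF wo] Suc.prems by blast
  have "n = card (S - {m})" using Suc m by simp
  then obtain l where l: "sorted_wrt (\<lambda>x y. (x, y) \<in> r \<and> x \<noteq> y) l" "set l = S - {m}"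
    using Suc.hyps(1)[of "S - {m}"] Suc.prems by auto
  then have "sorted_wrt (\<lambda>x y. (x, y) \<in> r \<and> x \<noteq> y) (l @ [m]) \<and> set (l @ [m]) = S"
    using m by (auto simp: sorted_wrt_append)
  then show ?case by blast
qed simp

lemma length_strict_sorted:
  assumes "\<And>x y. R x y \<Longrightarrow> \<not> R y x" "sorted_wrt R l"
  shows "length l = card (set l)"
proof -
  have "distinct l" using assms(2)
  proof (induction l)
    case (Cons x l)
    then show ?case using assms(1)[of x x] by auto
  qed simp
  then show ?thesis by (simp add: distinct_card)
qed

lemma sorted_wrt_map_mono:
  assumes "sorted_wrt R l" "\<And>x y. x \<in> set l \<Longrightarrow> y \<in> set l \<Longrightarrow> R x y \<Longrightarrow> R' (h x) (h y)"
  shows "sorted_wrt R' (map h l)"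
  using assms by (induction l) auto

section \<open>Renaming the variables of formulas with parameters\<close>

lemma satp_ren_map:
  fixes g :: "'v \<Rightarrow> 'w"
  assumes "infinite (UNIV :: 'w set)"
  shows "satp M e (ren p (map_sum g id)) \<longleftrightarrow> satp M (\<lambda>v. e (g v)) p"
proof -
  have "infinite (UNIV :: ('w + 'm) set)" using assms by simp
  then show ?thesis unfolding satp_alt
    by (subst sat_ren) (auto intro!: sat_cong simp: param_val_def split: sum.splits)
qed

lemma ren_map_over:
  assumes "p \<in> fm_over L V A" "g ` V \<subseteq> W"
  shows "ren p (map_sum g id) \<in> fm_over L W A"
proof -
  have "fv (ren p (map_sum g id)) \<subseteq> map_sum g id ` (V <+> A)"
    using assms(1) by (intro subset_trans[OF fv_ren] image_mono) (simp add: fm_over_def)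
  also have "\<dots> \<subseteq> W <+> A" using assms(2) by auto
  finally show ?thesis using assms(1) by (simp add: fm_over_def)
qed

lemma satp_cong_over:
  assumes "p \<in> fm_over L V A" "\<And>v. v \<in> V \<Longrightarrow> a v = a' v"
  shows "satp M a p \<longleftrightarrow> satp M a' p"
  using assms by (intro satp_cong) (auto simp: fm_over_def)

lemma infinite_UNIV_prod1: "infinite (UNIV :: 'a set) \<Longrightarrow> infinite (UNIV :: ('a \<times> 'b) set)"
  by (simp add: finite_prod)


section \<open>Indiscernible sequences in the monster model\<close>

text \<open>Indiscernibility over a set of parameters is expressed by adding the parameters to
  \<open>Z\<close> as constant coordinates, as in \<open>row_ext\<close> and
  \<open>rows_ext\<close>.\<close>

definition ind_seq :: "('f, 'r) lang \<Rightarrow> ('f, 'r, 'm) struct \<Rightarrow> 'z set \<Rightarrow> (nat \<Rightarrow> 'z \<Rightarrow> 'm) \<Rightarrow> bool" where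
  "ind_seq L M Z s \<longleftrightarrow> (\<forall>js js'. sorted_wrt (<) js \<longrightarrow> sorted_wrt (<) js' \<longrightarrow> length js = length js' \<longrightarrow>
    color L M ({..<length js} \<times> Z) (tuple_at s js) = color L M ({..<length js} \<times> Z) (tuple_at s js'))"

text \<open>The positive Ehrenfeucht-Mostowski type of \<open>s\<close> over \<open>A\<close> in
  \<open>N\<close> places.\<close>

definition em_seq :: "('f, 'r) lang \<Rightarrow> ('f, 'r, 'm) struct \<Rightarrow> 'z set \<Rightarrow> 'm set \<Rightarrow> (nat \<Rightarrow> 'z \<Rightarrow> 'm)
    \<Rightarrow> nat \<Rightarrow> ('f, 'r, (nat \<times> 'z) + 'm) fm set" where
  "em_seq L M Z A s N = {p \<in> fm_over L ({..<N} \<times> Z) A.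
    \<forall>js. sorted_wrt (<) js \<longrightarrow> length js = N \<longrightarrow> satp M (tuple_at s js) p}"

section \<open>Small sets, stretching of sequences and homogeneous finite sequences\<close>

locale monster_model =
  fixes L :: "('f, 'r) lang" and T :: "('f, 'r) hsentence set"
    and \<kappa> :: "'k rel" and M :: "('f, 'r, 'm) struct"
  assumes positive: "positive_theory L T" and monster: "monster L T \<kappa> M"
begin

lemma ec: "ec_model L T M"
  using monster unfolding monster_def by blast

lemma univ_nonempty: "univ M \<noteq> {}"
  using ec unfolding ec_model_def is_model_def is_struct_def by blast

lemma Card_order_\<kappa>: "Card_order \<kappa>"
  using monster unfolding monster_def large_card_def by blast

lemma infinite_\<kappa>: "infinite (Field \<kappa>)"
proof -
  have "natLeq \<le>o |Field \<kappa>|"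
    using monster Card_order_\<kappa> card_of_Field_ordIso ordIso_symmetric
    unfolding monster_def large_card_def by (metis ordLess_imp_ordLeq ordLeq_ordIso_trans)
  then show ?thesis using infinite_iff_natLeq_ordLeq by blast
qed

lemma wo_\<kappa>: "wo_rel \<kappa>"
  using Card_order_\<kappa> unfolding wo_rel_def card_order_on_def by blast

definition small :: "'a set \<Rightarrow> bool" where "small A \<longleftrightarrow> |A| <o \<kappa>"

lemma small_ordLeq: "|A| \<le>o |B| \<Longrightarrow> small B \<Longrightarrow> small A"
  unfolding small_def by (rule ordLeq_ordLess_trans)

lemma small_mono: "A \<subseteq> B \<Longrightarrow> small B \<Longrightarrow> small A"
  by (rule small_ordLeq[OF card_of_mono1])

lemma small_image: "small A \<Longrightarrow> small (f ` A)"
  by (rule small_ordLeq[OF card_of_image])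

lemma small_nat: "small (UNIV :: nat set)"
  unfolding small_def using monster card_of_nat ordIso_ordLess_trans
  unfolding monster_def large_card_def by blast

lemma small_Plus: "small A \<Longrightarrow> small B \<Longrightarrow> small (A <+> B)"
  unfolding small_def by (rule card_of_Plus_ordLess_infinite_Field[OF infinite_\<kappa> Card_order_\<kappa>])

lemma small_Un: "small A \<Longrightarrow> small B \<Longrightarrow> small (A \<union> B)"
  unfolding small_def by (rule card_of_Un_ordLess_infinite_Field[OF infinite_\<kappa> Card_order_\<kappa>])

lemma small_Times:
  assumes "small A" "small B"
  shows "small (A \<times> B)"
proof (rule small_ordLeq)
  \<comment> \<open>The summand \<open>nat\<close> makes the bound infinite, hence as large as its
    square.\<close>
  let ?Q = "(UNIV :: nat set) <+> (A <+> B)"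
  have "|A| \<le>o |?Q|" "|B| \<le>o |?Q|"
    by (rule ordLeq_transitive[OF card_of_Plus1 card_of_Plus2] ordLeq_transitive[OF card_of_Plus2 card_of_Plus2])+
  then show "|A \<times> B| \<le>o |?Q|" by (intro card_of_Times_ordLeq) (simp_all add: finite_Plus_iff)
  show "small ?Q" by (intro small_Plus small_nat assms)
qed

lemma small_saturation:
  assumes "small V" "small A" "A \<subseteq> univ M" "\<Sigma> \<subseteq> fm_over L V A"
    and "\<And>S. finite S \<Longrightarrow> S \<subseteq> \<Sigma> \<Longrightarrow> \<exists>e. e ` V \<subseteq> univ M \<and> (\<forall>p\<in>S. satp M e p)"
  shows "\<exists>e. e ` V \<subseteq> univ M \<and> (\<forall>p\<in>\<Sigma>. satp M e p)"
proof -
  obtain d where "d \<in> univ M" using univ_nonempty by blast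
  moreover have "saturated L \<kappa> M" using monster unfolding monster_def by blast
  ultimately show ?thesis
    using saturated_small_vars[OF Card_order_\<kappa> infinite_\<kappa> _ assms(1)[unfolded small_def] assms(3)
        assms(2)[unfolded small_def] assms(4) _ assms(5)] by simp
qed

abbreviation lt\<kappa> :: "'k \<Rightarrow> 'k \<Rightarrow> bool" where "lt\<kappa> x y \<equiv> (x, y) \<in> \<kappa> \<and> x \<noteq> y"

lemma lt\<kappa>_asym: "lt\<kappa> x y \<Longrightarrow> \<not> lt\<kappa> y x"
  using wo_rel.ANTISYM[OF wo_\<kappa>] unfolding antisym_def by blast

lemma lt\<kappa>_trans: "lt\<kappa> x y \<Longrightarrow> lt\<kappa> y z \<Longrightarrow> lt\<kappa> x z"
  using wo_rel.ANTISYM[OF wo_\<kappa>] wo_rel.TRANS[OF wo_\<kappa>] unfolding antisym_def trans_def by blast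

text \<open>A finite part of the requirements mentions finitely many indices, and these can be sent
  to \<omega> in increasing order, where \<open>s\<close> meets the requirements. The stretched
  sequences have the lengths that Erdos-Rado asks for.\<close>

lemma ex_long_sequence:
  fixes s :: "nat \<Rightarrow> 'z \<Rightarrow> 'm" and I :: "'k set"
  assumes Z: "small Z" and A: "small A" "A \<subseteq> univ M" and s: "\<And>j z. z \<in> Z \<Longrightarrow> s j z \<in> univ M"
    and I: "small I"
  shows "\<exists>u. (\<forall>i\<in>I. \<forall>z\<in>Z. u i z \<in> univ M) \<and> (\<forall>N. \<forall>p\<in>em_seq L M Z A s N. \<forall>is.
    set is \<subseteq> I \<longrightarrow> sorted_wrt lt\<kappa> is \<longrightarrow> length is = N \<longrightarrow> satp M (tuple_at u is) p)"
proof -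
  have inf: "infinite (UNIV :: ('k \<times> 'z) set)"
    using infinite_\<kappa> by (intro infinite_UNIV_prod1) (metis finite_subset subset_UNIV)
  define X where "X = {(p, is). set is \<subseteq> I \<and> sorted_wrt lt\<kappa> is \<and> p \<in> em_seq L M Z A s (length is)}"
  define F where "F = (\<lambda>(p, is). ren p (map_sum (\<lambda>(k, z). (is ! k, z)) id) :: ('f, 'r, ('k \<times> 'z) + 'm) fm)"
  have F: "satp M e (F (p, is)) \<longleftrightarrow> satp M (tuple_at (\<lambda>i z. e (i, z)) is) p" for e p "is"
  proof -
    have "tuple_at (\<lambda>i z. e (i, z)) is = (\<lambda>v. e (case v of (k, z) \<Rightarrow> (is ! k, z)))"
      by (auto simp: tuple_at_def)
    then show ?thesis unfolding F_def by (simp add: satp_ren_map[OF inf])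
  qed
  have over: "F ` X \<subseteq> fm_over L (I \<times> Z) A"
  proof
    fix q assume "q \<in> F ` X"
    then obtain p "is" where q: "q = F (p, is)" "set is \<subseteq> I" "p \<in> fm_over L ({..<length is} \<times> Z) A"
      by (auto simp: X_def em_seq_def)
    have "(\<lambda>(k, z). (is ! k, z)) ` ({..<length is} \<times> Z) \<subseteq> I \<times> Z" using q(2) nth_mem by fastforce
    then show "q \<in> fm_over L (I \<times> Z) A" unfolding q(1) F_def using ren_map_over[OF q(3)] by simp
  qed
  have fin: "\<exists>e. e ` (I \<times> Z) \<subseteq> univ M \<and> (\<forall>q\<in>S. satp M e q)" if S: "finite S" "S \<subseteq> F ` X" for S
  proof -
    obtain Y where Y: "Y \<subseteq> X" "finite Y" "S = F ` Y" using finite_subset_image[OF S] by blast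
    define J where "J = (\<Union>(p, is)\<in>Y. set is)"
    have J: "finite J" unfolding J_def using Y(2) by auto
    \<comment> \<open>The rank of \<open>i\<close> in the finite order \<open>J\<close>.\<close>
    define h where "h i = card {x \<in> J. lt\<kappa> x i}" for i
    have h: "h x < h y" if xy: "x \<in> J" "y \<in> J" "lt\<kappa> x y" for x y
      unfolding h_def
    proof (rule psubset_card_mono)
      have "{x' \<in> J. lt\<kappa> x' x} \<subseteq> {x \<in> J. lt\<kappa> x y}" using lt\<kappa>_trans[OF _ xy(3)] by blast
      moreover have "x \<in> {x \<in> J. lt\<kappa> x y}" "x \<notin> {x' \<in> J. lt\<kappa> x' x}" using xy by auto
      ultimately show "{x' \<in> J. lt\<kappa> x' x} \<subset> {x \<in> J. lt\<kappa> x y}" by blast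
    qed (simp add: J)
    have "satp M (\<lambda>(i, z). s (h i) z) q" if qS: "q \<in> S" for q
    proof -
      obtain p "is" where q: "q = F (p, is)" "(p, is) \<in> Y" using qS Y(3) by auto
      then have jis: "set is \<subseteq> J" "sorted_wrt lt\<kappa> is" "p \<in> em_seq L M Z A s (length is)"
        using Y(1) by (auto simp: J_def X_def)
      have "sorted_wrt (<) (map h is)"
        by (rule sorted_wrt_map_mono[OF jis(2)]) (use jis(1) h in blast)
      then have "satp M (tuple_at s (map h is)) p" using jis(3) by (simp add: em_seq_def)
      moreover have "p \<in> fm_over L ({..<length is} \<times> Z) A" using jis(3) by (simp add: em_seq_def)
      then have "satp M (tuple_at s (map h is)) p \<longleftrightarrow> satp M (tuple_at (\<lambda>i z. s (h i) z) is) p"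
        by (rule satp_cong_over) (auto simp: tuple_at_def)
      ultimately show ?thesis unfolding q(1) F by simp
    qed
    then show ?thesis using s by (intro exI[of _ "\<lambda>(i, z). s (h i) z"]) auto
  qed
  have "\<exists>e. e ` (I \<times> Z) \<subseteq> univ M \<and> (\<forall>q\<in>F ` X. satp M e q)"
    by (rule small_saturation[OF small_Times[OF I Z] A over]) (rule fin)
  then obtain e where e: "e ` (I \<times> Z) \<subseteq> univ M" "\<forall>q\<in>F ` X. satp M e q" by (elim exE conjE)
  have "satp M (tuple_at (\<lambda>i z. e (i, z)) is) p"
    if "set is \<subseteq> I" "sorted_wrt lt\<kappa> is" "p \<in> em_seq L M Z A s (length is)" for p "is"
  proof -
    have "(p, is) \<in> X" using that by (simp add: X_def)
    then have "satp M e (F (p, is))" using e(2) by blast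
    then show ?thesis unfolding F .
  qed
  moreover have "e (i, z) \<in> univ M" if "i \<in> I" "z \<in> Z" for i z using e(1) that by blast
  ultimately show ?thesis by (intro exI[of _ "\<lambda>i z. e (i, z)"]) simp
qed

lemma small_funs: "small (funs L)" and small_rels: "small (rels L)"
  using monster unfolding monster_def small_def by blast+

text \<open>\<open>s\<close> is stretched along every \<open>B i\<close>, and finite sets of indices
  are coloured by the types of their increasing enumerations. The sequences for different
  \<open>N\<close> may come from different stretchings; what they have in common is the assignment
  \<open>c\<close> of types to lengths, and compactness needs no more.\<close>

lemma ex_homogeneous_colors:
  fixes s :: "nat \<Rightarrow> 'z \<Rightarrow> 'm"
  assumes Z: "small Z" and A: "small A" "A \<subseteq> univ M" and s: "\<And>j z. z \<in> Z \<Longrightarrow> s j z \<in> univ M"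
  shows "\<exists>c. \<forall>N. \<exists>u :: nat \<Rightarrow> 'z \<Rightarrow> 'm. (\<forall>j<N. \<forall>z\<in>Z. u j z \<in> univ M) \<and>
    (\<forall>js. sorted_wrt (<) js \<longrightarrow> set js \<subseteq> {..<N} \<longrightarrow>
      color L M ({..<length js} \<times> Z) (tuple_at u js) = c (length js) \<and>
      (\<forall>p\<in>em_seq L M Z A s (length js). satp M (tuple_at u js) p))"
proof -
  \<comment> \<open>A bound for the number of formulas with coordinates. It is replaced by a subset
    \<open>A0\<close> of \<open>Field \<kappa>\<close>, because \<open>large_card\<close> quantifies
    over such subsets.\<close>
  define Q where "Q = (UNIV :: nat set) <+> (funs L <+> (rels L <+> Z))"
  have "small Q" unfolding Q_def by (intro small_Plus small_nat small_funs small_rels Z)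
  then have "|Q| \<le>o \<kappa>" unfolding small_def by (rule ordLess_imp_ordLeq)
  then obtain A0 where A0: "A0 \<subseteq> Field \<kappa>" "|Q| =o |A0|" using internalize_card_of_ordLeq by blast
  have infQ: "infinite Q" unfolding Q_def by (simp add: finite_Plus_iff)
  have infA0: "infinite A0" using A0(2) infQ card_of_ordIso_finite by blast
  have QA0: "|Q| \<le>o |A0|" using A0(2) ordIso_iff_ordLeq by blast
  define W where "W = fm_list L ((UNIV :: nat set) \<times> Z)"
  have "|W| \<le>o |Q|"
    unfolding W_def
  proof (rule card_of_fm_list[OF infQ])
    show "|funs L| \<le>o |Q|" unfolding Q_def by (rule ordLeq_transitive[OF card_of_Plus1 card_of_Plus2])
    show "|rels L| \<le>o |Q|" unfolding Q_def
      by (rule ordLeq_transitive[OF ordLeq_transitive[OF card_of_Plus1 card_of_Plus2] card_of_Plus2])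
    have "|Z| \<le>o |Q|" unfolding Q_def
      by (rule ordLeq_transitive[OF ordLeq_transitive[OF card_of_Plus2 card_of_Plus2] card_of_Plus2])
    moreover have "|UNIV :: nat set| \<le>o |Q|" unfolding Q_def by (rule card_of_Plus1)
    ultimately show "|(UNIV :: nat set) \<times> Z| \<le>o |Q|" by (intro card_of_Times_ordLeq infQ)
  qed
  \<comment> \<open>Colours are sets of formulas, so the set \<open>P\<close> of
    \<open>morley_extraction\<close> has to be \<open>Pow A0\<close>.\<close>
  then have Col: "|Pow W| \<le>o |Pow A0|" using card_of_Pow_mono[OF ordLeq_transitive[OF _ QA0]] by blast
  let ?r = "cardSuc |Pow A0|"
  have "|A0| <o \<kappa>" using \<open>small Q\<close> A0(2) ordIso_symmetric ordIso_ordLess_trans unfolding small_def by blast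
  then have "beth_le ?r \<kappa>" using monster A0(1) unfolding monster_def large_card_def by blast
  then obtain B :: "'k set set \<Rightarrow> 'k set" where
    B: "\<And>i. i \<in> Field ?r \<Longrightarrow> B i \<subseteq> Field \<kappa>" "\<And>i. i \<in> Field ?r \<Longrightarrow> |Pow (\<Union>j\<in>underS ?r i. B j)| \<le>o |B i|"
    unfolding beth_le_def by blast
  \<comment> \<open>There is a later index \<open>j\<close>, and \<open>B j\<close> inside
    \<open>Field \<kappa>\<close> is at least as large as the power set of
    \<open>B i\<close>.\<close>
  have smallB: "small (B i)" if i: "i \<in> Field ?r" for i
  proof -
    have r: "Card_order ?r" "infinite (Field ?r)"
      using infA0 by (auto simp: cardSuc_Card_order card_of_Card_order card_of_cardSuc_finite)
    obtain j where j: "j \<in> Field ?r" "i \<noteq> j" "(i, j) \<in> ?r"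
      using infinite_Card_order_limit[OF r i] by blast
    have "Pow (B i) \<subseteq> Pow (\<Union>j\<in>underS ?r j. B j)" using j by (auto simp: underS_def)
    then have "|Pow (B i)| \<le>o |B j|" by (rule ordLeq_transitive[OF card_of_mono1 B(2)[OF j(1)]])
    then have "|Pow (B i)| \<le>o |Field \<kappa>|" by (rule ordLeq_transitive[OF _ card_of_mono1[OF B(1)[OF j(1)]]])
    then have "|B i| <o |Field \<kappa>|" using card_of_Pow ordLess_ordLeq_trans by blast
    then show ?thesis unfolding small_def using card_of_Field_ordIso[OF Card_order_\<kappa>] ordLess_ordIso_trans by blast
  qed
  define good where "good i u \<longleftrightarrow> (\<forall>i'\<in>B i. \<forall>z\<in>Z. u i' z \<in> univ M) \<and> (\<forall>N. \<forall>p\<in>em_seq L M Z A s N. \<forall>is.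
    set is \<subseteq> B i \<longrightarrow> sorted_wrt lt\<kappa> is \<longrightarrow> length is = N \<longrightarrow> satp M (tuple_at u is) p)" for i u
  have "\<exists>u. good i u" if "i \<in> Field ?r" for i
    unfolding good_def by (rule ex_long_sequence[OF Z A _ smallB[OF that]]) (rule s)
  then obtain u where u: "\<And>i. i \<in> Field ?r \<Longrightarrow> good i (u i)" by metis
  \<comment> \<open>Erdos-Rado colours sets, types belong to tuples; the increasing enumeration
    mediates.\<close>
  define srt where "srt S = (SOME l. sorted_wrt lt\<kappa> l \<and> set l = S)" for S
  have srt: "sorted_wrt lt\<kappa> (srt S) \<and> set (srt S) = S" if "finite S" "S \<subseteq> Field \<kappa>" for S
    unfolding srt_def by (rule someI_ex[OF ex_sorted_wrt[OF wo_\<kappa> that]])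
  define f where "f i S = color L M ({..<card S} \<times> Z) (tuple_at (u i) (srt S))" for i S
  have fW: "f i S \<in> Pow W" for i S
    unfolding f_def W_def color_def fm_list_def by (auto simp: lists_eq_set)
  have "\<exists>c. \<forall>N. \<exists>i\<in>Field ?r. \<exists>S\<subseteq>B i. finite S \<and> card S = N \<and> (\<forall>T\<subseteq>S. f i T = c (card T))"
  proof (rule morley_extraction)
    show "infinite (Pow A0)" using infA0 by simp
  qed (rule B(2) Col fW, assumption?)+
  then obtain c where c: "\<And>N. \<exists>i\<in>Field ?r. \<exists>S\<subseteq>B i. finite S \<and> card S = N \<and> (\<forall>T\<subseteq>S. f i T = c (card T))"
    by blast
  show ?thesis
  proof (intro exI[of _ c] allI)
    fix N
    from c[of N] obtain i S where i: "i \<in> Field ?r" and S: "S \<subseteq> B i" "finite S" "card S = N"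
      and hom: "\<And>T. T \<subseteq> S \<Longrightarrow> f i T = c (card T)" by blast
    have S\<kappa>: "S \<subseteq> Field \<kappa>" using S(1) B(1)[OF i] by blast
    have l: "sorted_wrt lt\<kappa> (srt S)" "set (srt S) = S" using srt[OF S(2) S\<kappa>] by auto
    have len: "length (srt S) = N" using length_strict_sorted[OF lt\<kappa>_asym l(1)] l(2) S(3) by simp
    define v where "v j z = u i (srt S ! j) z" for j z
    have mem: "srt S ! j \<in> S" if "j < N" for j using nth_mem[of j "srt S"] that len l(2) by simp
    have "v j z \<in> univ M" if "j < N" "z \<in> Z" for j z
      using u[OF i] mem[OF that(1)] S(1) that(2) unfolding good_def v_def by blast
    moreover have "color L M ({..<length js} \<times> Z) (tuple_at v js) = c (length js) \<and>
      (\<forall>p\<in>em_seq L M Z A s (length js). satp M (tuple_at v js) p)"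
      if js: "sorted_wrt (<) js" "set js \<subseteq> {..<N}" for js
    proof -
      let ?is = "map ((!) (srt S)) js"
      have sorted: "sorted_wrt lt\<kappa> ?is"
      proof (rule sorted_wrt_map_mono[OF js(1)])
        fix x y assume "x \<in> set js" "y \<in> set js" "x < y"
        then show "lt\<kappa> (srt S ! x) (srt S ! y)"
          using sorted_wrt_nth_less[OF l(1), of x y] js(2) len by auto
      qed
      have sub: "set ?is \<subseteq> S" using mem js(2) by auto
      have card: "card (set ?is) = length js" using length_strict_sorted[OF lt\<kappa>_asym sorted] by simp
      have "finite (set ?is)" "set ?is \<subseteq> Field \<kappa>" using sub S\<kappa> by auto
      then have "srt (set ?is) = ?is"
        using srt[of "set ?is"] sorted by (intro sorted_wrt_unique[of lt\<kappa>] lt\<kappa>_asym) auto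
      then have "color L M ({..<length js} \<times> Z) (tuple_at (u i) ?is) = c (length js)"
        using hom[OF sub] card unfolding f_def by simp
      moreover have "color L M ({..<length js} \<times> Z) (tuple_at v js) =
        color L M ({..<length js} \<times> Z) (tuple_at (u i) ?is)"
        by (rule color_cong) (auto simp: tuple_at_def v_def)
      moreover have "satp M (tuple_at v js) p" if p: "p \<in> em_seq L M Z A s (length js)" for p
      proof -
        have "length ?is = length js" "set ?is \<subseteq> B i" using sub S(1) by auto
        then have "satp M (tuple_at (u i) ?is) p" using u[OF i] p sorted unfolding good_def by blast
        moreover have "p \<in> fm_over L ({..<length js} \<times> Z) A" using p by (simp add: em_seq_def)
        then have "satp M (tuple_at (u i) ?is) p \<longleftrightarrow> satp M (tuple_at v js) p"
          by (rule satp_cong_over) (auto simp: tuple_at_def v_def)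
        ultimately show ?thesis by simp
      qed
      ultimately show ?thesis by simp
    qed
    ultimately show "\<exists>u. (\<forall>j<N. \<forall>z\<in>Z. u j z \<in> univ M) \<and>
      (\<forall>js. sorted_wrt (<) js \<longrightarrow> set js \<subseteq> {..<N} \<longrightarrow>
        color L M ({..<length js} \<times> Z) (tuple_at u js) = c (length js) \<and>
        (\<forall>p\<in>em_seq L M Z A s (length js). satp M (tuple_at u js) p))"
      by (intro exI[of _ v]) simp
  qed
qed

end

text \<open>\<open>\<rho>\<close> does not depend on the index \<open>j\<close>, so it acts on all
  tuples alike. The inheritance by thinned arrays and the passage to coordinates in
  \<open>Field \<kappa>\<close> are instances.\<close>

lemma ind_seq_reindex:
  assumes "ind_seq L M Z s" "\<rho> ` Z' \<subseteq> Z" "\<And>j z. z \<in> Z' \<Longrightarrow> s' j z = s j (\<rho> z)"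
  shows "ind_seq L M Z' s'"
  unfolding ind_seq_def
proof (intro allI impI)
  fix js js' :: "nat list"
  assume js: "sorted_wrt (<) js" "sorted_wrt (<) js'" "length js = length js'"
  then have *: "color L M ({..<length js} \<times> Z) (tuple_at s js) = color L M ({..<length js} \<times> Z) (tuple_at s js')"
    using assms(1) unfolding ind_seq_def by blast
  show "color L M ({..<length js} \<times> Z') (tuple_at s' js) = color L M ({..<length js} \<times> Z') (tuple_at s' js')"
    by (rule color_reindex[OF *, of "\<lambda>(k, z). (k, \<rho> z)"]) (use assms(2,3) in \<open>auto simp: tuple_at_def\<close>)
qed

text \<open>Extends indiscernibility from increasing tuples to tuples in any order and with
  repetitions, as they occur in tuples of array indices: the distinct values are sorted and each
  place is read off from the sorted list.\<close>

lemma ind_seq_iso: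
  fixes s :: "nat \<Rightarrow> 'z \<Rightarrow> 'm" and u v :: "'i \<Rightarrow> nat"
  assumes ind: "ind_seq L M Z s" and K: "finite K"
    and iso: "\<And>k l. k \<in> K \<Longrightarrow> l \<in> K \<Longrightarrow> u k < u l \<longleftrightarrow> v k < v l"
  shows "color L M (K \<times> Z) (\<lambda>(k, z). s (u k) z) = color L M (K \<times> Z) (\<lambda>(k, z). s (v k) z)"
proof -
  define js where "js = sorted_list_of_set (u ` K)"
  have js: "sorted_wrt (<) js" "set js = u ` K" unfolding js_def using K by auto
  \<comment> \<open>The choice of \<open>k\<close> is immaterial: by \<open>iso\<close>, equal
    values of \<open>u\<close> come with equal values of \<open>v\<close>.\<close>
  define \<phi> where "\<phi> m = v (SOME k. k \<in> K \<and> u k = m)" for m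
  have \<phi>: "\<phi> (u k) = v k" if k: "k \<in> K" for k
  proof -
    define l where "l = (SOME l. l \<in> K \<and> u l = u k)"
    have "l \<in> K \<and> u l = u k" unfolding l_def by (rule someI[of _ k]) (use k in simp)
    then have "v l = v k" using iso[of k l] iso[of l k] k by simp
    then show ?thesis unfolding \<phi>_def l_def by simp
  qed
  have js': "sorted_wrt (<) (map \<phi> js)"
  proof (rule sorted_wrt_map_mono[OF js(1)])
    fix x y assume "x \<in> set js" "y \<in> set js" "x < y"
    then show "\<phi> x < \<phi> y" using js(2) \<phi> iso by auto
  qed
  define pos where "pos m = (SOME q. q < length js \<and> js ! q = m)" for m
  have pos: "pos (u k) < length js \<and> js ! pos (u k) = u k" if "k \<in> K" for k
  proof -
    have "\<exists>q. q < length js \<and> js ! q = u k" using that js(2) unfolding in_set_conv_nth[symmetric] by simp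
    from someI_ex[OF this] show ?thesis unfolding pos_def .
  qed
  have "length js = length (map \<phi> js)" by simp
  then have *: "color L M ({..<length js} \<times> Z) (tuple_at s js) =
      color L M ({..<length js} \<times> Z) (tuple_at s (map \<phi> js))"
    using ind js(1) js' unfolding ind_seq_def by blast
  show ?thesis
  proof (rule color_reindex[OF *, of "\<lambda>(k, z). (pos (u k), z)"])
    show "(\<lambda>(k, z). (pos (u k), z)) ` (K \<times> Z) \<subseteq> {..<length js} \<times> Z" using pos by auto
  next
    fix w assume "w \<in> K \<times> Z"
    then obtain k z where w: "w = (k, z)" "k \<in> K" by auto
    show "(case w of (k, z) \<Rightarrow> s (u k) z) = tuple_at s js (case w of (k, z) \<Rightarrow> (pos (u k), z))"
      using w pos[OF w(2)] by (simp add: tuple_at_def)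
    show "(case w of (k, z) \<Rightarrow> s (v k) z) = tuple_at s (map \<phi> js) (case w of (k, z) \<Rightarrow> (pos (u k), z))"
      using w pos[OF w(2)] \<phi>[OF w(2)] by (simp add: tuple_at_def)
  qed
qed

lemma color_Plus_empty:
  "color L M (V <+> {}) (param_val e) = color L M (V <+> {}) (param_val e') \<longleftrightarrow>
    color L M V e = color L M V e'"
proof
  assume *: "color L M (V <+> {}) (param_val e) = color L M (V <+> {}) (param_val e')"
  show "color L M V e = color L M V e'" by (rule color_reindex[OF *, of Inl]) auto
next
  assume *: "color L M V e = color L M V e'"
  show "color L M (V <+> {}) (param_val e) = color L M (V <+> {}) (param_val e')"
    by (rule color_reindex[OF *, of "case_sum id undefined"]) auto
qed

lemma indiscernible_seq_iff:
  fixes Z :: "'z set"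
  shows "indiscernible_seq L M {} Z s \<longleftrightarrow> ind_seq L M Z s"
proof -
  have "infinite (UNIV :: (nat \<times> 'z) set)" by (rule infinite_UNIV_prod1) simp
  note tp = tp_eq_iff_color[OF this, of L M "{}", unfolded color_Plus_empty]
  have eq: "tp_at L M {} Z s js = tp_at L M {} Z s js' \<longleftrightarrow>
      color L M ({..<length js} \<times> Z) (tuple_at s js) = color L M ({..<length js} \<times> Z) (tuple_at s js')"
    if "length js = length js'" for js js'
    unfolding tp_at_def that by (rule tp)
  show ?thesis
    unfolding indiscernible_seq_def ind_seq_def by (intro iff_allI) (use eq in auto)
qed

section \<open>Extraction of indiscernible sequences; thickness for arbitrary coordinates\<close>

context monster_model
begin

text \<open>By compactness, \<open>s'\<close> satisfies all formulas in the types \<open>c n\<close>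
  and in the positive EM-type of \<open>s\<close>. Each \<open>c n\<close> is a realised type, so
  maximality turns "contains \<open>c n\<close>" into equality, which is indiscernibility. Formulas
  about the whole sequence are tested on subsequences, the form in which the thinned arrays provide
  them.\<close>

lemma ex_indiscernible_seq:
  fixes s :: "nat \<Rightarrow> 'z \<Rightarrow> 'm"
  assumes Z: "small Z" and A: "small A" "A \<subseteq> univ M" and s: "\<And>j z. z \<in> Z \<Longrightarrow> s j z \<in> univ M"
  shows "\<exists>s'. (\<forall>j. \<forall>z\<in>Z. s' j z \<in> univ M) \<and> ind_seq L M Z s' \<and>
    (\<forall>p\<in>fm_over L (UNIV \<times> Z) A. (\<forall>g. strict_mono g \<longrightarrow> satp M (\<lambda>(j, z). s (g j) z) p) \<longrightarrow>
      satp M (\<lambda>(j, z). s' j z) p)"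
proof -
  have inf: "infinite (UNIV :: (nat \<times> 'z) set)" by (rule infinite_UNIV_prod1) simp
  then have inf': "infinite (UNIV :: ((nat \<times> 'z) + 'm) set)" by simp
  obtain d where d: "d \<in> univ M" using univ_nonempty by blast
  define real where "real N u c \<longleftrightarrow> (\<forall>j<N. \<forall>z\<in>Z. u j z \<in> univ M) \<and>
    (\<forall>js. sorted_wrt (<) js \<longrightarrow> set js \<subseteq> {..<N} \<longrightarrow>
      color L M ({..<length js} \<times> Z) (tuple_at u js) = c (length js) \<and>
      (\<forall>p\<in>em_seq L M Z A s (length js). satp M (tuple_at u js) p))"
    for N and u :: "nat \<Rightarrow> 'z \<Rightarrow> 'm" and c
  have "\<exists>c. \<forall>N. \<exists>u. real N u c"
    unfolding real_def by (rule ex_homogeneous_colors[OF Z A]) (rule s)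
  then obtain c where c: "\<And>N. \<exists>u. real N u c" by blast
  have realD: "j < N \<Longrightarrow> z \<in> Z \<Longrightarrow> u j z \<in> univ M"
    "sorted_wrt (<) js \<Longrightarrow> set js \<subseteq> {..<N} \<Longrightarrow>
      color L M ({..<length js} \<times> Z) (tuple_at u js) = c (length js)"
    "sorted_wrt (<) js \<Longrightarrow> set js \<subseteq> {..<N} \<Longrightarrow> p \<in> em_seq L M Z A s (length js) \<Longrightarrow>
      satp M (tuple_at u js) p" if "real N u c" for N u j z js p
    using that unfolding real_def by auto
  \<comment> \<open>That \<open>c n\<close> is realised is what makes it maximal, and also shows
    that its members are formulas of the right kind.\<close>
  have ex_color: "\<exists>e. e ` ({..<n} \<times> Z) \<subseteq> univ M \<and> color L M ({..<n} \<times> Z) e = c n" for n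
  proof -
    obtain u where u: "real n u c" using c by blast
    have "color L M ({..<n} \<times> Z) (tuple_at u [0..<n]) = c n" using realD(2)[OF u, of "[0..<n]"] by (simp add: atLeast0LessThan)
    moreover have "tuple_at u [0..<n] ` ({..<n} \<times> Z) \<subseteq> univ M"
      using realD(1)[OF u] by (auto simp: tuple_at_def)
    ultimately show ?thesis by blast
  qed
  define F1 :: "('f, 'r, nat) fm \<times> (nat \<times> 'z) list \<times> nat list \<Rightarrow> ('f, 'r, (nat \<times> 'z) + 'm) fm"
    where "F1 = (\<lambda>(p, l, js). ren p (\<lambda>k. Inl (js ! fst (l ! k), snd (l ! k))))"
  define F2 :: "('f, 'r, (nat \<times> 'z) + 'm) fm \<times> nat list \<Rightarrow> ('f, 'r, (nat \<times> 'z) + 'm) fm"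
    where "F2 = (\<lambda>(p, js). ren p (map_sum (\<lambda>(k, z). (js ! k, z)) id))"
  define X1 where "X1 = {(p, l, js :: nat list). sorted_wrt (<) js \<and> (p, l) \<in> c (length js)}"
  define X2 where "X2 = {(p, js :: nat list). sorted_wrt (<) js \<and> p \<in> em_seq L M Z A s (length js)}"
  have F1: "satp M e (F1 (p, l, js)) \<longleftrightarrow> sat M (\<lambda>k. tuple_at (\<lambda>j z. e (j, z)) js (l ! k)) p" for e p l js
    unfolding F1_def satp_alt by (simp add: sat_ren[OF inf'] tuple_at_def split_beta)
  have F2: "satp M e (F2 (p, js)) \<longleftrightarrow> satp M (tuple_at (\<lambda>j z. e (j, z)) js) p" for e p js
  proof -
    have "tuple_at (\<lambda>j z. e (j, z)) js = (\<lambda>v. e (case v of (k, z) \<Rightarrow> (js ! k, z)))"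
      by (auto simp: tuple_at_def)
    then show ?thesis unfolding F2_def by (simp add: satp_ren_map[OF inf])
  qed
  have c_fm: "(p, l) \<in> fm_list L ({..<n} \<times> Z)" if pl: "(p, l) \<in> c n" for p l n
  proof -
    obtain e where "color L M ({..<n} \<times> Z) e = c n" using ex_color by blast
    then have "(p, l) \<in> color L M ({..<n} \<times> Z) e" using pl by simp
    then show ?thesis unfolding color_def by blast
  qed
  have l_mem: "fst (l ! k) < n \<and> snd (l ! k) \<in> Z" if "(p, l) \<in> c n" "k \<in> fv p" for p l n k
  proof -
    have "fv p \<subseteq> {..<length l}" "set l \<subseteq> {..<n} \<times> Z"
      using c_fm[OF that(1)] by (auto simp: fm_list_def lists_eq_set)
    from nth_mem_fv[OF this that(2)] show ?thesis by (auto simp: mem_Times_iff)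
  qed
  have over1: "F1 q \<in> fm_over L (UNIV \<times> Z) A" if q: "q \<in> X1" for q
  proof -
    obtain p l js where q': "q = (p, l, js)" "(p, l) \<in> c (length js)" using q unfolding X1_def by auto
    have "(\<lambda>k. Inl (js ! fst (l ! k), snd (l ! k))) ` fv p \<subseteq> (UNIV \<times> Z) <+> A"
      using l_mem[OF q'(2)] by auto
    moreover have "wf_fm L p" using c_fm[OF q'(2)] by (simp add: fm_list_def)
    ultimately show ?thesis
      unfolding q'(1) F1_def fm_over_def using subset_trans[OF fv_ren] by simp
  qed
  have over2: "F2 q \<in> fm_over L (UNIV \<times> Z) A" if q: "q \<in> X2" for q
  proof -
    obtain p js where q': "q = (p, js)" "p \<in> fm_over L ({..<length js} \<times> Z) A"
      using q unfolding X2_def em_seq_def by auto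
    have "(\<lambda>(k, z). (js ! k, z)) ` ({..<length js} \<times> Z) \<subseteq> UNIV \<times> Z" by auto
    from ren_map_over[OF q'(2) this] show ?thesis unfolding q'(1) F2_def by simp
  qed
  define rep where "rep q js \<longleftrightarrow> (\<exists>p l. (p, l, js) \<in> X1 \<and> q = F1 (p, l, js)) \<or>
    (\<exists>p. (p, js) \<in> X2 \<and> q = F2 (p, js))" for q js
  have fin: "\<exists>e. e ` (UNIV \<times> Z) \<subseteq> univ M \<and> (\<forall>q\<in>S. satp M e q)"
    if S: "finite S" "S \<subseteq> F1 ` X1 \<union> F2 ` X2" for S
  proof -
    have "\<exists>js. rep q js" if "q \<in> S" for q
    proof -
      from that S(2) have "q \<in> F1 ` X1 \<or> q \<in> F2 ` X2" by blast
      then show ?thesis unfolding rep_def by auto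
    qed
    then obtain J where J: "\<And>q. q \<in> S \<Longrightarrow> rep q (J q)" by metis
    have "finite (\<Union>q\<in>S. set (J q))" using S(1) by simp
    then obtain N where N: "\<And>q. q \<in> S \<Longrightarrow> set (J q) \<subseteq> {..<N}"
      unfolding finite_nat_set_iff_bounded by blast
    obtain u where u: "real N u c" using c by blast
    \<comment> \<open>The formulas in \<open>S\<close> mention no index from \<open>N\<close> on;
      \<open>d\<close> merely keeps the values in the universe.\<close>
    define e where "e = (\<lambda>(j, z). if j < N then u j z else d)"
    have "e ` (UNIV \<times> Z) \<subseteq> univ M" using realD(1)[OF u] d by (auto simp: e_def)
    moreover have "satp M e q" if q: "q \<in> S" for q
    proof -
      have lt: "J q ! k < N" if "k < length (J q)" for k using N[OF q] nth_mem[OF that] by blast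
      have eq: "tuple_at (\<lambda>j z. e (j, z)) (J q) w = tuple_at u (J q) w" if "fst w < length (J q)" for w
        using lt[OF that] by (simp add: tuple_at_def e_def split_beta)
      consider p l where "(p, l, J q) \<in> X1" "q = F1 (p, l, J q)" | p where "(p, J q) \<in> X2" "q = F2 (p, J q)"
        using J[OF q] unfolding rep_def by blast
      then show ?thesis
      proof cases
        case (1 p l)
        then have js: "sorted_wrt (<) (J q)" "(p, l) \<in> c (length (J q))" by (auto simp: X1_def)
        then have "(p, l) \<in> color L M ({..<length (J q)} \<times> Z) (tuple_at u (J q))"
          using realD(2)[OF u js(1) N[OF q]] by simp
        then have "sat M (\<lambda>k. tuple_at u (J q) (l ! k)) p" unfolding color_def by blast
        moreover have "sat M (\<lambda>k. tuple_at (\<lambda>j z. e (j, z)) (J q) (l ! k)) p \<longleftrightarrow>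
            sat M (\<lambda>k. tuple_at u (J q) (l ! k)) p"
          by (rule sat_cong) (use eq l_mem[OF js(2)] in blast)
        ultimately have "satp M e (F1 (p, l, J q))" unfolding F1 by simp
        then show ?thesis using 1(2) by simp
      next
        case (2 p)
        then have js: "sorted_wrt (<) (J q)" "p \<in> em_seq L M Z A s (length (J q))" by (auto simp: X2_def)
        have "satp M (tuple_at u (J q)) p" by (rule realD(3)[OF u js(1) N[OF q] js(2)])
        moreover have "p \<in> fm_over L ({..<length (J q)} \<times> Z) A" using js(2) by (simp add: em_seq_def)
        then have "satp M (tuple_at (\<lambda>j z. e (j, z)) (J q)) p \<longleftrightarrow> satp M (tuple_at u (J q)) p"
          by (rule satp_cong_over) (use eq in auto)
        ultimately have "satp M e (F2 (p, J q))" unfolding F2 by simp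
        then show ?thesis using 2(2) by simp
      qed
    qed
    ultimately show ?thesis by blast
  qed
  have over: "F1 ` X1 \<union> F2 ` X2 \<subseteq> fm_over L (UNIV \<times> Z) A" using over1 over2 by blast
  have "\<exists>e. e ` (UNIV \<times> Z) \<subseteq> univ M \<and> (\<forall>q\<in>F1 ` X1 \<union> F2 ` X2. satp M e q)"
    by (rule small_saturation[OF small_Times[OF small_nat Z] A over]) (rule fin)
  then obtain e where e: "e ` (UNIV \<times> Z) \<subseteq> univ M" "\<forall>q\<in>F1 ` X1 \<union> F2 ` X2. satp M e q"
    by (elim exE conjE)
  define s' where "s' j z = e (j, z)" for j z
  have s'_univ: "s' j z \<in> univ M" if "z \<in> Z" for j z using e(1) that by (auto simp: s'_def)
  have s'_color: "color L M ({..<length js} \<times> Z) (tuple_at s' js) = c (length js)"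
    if js: "sorted_wrt (<) js" for js
  proof -
    obtain e0 where e0: "e0 ` ({..<length js} \<times> Z) \<subseteq> univ M" "color L M ({..<length js} \<times> Z) e0 = c (length js)"
      using ex_color by blast
    have "tuple_at s' js ` ({..<length js} \<times> Z) \<subseteq> univ M" using s'_univ by (auto simp: tuple_at_def)
    \<comment> \<open>Compactness gives just this inclusion; \<open>ec_color_maximal\<close> makes
      it an equality.\<close>
    moreover have "color L M ({..<length js} \<times> Z) e0 \<subseteq> color L M ({..<length js} \<times> Z) (tuple_at s' js)"
    proof (rule subrelI)
      fix p l assume "(p, l) \<in> color L M ({..<length js} \<times> Z) e0"
      then have pl: "(p, l) \<in> c (length js)" using e0(2) by simp
      then have "(p, l, js) \<in> X1" using js by (simp add: X1_def)
      then have "satp M e (F1 (p, l, js))" using e(2) by blast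
      then show "(p, l) \<in> color L M ({..<length js} \<times> Z) (tuple_at s' js)"
        using c_fm[OF pl] unfolding F1 color_def s'_def by blast
    qed
    ultimately show ?thesis using ec_color_maximal[OF ec positive e0(1)] e0(2) by blast
  qed
  have "ind_seq L M Z s'"
    unfolding ind_seq_def
  proof (intro allI impI)
    fix js js' :: "nat list"
    assume js: "sorted_wrt (<) js" "sorted_wrt (<) js'" and len: "length js = length js'"
    show "color L M ({..<length js} \<times> Z) (tuple_at s' js) = color L M ({..<length js} \<times> Z) (tuple_at s' js')"
      using s'_color[OF js(1)] s'_color[OF js(2)] unfolding len by simp
  qed
  moreover have "satp M (\<lambda>(j, z). s' j z) p"
    if p: "p \<in> fm_over L (UNIV \<times> Z) A" and sg: "\<forall>g. strict_mono g \<longrightarrow> satp M (\<lambda>(j, z). s (g j) z) p" for p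
  proof -
    have "finite (fst ` (Inl -` fv p :: (nat \<times> 'z) set))" by (intro finite_imageI finite_vimageI) auto
    then obtain N where N: "\<forall>j \<in> fst ` (Inl -` fv p :: (nat \<times> 'z) set). j < N"
      unfolding finite_nat_set_iff_bounded by blast
    have "fv p \<subseteq> ({..<N} \<times> Z) <+> A"
    proof
      fix x assume x: "x \<in> fv p"
      then have xx: "x \<in> (UNIV \<times> Z) <+> A" using p unfolding fm_over_def by blast
      show "x \<in> ({..<N} \<times> Z) <+> A"
      proof (cases x)
        case (Inl w)
        then have "fst w < N" using N x by blast
        then show ?thesis using xx Inl by (cases w) auto
      qed (use xx in auto)
    qed
    then have pN: "p \<in> fm_over L ({..<N} \<times> Z) A" using p by (simp add: fm_over_def)
    have "satp M (tuple_at s js) p" if js: "sorted_wrt (<) js" "length js = N" for js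
    proof -
      \<comment> \<open>The tuple is continued to a whole subsequence; \<open>Suc\<close> pushes the
        continuation strictly above all entries of \<open>js\<close>.\<close>
      define g where "g k = (if k < N then js ! k else Max (insert 0 (set js)) + Suc k)" for k
      have "strict_mono g"
      proof (rule strict_monoI)
        fix x y :: nat assume "x < y"
        show "g x < g y"
        proof (cases "y < N")
          case True
          then show ?thesis using sorted_wrt_nth_less[OF js(1) \<open>x < y\<close>] \<open>x < y\<close> js(2) by (simp add: g_def)
        next
          case False
          have "js ! x \<le> Max (insert 0 (set js))" if "x < N" using js(2) that by (intro Max_ge) auto
          then show ?thesis using False \<open>x < y\<close> by (auto simp: g_def)
        qed
      qed
      then have "satp M (\<lambda>(j, z). s (g j) z) p" using sg by blast
      moreover have "satp M (\<lambda>(j, z). s (g j) z) p \<longleftrightarrow> satp M (tuple_at s js) p"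
        by (rule satp_cong_over[OF pN]) (auto simp: tuple_at_def g_def)
      ultimately show ?thesis by simp
    qed
    then have "p \<in> em_seq L M Z A s N" using pN by (simp add: em_seq_def)
    then have "(p, [0..<N]) \<in> X2" by (simp add: X2_def)
    then have "satp M e (F2 (p, [0..<N]))" using e(2) by blast
    then have "satp M (tuple_at s' [0..<N]) p" unfolding F2 s'_def .
    moreover have "satp M (tuple_at s' [0..<N]) p \<longleftrightarrow> satp M (\<lambda>(j, z). s' j z) p"
      by (rule satp_cong_over[OF pN]) (auto simp: tuple_at_def)
    ultimately show ?thesis by simp
  qed
  ultimately show ?thesis using s'_univ by (intro exI[of _ s']) blast
qed

text \<open>Thickness speaks about coordinates in \<open>Field \<kappa>\<close>; any small set of coordinates embeds there.\<close>

lemma thick_ind_seq: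
  fixes Z :: "'z set"
  assumes thick: "thick L \<kappa> M" and Z: "small Z"
  shows "\<exists>\<Theta> \<subseteq> fm_over L ((UNIV :: nat set) \<times> Z) {}. \<forall>s. (\<forall>j. \<forall>z\<in>Z. s j z \<in> univ M) \<longrightarrow>
    ((\<forall>p\<in>\<Theta>. satp M (\<lambda>(j, z). s j z) p) \<longleftrightarrow> ind_seq L M Z s)"
proof -
  have "|Z| \<le>o |Field \<kappa>|"
    using Z ordLess_imp_ordLeq ordLeq_ordIso_trans[OF _ ordIso_symmetric[OF card_of_Field_ordIso[OF Card_order_\<kappa>]]]
    unfolding small_def by blast
  then obtain \<iota> where \<iota>: "inj_on \<iota> Z" "\<iota> ` Z \<subseteq> Field \<kappa>" using card_of_ordLeq[of Z "Field \<kappa>"] by blast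
  define \<delta> where "\<delta> = inv_into Z \<iota>"
  have \<delta>: "\<delta> (\<iota> z) = z" if "z \<in> Z" for z unfolding \<delta>_def using \<iota>(1) that by simp
  have "|\<iota> ` Z| <o \<kappa>" using small_image[OF Z] unfolding small_def .
  with thick[unfolded thick_def, THEN spec, THEN mp, OF \<iota>(2)]
  obtain \<Theta> where \<Theta>: "\<Theta> \<subseteq> fm_over L ((UNIV :: nat set) \<times> \<iota> ` Z) {}"
    "\<forall>a. family_in M (\<iota> ` Z) a UNIV \<longrightarrow>
      ((\<forall>p\<in>\<Theta>. satp M (\<lambda>(i, x). a i x) p) \<longleftrightarrow> indiscernible_seq L M {} (\<iota> ` Z) a)" by blast
  have inf: "infinite (UNIV :: (nat \<times> 'z) set)" by (rule infinite_UNIV_prod1) simp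
  define F :: "('f, 'r, (nat \<times> 'k) + 'm) fm \<Rightarrow> ('f, 'r, (nat \<times> 'z) + 'm) fm"
    where "F p = ren p (map_sum (\<lambda>(j, y). (j, \<delta> y)) id)" for p
  have "F ` \<Theta> \<subseteq> fm_over L (UNIV \<times> Z) {}"
  proof (rule image_subsetI)
    fix p assume "p \<in> \<Theta>"
    then have p: "p \<in> fm_over L ((UNIV :: nat set) \<times> \<iota> ` Z) {}" using \<Theta>(1) by blast
    show "F p \<in> fm_over L (UNIV \<times> Z) {}" unfolding F_def by (rule ren_map_over[OF p]) (auto simp: \<delta>)
  qed
  moreover have "(\<forall>p\<in>F ` \<Theta>. satp M (\<lambda>(j, z). s j z) p) \<longleftrightarrow> ind_seq L M Z s"
    if s: "\<forall>j. \<forall>z\<in>Z. s j z \<in> univ M" for s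
  proof -
    have "satp M (\<lambda>(j, z). s j z) (F p) \<longleftrightarrow> satp M (\<lambda>(j, y). s j (\<delta> y)) p" for p
    proof -
      have "(\<lambda>v. (\<lambda>(j, z). s j z) (case v of (j, y) \<Rightarrow> (j, \<delta> y))) = (\<lambda>(j, y). s j (\<delta> y))" by auto
      then show ?thesis unfolding F_def satp_ren_map[OF inf] by simp
    qed
    then have "(\<forall>p\<in>F ` \<Theta>. satp M (\<lambda>(j, z). s j z) p) \<longleftrightarrow> (\<forall>p\<in>\<Theta>. satp M (\<lambda>(j, y). s j (\<delta> y)) p)" by simp
    also have "\<dots> \<longleftrightarrow> ind_seq L M (\<iota> ` Z) (\<lambda>j y. s j (\<delta> y))"
    proof -
      have "family_in M (\<iota> ` Z) (\<lambda>j y. s j (\<delta> y)) UNIV" using s \<delta> by (auto simp: family_in_def)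
      then show ?thesis using \<Theta>(2) unfolding indiscernible_seq_iff by blast
    qed
    also have "\<dots> \<longleftrightarrow> ind_seq L M Z s"
    proof
      assume "ind_seq L M (\<iota> ` Z) (\<lambda>j y. s j (\<delta> y))"
      then show "ind_seq L M Z s" by (rule ind_seq_reindex[where \<rho> = \<iota>]) (auto simp: \<delta>)
    next
      assume "ind_seq L M Z s"
      then show "ind_seq L M (\<iota> ` Z) (\<lambda>j y. s j (\<delta> y))"
        by (rule ind_seq_reindex[where \<rho> = \<delta>]) (auto simp: \<delta>)
    qed
    finally show ?thesis .
  qed
  ultimately show ?thesis by blast
qed

end

section \<open>Self-embeddings of the array\<close>

text \<open>Exactly the self-embeddings of the array for \<open>L_ar\<close>: preserving both
  relations and their negations forces rows to go to rows in order, while the columns may be moved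
  in each row independently.\<close>

definition array_emb :: "(nat \<times> nat \<Rightarrow> nat \<times> nat) \<Rightarrow> bool" where
  "array_emb h \<longleftrightarrow> (\<exists>f g. strict_mono f \<and> (\<forall>i. strict_mono (g i)) \<and> h = (\<lambda>(i, j). (f i, g i j)))"

definition thin_row :: "nat \<Rightarrow> (nat \<Rightarrow> nat) \<Rightarrow> nat \<times> nat \<Rightarrow> nat \<times> nat" where
  "thin_row n g = (\<lambda>(i, j). (i, if i = n then g j else j))"

definition thin_rows :: "(nat \<Rightarrow> nat) \<Rightarrow> nat \<times> nat \<Rightarrow> nat \<times> nat" where
  "thin_rows g = (\<lambda>(i, j). (g i, j))"

lemma array_embI: "strict_mono f \<Longrightarrow> (\<And>i. strict_mono (g i)) \<Longrightarrow> array_emb (\<lambda>(i, j). (f i, g i j))"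
  unfolding array_emb_def by blast

lemma strict_mono_id': "strict_mono (\<lambda>j :: nat. j)"
  by (simp add: strict_mono_def)

lemma array_emb_id: "array_emb (\<lambda>q. q)"
  unfolding array_emb_def
  by (intro exI[of _ "\<lambda>j. j"] exI[of _ "\<lambda>_ j. j"]) (auto simp: strict_mono_def)

lemma array_emb_thin_row: "strict_mono g \<Longrightarrow> array_emb (thin_row n g)"
proof -
  assume g: "strict_mono g"
  have "strict_mono (\<lambda>j. if i = n then g j else j)" for i
    using g by (simp add: strict_mono_def)
  from array_embI[OF strict_mono_id' this] show ?thesis by (simp add: thin_row_def)
qed

lemma array_emb_thin_rows: "strict_mono g \<Longrightarrow> array_emb (thin_rows g)"
  using array_embI[of g "\<lambda>_ j. j"] strict_mono_id' by (simp add: thin_rows_def)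

lemma array_emb_comp:
  assumes "array_emb h" "array_emb k"
  shows "array_emb (\<lambda>q. h (k q))"
proof -
  obtain f g where h: "strict_mono f" "\<And>i. strict_mono (g i)" "h = (\<lambda>(i, j). (f i, g i j))"
    using assms(1) unfolding array_emb_def by blast
  obtain f' g' where k: "strict_mono f'" "\<And>i. strict_mono (g' i)" "k = (\<lambda>(i, j). (f' i, g' i j))"
    using assms(2) unfolding array_emb_def by blast
  have "strict_mono (\<lambda>i. f (f' i))" "\<And>i. strict_mono (\<lambda>j. g (f' i) (g' i j))"
    using h(1,2) k(1,2) by (simp_all add: strict_mono_def)
  from array_embI[OF this] show ?thesis by (simp add: h(3) k(3) split_def)
qed

lemma array_emb_qf:
  assumes h: "array_emb h"
    and "wf_qf L_ar p" "vars_qf p \<subseteq> {..<length \<eta>}"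
  shows "sat_qf array (nth (map h \<eta>)) p \<longleftrightarrow> sat_qf array (nth \<eta>) p"
  using assms(2,3)
proof (induction p)
  case (QRel r ts)
  obtain f g where fg: "strict_mono f" "\<And>i. strict_mono (g i)" "h = (\<lambda>(i, j). (f i, g i j))"
    using h unfolding array_emb_def by blast
  have var: "\<exists>k<length \<eta>. t = Var k" if "t \<in> set ts" for t
  proof -
    have "fv_tm t \<subseteq> {..<length \<eta>}" "wf_tm L_ar t" using QRel that by (auto simp: list_all_iff)
    then show ?thesis by (cases t) (auto simp: L_ar_def)
  qed
  have "length ts = 2" using QRel.prems by (simp add: L_ar_def)
  then obtain t t' where ts: "ts = [t, t']" by (auto simp: length_Suc_conv numeral_2_eq_2)
  obtain k l where kl: "k < length \<eta>" "l < length \<eta>" "ts = [Var k, Var l]"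
    using var[of t] var[of t'] ts by auto
  obtain i j i' j' where ij: "\<eta> ! k = (i, j)" "\<eta> ! l = (i', j')" by (cases "\<eta> ! k", cases "\<eta> ! l") blast
  show ?case
    using kl ij fg strict_mono_less[OF fg(1)] strict_mono_less[OF fg(2)] strict_mono_eq[OF fg(1)]
    by (cases r) (auto simp: array_def)
next
  case (QEq s t)
  obtain k l where kl: "s = Var k" "t = Var l" "k < length \<eta>" "l < length \<eta>"
    using QEq by (cases s; cases t) (auto simp: L_ar_def)
  obtain f g where fg: "strict_mono f" "\<And>i. strict_mono (g i)" "h = (\<lambda>(i, j). (f i, g i j))"
    using h unfolding array_emb_def by blast
  have "h q = h q' \<longleftrightarrow> q = q'" for q q'
    using strict_mono_eq[OF fg(1)] strict_mono_eq[OF fg(2)] unfolding fg(3) by (cases q, cases q') auto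
  then show ?case using kl by simp
qed auto

lemma qftp_map_array_emb: "array_emb h \<Longrightarrow> qftp L_ar array (map h \<eta>) = qftp L_ar array \<eta>"
  unfolding qftp_def using array_emb_qf by auto

lemma qftp_array_eqD:
  assumes "qftp L_ar array \<eta> = qftp L_ar array \<nu>"
  shows "length \<eta> = length \<nu>"
    and "k < length \<eta> \<Longrightarrow> l < length \<eta> \<Longrightarrow> fst (\<eta> ! k) < fst (\<eta> ! l) \<longleftrightarrow> fst (\<nu> ! k) < fst (\<nu> ! l)"
    and "k < length \<eta> \<Longrightarrow> l < length \<eta> \<Longrightarrow> fst (\<eta> ! k) = fst (\<eta> ! l) \<and> snd (\<eta> ! k) < snd (\<eta> ! l) \<longleftrightarrow>
      fst (\<nu> ! k) = fst (\<nu> ! l) \<and> snd (\<nu> ! k) < snd (\<nu> ! l)"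
proof -
  have "QEq (Var k) (Var k) \<in> qftp L_ar array \<theta> \<longleftrightarrow> k < length \<theta>" for k \<theta>
    by (auto simp: qftp_def)
  then have "k < length \<eta> \<longleftrightarrow> k < length \<nu>" for k using assms by blast
  then show len: "length \<eta> = length \<nu>" by (metis linorder_neqE_nat less_irrefl)
  have rel: "QRel r [Var k, Var l] \<in> qftp L_ar array \<theta> \<longleftrightarrow> rint array r [\<theta> ! k, \<theta> ! l]"
    if "k < length \<theta>" "l < length \<theta>" for r k l \<theta>
    using that by (cases r) (auto simp: qftp_def L_ar_def)
  have less: "rint array Less1 [q, q'] \<longleftrightarrow> fst q < fst q'"
    "rint array Less2 [q, q'] \<longleftrightarrow> fst q = fst q' \<and> snd q < snd q'" for q q'
    by (auto simp: array_def split_def)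
  assume kl: "k < length \<eta>" "l < length \<eta>"
  have "rint array r [\<eta> ! k, \<eta> ! l] \<longleftrightarrow> rint array r [\<nu> ! k, \<nu> ! l]" for r
    using rel[OF kl] rel[of k \<nu> l] kl assms unfolding len by blast
  then show "fst (\<eta> ! k) < fst (\<eta> ! l) \<longleftrightarrow> fst (\<nu> ! k) < fst (\<nu> ! l)"
    "fst (\<eta> ! k) = fst (\<eta> ! l) \<and> snd (\<eta> ! k) < snd (\<eta> ! l) \<longleftrightarrow>
      fst (\<nu> ! k) = fst (\<nu> ! l) \<and> snd (\<nu> ! k) < snd (\<nu> ! l)"
    unfolding less[symmetric] by blast+
qed


section \<open>Arrays with mutually indiscernible rows\<close>

text \<open>Row \<open>n\<close> as a sequence, with the other entries and the parameters as constant coordinates.\<close>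

definition row_ext :: "nat \<Rightarrow> (nat \<times> nat \<Rightarrow> 'x \<Rightarrow> 'm) \<Rightarrow> nat \<Rightarrow> 'x + ((nat \<times> nat) \<times> 'x) + 'm \<Rightarrow> 'm" where
  "row_ext n a j z = (case z of Inl x \<Rightarrow> a (n, j) x | Inr (Inl (q, x)) \<Rightarrow> a q x | Inr (Inr c) \<Rightarrow> c)"

definition row_coords :: "'m set \<Rightarrow> 'x set \<Rightarrow> nat \<Rightarrow> ('x + ((nat \<times> nat) \<times> 'x) + 'm) set" where
  "row_coords C X n = X <+> (({q. fst q \<noteq> n} \<times> X) <+> C)"

text \<open>The array as a sequence of infinite tuples: the column has become part of the
  coordinate.\<close>

definition rows_ext :: "(nat \<times> nat \<Rightarrow> 'x \<Rightarrow> 'm) \<Rightarrow> nat \<Rightarrow> (nat \<times> 'x) + 'm \<Rightarrow> 'm" where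
  "rows_ext a i z = (case z of Inl (j, x) \<Rightarrow> a (i, j) x | Inr c \<Rightarrow> c)"

lemma row_ext_simps [simp]:
  "row_ext n a j (Inl x) = a (n, j) x" "row_ext n a j (Inr (Inl (q, x))) = a q x"
  "row_ext n a j (Inr (Inr c)) = c"
  by (simp_all add: row_ext_def)

lemma rows_ext_simps [simp]: "rows_ext a i (Inl (j, x)) = a (i, j) x" "rows_ext a i (Inr c) = c"
  by (simp_all add: rows_ext_def)

lemma row_coords_simps [simp]:
  "Inl x \<in> row_coords C X n \<longleftrightarrow> x \<in> X" "Inr (Inl (q, x)) \<in> row_coords C X n \<longleftrightarrow> fst q \<noteq> n \<and> x \<in> X"
  "Inr (Inr c) \<in> row_coords C X n \<longleftrightarrow> c \<in> C"
  by (auto simp: row_coords_def)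

lemma row_coords_cases:
  assumes "z \<in> row_coords C X n"
  obtains x where "z = Inl x" "x \<in> X" | q x where "z = Inr (Inl (q, x))" "fst q \<noteq> n" "x \<in> X"
    | c where "z = Inr (Inr c)" "c \<in> C"
  using assms unfolding row_coords_def by auto

definition row_ind :: "('f, 'r) lang \<Rightarrow> ('f, 'r, 'm) struct \<Rightarrow> 'm set \<Rightarrow> 'x set \<Rightarrow> nat
    \<Rightarrow> (nat \<times> nat \<Rightarrow> 'x \<Rightarrow> 'm) \<Rightarrow> bool" where
  "row_ind L M C X n a \<longleftrightarrow> ind_seq L M (row_coords C X n) (row_ext n a)"

definition rows_ind :: "('f, 'r) lang \<Rightarrow> ('f, 'r, 'm) struct \<Rightarrow> 'm set \<Rightarrow> 'x set
    \<Rightarrow> (nat \<times> nat \<Rightarrow> 'x \<Rightarrow> 'm) \<Rightarrow> bool" where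
  "rows_ind L M C X a \<longleftrightarrow> ind_seq L M ((UNIV \<times> X) <+> C) (rows_ext a)"

text \<open>For row \<open>i\<close>, the entries of row \<open>n\<close> are constant coordinates,
  and thinning row \<open>n\<close> just selects some of them.\<close>

lemma row_ind_thin_row:
  assumes "row_ind L M C X i a" "i \<noteq> n"
  shows "row_ind L M C X i (\<lambda>q. a (thin_row n g q))"
  unfolding row_ind_def
proof (rule ind_seq_reindex[OF assms(1)[unfolded row_ind_def],
      where \<rho> = "map_sum id (map_sum (map_prod (thin_row n g) id) id)"])
  show "map_sum id (map_sum (map_prod (thin_row n g) id) id) ` row_coords C X i \<subseteq> row_coords C X i"
    by (auto elim!: row_coords_cases simp: thin_row_def)
  fix j z assume "z \<in> row_coords C X i"
  then show "row_ext i (\<lambda>q. a (thin_row n g q)) j z =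
      row_ext i a j (map_sum id (map_sum (map_prod (thin_row n g) id) id) z)"
    using assms(2) by (cases rule: row_coords_cases) (simp_all add: thin_row_def)
qed

text \<open>As \<open>g\<close> is injective, the other remaining rows are rows of \<open>a\<close>
  different from row \<open>g i\<close>, hence among the constant coordinates of that row.\<close>

lemma row_ind_thin_rows:
  assumes "row_ind L M C X (g i) a" and g: "strict_mono g"
  shows "row_ind L M C X i (\<lambda>q. a (thin_rows g q))"
  unfolding row_ind_def
proof (rule ind_seq_reindex[OF assms(1)[unfolded row_ind_def],
      where \<rho> = "map_sum id (map_sum (map_prod (thin_rows g) id) id)"])
  show "map_sum id (map_sum (map_prod (thin_rows g) id) id) ` row_coords C X i \<subseteq> row_coords C X (g i)"
    using strict_mono_eq[OF g] by (auto elim!: row_coords_cases simp: thin_rows_def)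
  fix j z assume "z \<in> row_coords C X i"
  then show "row_ext i (\<lambda>q. a (thin_rows g q)) j z =
      row_ext (g i) a j (map_sum id (map_sum (map_prod (thin_rows g) id) id) z)"
    by (cases rule: row_coords_cases) (simp_all add: thin_rows_def)
qed

lemma ind_array_imp_indiscernible:
  fixes X :: "'x set"
  assumes rows: "rows_ind L M C X a" and row: "\<And>i. row_ind L M C X i a"
  shows "array_indiscernible L M C X a"
  unfolding indiscernible_def
proof (intro ballI impI)
  fix \<eta> \<nu> :: "(nat \<times> nat) list"
  assume qf: "qftp L_ar array \<eta> = qftp L_ar array \<nu>"
  define n where "n = length \<eta>"
  have len: "length \<nu> = n" using qftp_array_eqD(1)[OF qf] n_def by simp
  have iso1: "fst (\<eta> ! k) < fst (\<eta> ! l) \<longleftrightarrow> fst (\<nu> ! k) < fst (\<nu> ! l)" if "k < n" "l < n" for k l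
    using qftp_array_eqD(2)[OF qf] that n_def by blast
  have iso2: "fst (\<eta> ! k) = fst (\<eta> ! l) \<and> snd (\<eta> ! k) < snd (\<eta> ! l) \<longleftrightarrow>
      fst (\<nu> ! k) = fst (\<nu> ! l) \<and> snd (\<nu> ! k) < snd (\<nu> ! l)" if "k < n" "l < n" for k l
    using qftp_array_eqD(3)[OF qf] that n_def by blast
  let ?W = "({..<n} \<times> X) <+> C"
  define col where "col \<theta> = color L M ?W (param_val (\<lambda>(k, x). a (\<theta> k) x))" for \<theta> :: "nat \<Rightarrow> nat \<times> nat"
  have col_cong: "col \<theta> = col \<theta>'" if "\<And>k. k < n \<Longrightarrow> \<theta> k = \<theta>' k" for \<theta> \<theta>'
    unfolding col_def by (rule color_cong) (use that in auto)
  \<comment> \<open>Interpolates between the tuples: all rows are those of \<open>\<nu>\<close>, the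
    columns are those of \<open>\<nu>\<close> in rows below \<open>m\<close> and still those of
    \<open>\<eta>\<close> from row \<open>m\<close> on. Passing to \<open>Suc m\<close> moves only
    columns in row \<open>m\<close>, with everything else constant.\<close>
  define mix where "mix m k = (if fst (\<nu> ! k) < m then \<nu> ! k else (fst (\<nu> ! k), snd (\<eta> ! k)))" for m k
  have "col (nth \<eta>) = col (mix 0)"
  \<comment> \<open>Parameters are read as coordinates at place 0 of the tuple, which exists only if
    the tuple is nonempty.\<close>
  proof (cases "n = 0")
    case False
    have "color L M ({..<n} \<times> ((UNIV \<times> X) <+> C)) (\<lambda>(k, z). rows_ext a (fst (\<eta> ! k)) z) =
      color L M ({..<n} \<times> ((UNIV \<times> X) <+> C)) (\<lambda>(k, z). rows_ext a (fst (\<nu> ! k)) z)"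
      by (rule ind_seq_iso[OF rows[unfolded rows_ind_def]]) (use iso1 in auto)
    then show ?thesis unfolding col_def
      by (rule color_reindex[where \<rho> = "case_sum (\<lambda>(k, x). (k, Inl (snd (\<eta> ! k), x))) (\<lambda>c. (0, Inr c))"])
        (use False in \<open>auto simp: mix_def\<close>)
  qed (rule col_cong, simp)
  moreover have "col (mix m) = col (mix (Suc m))" for m
  proof (cases "\<exists>k<n. fst (\<nu> ! k) = m")
    case False
    then show ?thesis by (intro col_cong) (auto simp: mix_def less_Suc_eq)
  next
    case True
    \<comment> \<open>The place at which entries of other rows and parameters are read as constant
      coordinates.\<close>
    then obtain k0 where k0: "k0 < n" "fst (\<nu> ! k0) = m" by blast
    define K where "K = {k. k < n \<and> fst (\<nu> ! k) = m}"
    have eq: "fst (\<eta> ! k) = fst (\<eta> ! l)" if "k \<in> K" "l \<in> K" for k l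
      using iso1[of k l] iso1[of l k] that by (auto simp: K_def)
    have "color L M (K \<times> row_coords C X m) (\<lambda>(k, z). row_ext m a (snd (\<eta> ! k)) z) =
      color L M (K \<times> row_coords C X m) (\<lambda>(k, z). row_ext m a (snd (\<nu> ! k)) z)"
    proof (rule ind_seq_iso[OF row[unfolded row_ind_def]])
      show "finite K" unfolding K_def by simp
      fix k l assume kl: "k \<in> K" "l \<in> K"
      then show "snd (\<eta> ! k) < snd (\<eta> ! l) \<longleftrightarrow> snd (\<nu> ! k) < snd (\<nu> ! l)"
        using iso2[of k l] eq[OF kl] by (auto simp: K_def)
    qed
    then show ?thesis unfolding col_def
    proof (rule color_reindex[where \<rho> = "case_sum
          (\<lambda>(k, x). if k \<in> K then (k, Inl x) else (k0, Inr (Inl (mix m k, x)))) (\<lambda>c. (k0, Inr (Inr c)))"])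
      let ?\<rho> = "case_sum (\<lambda>(k, x). if k \<in> K then (k, Inl x) else (k0, Inr (Inl (mix m k, x))))
          (\<lambda>c. (k0, Inr (Inr c)))"
      have k0K: "k0 \<in> K" using k0 by (simp add: K_def)
      have notK: "fst (mix m k) \<noteq> m" "mix (Suc m) k = mix m k" if "k < n" "k \<notin> K" for k
        using that by (auto simp: K_def mix_def)
      have inK: "mix m k = (m, snd (\<eta> ! k))" "mix (Suc m) k = (m, snd (\<nu> ! k))" if "k \<in> K" for k
        using that by (auto simp: K_def mix_def prod_eq_iff)
      have W: "(\<exists>k x. w = Inl (k, x) \<and> k \<in> K \<and> x \<in> X) \<or> (\<exists>k x. w = Inl (k, x) \<and> k \<notin> K \<and> k < n \<and> x \<in> X) \<or>
          (\<exists>c. w = Inr c \<and> c \<in> C)" if "w \<in> ?W" for w using that by (auto simp: K_def)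
      show "?\<rho> ` ?W \<subseteq> K \<times> row_coords C X m"
        by (rule image_subsetI, drule W) (use k0K notK(1) in auto)
      fix w assume w: "w \<in> ?W"
      show "param_val (\<lambda>(k, x). a (mix m k) x) w = (case ?\<rho> w of (k, z) \<Rightarrow> row_ext m a (snd (\<eta> ! k)) z)"
        using W[OF w] by (elim disjE exE conjE) (simp_all add: inK(1))
      show "param_val (\<lambda>(k, x). a (mix (Suc m) k) x) w = (case ?\<rho> w of (k, z) \<Rightarrow> row_ext m a (snd (\<nu> ! k)) z)"
        using W[OF w] by (elim disjE exE conjE) (simp_all add: inK(2) notK(2))
    qed
  qed
  then have "col (mix 0) = col (mix m)" for m by (induction m) auto
  moreover obtain m where m: "\<And>k. k < n \<Longrightarrow> fst (\<nu> ! k) < m"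
  proof -
    have "finite ((\<lambda>k. fst (\<nu> ! k)) ` {..<n})" by simp
    then show ?thesis using that unfolding finite_nat_set_iff_bounded by auto
  qed
  then have "col (mix m) = col (nth \<nu>)" by (intro col_cong) (simp add: mix_def)
  ultimately have "col (nth \<eta>) = col (nth \<nu>)" by metis
  moreover have "infinite (UNIV :: (nat \<times> 'x) set)" by (rule infinite_UNIV_prod1) simp
  ultimately show "tp_at L M C X a \<eta> = tp_at L M C X a \<nu>"
    unfolding tp_at_def len n_def[symmetric] by (simp add: tp_eq_iff_color col_def tuple_at_def)
qed

section \<open>Construction of the array-indiscernible array\<close>

lemma fm_over_mono: "p \<in> fm_over L V A \<Longrightarrow> A \<subseteq> A' \<Longrightarrow> p \<in> fm_over L V A'"
  unfolding fm_over_def by auto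

locale thick_array = monster_model L T \<kappa> M
  for L :: "('f, 'r) lang" and T :: "('f, 'r) hsentence set" and \<kappa> :: "'k rel" and M :: "('f, 'r, 'm) struct" +
  fixes C :: "'m set" and X :: "'x set"
  assumes thick: "thick L \<kappa> M" and C: "C \<subseteq> univ M" "small C" and X: "small X"
begin

abbreviation fam :: "(nat \<times> nat \<Rightarrow> 'x \<Rightarrow> 'm) \<Rightarrow> bool" where
  "fam a \<equiv> family_in M X a UNIV"

abbreviation array_fm :: "('f, 'r, ((nat \<times> nat) \<times> 'x) + 'm) fm set" where
  "array_fm \<equiv> fm_over L (UNIV \<times> X) C"

definition true_of :: "(nat \<times> nat \<Rightarrow> 'x \<Rightarrow> 'm) \<Rightarrow> ('f, 'r, ((nat \<times> nat) \<times> 'x) + 'm) fm \<Rightarrow> bool" where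
  "true_of a p \<longleftrightarrow> satp M (\<lambda>(q, x). a q x) p"

text \<open>Implies \<open>EM_ar_based\<close>, but is stated for formulas about the whole array and
  by self-embeddings in place of quantifier-free types. In this form it is given by a set of
  positive formulas, so compactness can impose it, and it is stable under thinning.\<close>

definition based :: "(nat \<times> nat \<Rightarrow> 'x \<Rightarrow> 'm) \<Rightarrow> (nat \<times> nat \<Rightarrow> 'x \<Rightarrow> 'm) \<Rightarrow> bool" where
  "based a b \<longleftrightarrow> (\<forall>p\<in>array_fm. (\<forall>h. array_emb h \<longrightarrow> true_of (\<lambda>q. a (h q)) p) \<longrightarrow> true_of b p)"

lemma famD: "fam a \<Longrightarrow> x \<in> X \<Longrightarrow> a q x \<in> univ M"
  unfolding family_in_def by blast

lemma fam_comp: "fam a \<Longrightarrow> fam (\<lambda>q. a (h q))"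
  unfolding family_in_def by blast

lemma true_of_ren:
  fixes h :: "nat \<times> nat \<Rightarrow> nat \<times> nat"
  shows "true_of a (ren p (map_sum (\<lambda>(q, x). (h q, x)) id)) \<longleftrightarrow> true_of (\<lambda>q. a (h q)) p"
proof -
  have inf: "infinite (UNIV :: ((nat \<times> nat) \<times> 'x) set)" by (intro infinite_UNIV_prod1) simp
  have "(\<lambda>v. (\<lambda>(q, x). a q x) (case v of (q, x) \<Rightarrow> (h q, x))) = (\<lambda>(q, x). a (h q) x)" by auto
  then show ?thesis unfolding true_of_def satp_ren_map[OF inf] by simp
qed

lemma ren_array_fm: "p \<in> array_fm \<Longrightarrow> ren p (map_sum (\<lambda>(q, x). (h q, x)) id) \<in> array_fm"
  by (rule ren_map_over) auto

lemma based_refl: "based a a"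
  unfolding based_def using array_emb_id by blast

lemma based_comp:
  assumes ab: "based a b" and h: "array_emb h"
  shows "based a (\<lambda>q. b (h q))"
  unfolding based_def
proof (intro ballI impI)
  fix p assume p: "p \<in> array_fm" and a: "\<forall>h. array_emb h \<longrightarrow> true_of (\<lambda>q. a (h q)) p"
  let ?p = "ren p (map_sum (\<lambda>(q, x). (h q, x)) id)"
  have "true_of (\<lambda>q. a (k q)) ?p" if "array_emb k" for k
    using a array_emb_comp[OF that h] by (simp add: true_of_ren)
  then have "true_of b ?p" using ab ren_array_fm[OF p] unfolding based_def by blast
  then show "true_of (\<lambda>q. b (h q)) p" by (simp add: true_of_ren)
qed

text \<open>Every thinning of \<open>b\<close> is again based on \<open>a\<close>; a formula true in
  all reindexings of \<open>a\<close> is therefore true in all these thinnings, which is what the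
  extraction hands on to \<open>c\<close>.\<close>

lemma based_transfer:
  assumes ab: "based a b"
    and bc: "\<And>p. p \<in> array_fm \<Longrightarrow> (\<And>g :: nat \<Rightarrow> nat. strict_mono g \<Longrightarrow> true_of (\<lambda>q. b (th g q)) p) \<Longrightarrow> true_of c p"
    and th: "\<And>g :: nat \<Rightarrow> nat. strict_mono g \<Longrightarrow> array_emb (th g)"
  shows "based a c"
  unfolding based_def
proof (intro ballI impI)
  fix p assume p: "p \<in> array_fm" and a: "\<forall>h. array_emb h \<longrightarrow> true_of (\<lambda>q. a (h q)) p"
  show "true_of c p"
  proof (rule bc[OF p])
    fix g :: "nat \<Rightarrow> nat" assume g: "strict_mono g"
    have "based a (\<lambda>q. b (th g q))" by (rule based_comp[OF ab th[OF g]])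
    then show "true_of (\<lambda>q. b (th g q)) p" using p a unfolding based_def by blast
  qed
qed

lemma row_ext_univ: "fam a \<Longrightarrow> z \<in> row_coords C X n \<Longrightarrow> row_ext n a j z \<in> univ M"
  using C(1) by (auto elim!: row_coords_cases intro: famD)

lemma small_row_coords: "small (row_coords C X n)"
proof -
  have "small (UNIV :: (nat \<times> nat) set)" using small_Times[OF small_nat small_nat] by simp
  then show ?thesis unfolding row_coords_def
    by (intro small_Plus small_Times X C(2)) (rule small_mono[OF subset_UNIV])
qed

text \<open>Thickness applies to row \<open>n\<close> with the rest of the array and
  \<open>C\<close> as coordinates and gives formulas without parameters; substituting entries and
  parameters for these coordinates makes them formulas about the array over
  \<open>C\<close>.\<close>

lemma row_ind_type_definable:
  "\<exists>\<Theta>\<subseteq>array_fm. \<forall>a. fam a \<longrightarrow> ((\<forall>p\<in>\<Theta>. true_of a p) \<longleftrightarrow> row_ind L M C X n a)"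
proof -
  from thick_ind_seq[OF thick small_row_coords[of n]]
  obtain \<Theta> where \<Theta>: "\<Theta> \<subseteq> fm_over L ((UNIV :: nat set) \<times> row_coords C X n) {}"
    "\<forall>s. (\<forall>j. \<forall>z\<in>row_coords C X n. s j z \<in> univ M) \<longrightarrow>
      ((\<forall>p\<in>\<Theta>. satp M (\<lambda>(j, z). s j z) p) \<longleftrightarrow> ind_seq L M (row_coords C X n) s)"
    by (elim exE conjE)
  \<comment> \<open>A constant coordinate forgets its index \<open>j\<close>; what is left,
    \<open>w\<close>, already is an array variable or a parameter.\<close>
  define \<rho> :: "(nat \<times> ('x + ((nat \<times> nat) \<times> 'x) + 'm)) + 'm \<Rightarrow> ((nat \<times> nat) \<times> 'x) + 'm" where
    "\<rho> = case_sum (\<lambda>(j, z). case z of Inl x \<Rightarrow> Inl ((n, j), x) | Inr w \<Rightarrow> w) Inr"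
  have "(\<lambda>p. ren p \<rho>) ` \<Theta> \<subseteq> array_fm"
  proof (rule image_subsetI)
    fix p assume "p \<in> \<Theta>"
    then have p: "wf_fm L p" "fv p \<subseteq> (UNIV \<times> row_coords C X n) <+> {}"
      using \<Theta>(1) unfolding fm_over_def by blast+
    have "\<rho> w \<in> (UNIV \<times> X) <+> C" if fv: "w \<in> fv p" for w
    proof -
      obtain j z where w: "w = Inl (j, z)" "z \<in> row_coords C X n" using p(2) fv by blast
      show ?thesis using w(2) by (cases rule: row_coords_cases) (auto simp: w(1) \<rho>_def)
    qed
    then have "fv (ren p \<rho>) \<subseteq> (UNIV \<times> X) <+> C" by (intro subset_trans[OF fv_ren] image_subsetI)
    then show "ren p \<rho> \<in> array_fm" using p(1) by (simp add: fm_over_def)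
  qed
  moreover have "(\<forall>p\<in>(\<lambda>p. ren p \<rho>) ` \<Theta>. true_of a p) \<longleftrightarrow> row_ind L M C X n a" if a: "fam a" for a
  proof -
    have inf: "infinite (UNIV :: (((nat \<times> nat) \<times> 'x) + 'm) set)"
      by (simp add: finite_prod)
    have "param_val (\<lambda>(q, x). a q x) (\<rho> w) = param_val (\<lambda>(j, z). row_ext n a j z) w" for w
    proof (cases w)
      case (Inl v)
      obtain j z where "v = (j, z)" by (cases v)
      then show ?thesis using Inl by (cases z) (auto simp: \<rho>_def row_ext_def split: sum.splits)
    qed (simp add: \<rho>_def)
    then have "true_of a (ren p \<rho>) \<longleftrightarrow> satp M (\<lambda>(j, z). row_ext n a j z) p" for p
      unfolding true_of_def satp_alt sat_ren[OF inf] by simp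
    moreover have "\<forall>j. \<forall>z\<in>row_coords C X n. row_ext n a j z \<in> univ M" using row_ext_univ[OF a] by blast
    from \<Theta>(2)[THEN spec, THEN mp, OF this]
    have "(\<forall>p\<in>\<Theta>. satp M (\<lambda>(j, z). row_ext n a j z) p) \<longleftrightarrow> row_ind L M C X n a"
      unfolding row_ind_def .
    ultimately show ?thesis by simp
  qed
  ultimately show ?thesis by (intro exI[of _ "(\<lambda>p. ren p \<rho>) ` \<Theta>"]) simp
qed

lemma Eq_var_param_over: "v \<in> V \<Longrightarrow> c \<in> A \<Longrightarrow> Eq (Var (Inl v)) (Var (Inr c)) \<in> fm_over L V A"
  by (auto simp: fm_over_def)

lemma satp_Eq_var_param: "satp M e (Eq (Var (Inl v)) (Var (Inr c))) \<longleftrightarrow> e v = c"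
  by (simp add: satp_alt)

text \<open>The extraction may change all coordinates, including those meant to be constant.
  Equations with parameters prevent this, which is why the entries of the array are among the
  parameters \<open>A\<close>.\<close>

lemma row_step:
  assumes a: "fam a"
  shows "\<exists>b. fam b \<and> row_ind L M C X n b \<and> (\<forall>p\<in>array_fm.
    (\<forall>g. strict_mono g \<longrightarrow> true_of (\<lambda>q. a (thin_row n g q)) p) \<longrightarrow> true_of b p)"
proof -
  let ?Z = "row_coords C X n"
  define A where "A = C \<union> (\<lambda>(q, x). a q x) ` (UNIV \<times> X)"
  have "small (UNIV :: (nat \<times> nat) set)" using small_Times[OF small_nat small_nat] by simp
  then have A: "small A" unfolding A_def by (intro small_Un small_image small_Times X C(2))
  have A': "A \<subseteq> univ M" unfolding A_def using C(1) famD[OF a] by auto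
  have "\<exists>s'. (\<forall>j. \<forall>z\<in>?Z. s' j z \<in> univ M) \<and> ind_seq L M ?Z s' \<and>
    (\<forall>p\<in>fm_over L (UNIV \<times> ?Z) A.
      (\<forall>g. strict_mono g \<longrightarrow> satp M (\<lambda>(j, z). row_ext n a (g j) z) p) \<longrightarrow> satp M (\<lambda>(j, z). s' j z) p)"
    by (rule ex_indiscernible_seq[OF small_row_coords A A']) (rule row_ext_univ[OF a])
  then obtain s where s: "\<forall>j. \<forall>z\<in>?Z. s j z \<in> univ M" "ind_seq L M ?Z s"
    "\<forall>p\<in>fm_over L (UNIV \<times> ?Z) A.
      (\<forall>g. strict_mono g \<longrightarrow> satp M (\<lambda>(j, z). row_ext n a (g j) z) p) \<longrightarrow> satp M (\<lambda>(j, z). s j z) p"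
    by (elim exE conjE)
  \<comment> \<open>The equation with \<open>c\<close> is positive and true along every subsequence,
    so it survives.\<close>
  have const: "s j (Inr w) = c" if "Inr w \<in> ?Z" "c \<in> A" "\<And>j. row_ext n a j (Inr w) = c" for j w c
  proof -
    let ?p = "Eq (Var (Inl (j, Inr w))) (Var (Inr c))"
    have "?p \<in> fm_over L (UNIV \<times> ?Z) A" using that(1,2) by (intro Eq_var_param_over) auto
    moreover have "satp M (\<lambda>(j, z). row_ext n a (g j) z) ?p" for g
      using that(3) by (simp add: satp_Eq_var_param)
    ultimately have "satp M (\<lambda>(j, z). s j z) ?p" using s(3) by blast
    then show ?thesis by (simp add: satp_Eq_var_param)
  qed
  have const_param: "s j (Inr (Inr c)) = c" if "c \<in> C" for j c
    using that by (intro const) (auto simp: A_def)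
  have const_entry: "s j (Inr (Inl (q, x))) = a q x" if "fst q \<noteq> n" "x \<in> X" for j q x
    using that by (intro const) (auto simp: A_def)
  define b where "b = (\<lambda>(i, j) x. if i = n then s j (Inl x) else a (i, j) x)"
  have b: "b (n, j) x = s j (Inl x)" "fst q \<noteq> n \<Longrightarrow> b q x = a q x" for j q x
    unfolding b_def by (auto simp: split_beta)
  have "fam b"
    using s(1) famD[OF a] by (auto simp: family_in_def b_def)
  moreover have "row_ind L M C X n b"
    unfolding row_ind_def
  proof (rule ind_seq_reindex[OF s(2), of id])
    fix j z assume "z \<in> ?Z"
    then show "row_ext n b j z = s j (id z)"
      by (cases rule: row_coords_cases) (simp_all add: b const_entry const_param)
  qed simp
  moreover have "true_of b p"
    if p: "p \<in> array_fm" and thin: "\<forall>g. strict_mono g \<longrightarrow> true_of (\<lambda>q. a (thin_row n g q)) p" for p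
  proof -
    \<comment> \<open>Entries outside row \<open>n\<close> are the same at every index; index 0 is
      an arbitrary choice.\<close>
    define f :: "(nat \<times> nat) \<times> 'x \<Rightarrow> nat \<times> ('x + ((nat \<times> nat) \<times> 'x) + 'm)"
      where "f = (\<lambda>((i, j), x). if i = n then (j, Inl x) else (0, Inr (Inl ((i, j), x))))"
    have inf: "infinite (UNIV :: (nat \<times> ('x + ((nat \<times> nat) \<times> 'x) + 'm)) set)"
      by (rule infinite_UNIV_prod1) simp
    have "f ` (UNIV \<times> X) \<subseteq> UNIV \<times> ?Z" by (auto simp: f_def split: if_splits)
    then have "ren p (map_sum f id) \<in> fm_over L (UNIV \<times> ?Z) C" by (rule ren_map_over[OF p])
    then have over: "ren p (map_sum f id) \<in> fm_over L (UNIV \<times> ?Z) A"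
      by (rule fm_over_mono) (simp add: A_def)
    have "satp M (\<lambda>(j, z). row_ext n a (g j) z) (ren p (map_sum f id))" if g: "strict_mono g" for g
    proof -
      have "(\<lambda>v. (\<lambda>(j, z). row_ext n a (g j) z) (f v)) = (\<lambda>(q, x). a (thin_row n g q) x)"
        by (auto simp: f_def thin_row_def)
      then show ?thesis using thin g unfolding satp_ren_map[OF inf] true_of_def by simp
    qed
    then have "satp M (\<lambda>(j, z). s j z) (ren p (map_sum f id))" using s(3) over by blast
    then have "satp M (\<lambda>v. (\<lambda>(j, z). s j z) (f v)) p" unfolding satp_ren_map[OF inf] .
    moreover have "satp M (\<lambda>v. (\<lambda>(j, z). s j z) (f v)) p \<longleftrightarrow> true_of b p"
      unfolding true_of_def
      by (rule satp_cong_over[OF p]) (auto simp: f_def b const_entry)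
    ultimately show ?thesis by simp
  qed
  ultimately show ?thesis by (intro exI[of _ b]) simp
qed

text \<open>Here all entries take part in the extraction, so only \<open>C\<close> is held constant;
  an array formula becomes a formula about the sequence of rows by regrouping its variables.\<close>

lemma rows_step:
  assumes a: "fam a"
  shows "\<exists>b. fam b \<and> rows_ind L M C X b \<and> (\<forall>p\<in>array_fm.
    (\<forall>g. strict_mono g \<longrightarrow> true_of (\<lambda>q. a (thin_rows g q)) p) \<longrightarrow> true_of b p)"
proof -
  let ?Z = "((UNIV :: nat set) \<times> X) <+> C"
  have Z: "small ?Z" by (intro small_Plus small_Times small_nat X C(2))
  have univ: "rows_ext a i z \<in> univ M" if "z \<in> ?Z" for i z
    using that C(1) famD[OF a] by auto
  have "\<exists>s'. (\<forall>j. \<forall>z\<in>?Z. s' j z \<in> univ M) \<and> ind_seq L M ?Z s' \<and>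
    (\<forall>p\<in>fm_over L (UNIV \<times> ?Z) C.
      (\<forall>g. strict_mono g \<longrightarrow> satp M (\<lambda>(j, z). rows_ext a (g j) z) p) \<longrightarrow> satp M (\<lambda>(j, z). s' j z) p)"
    by (rule ex_indiscernible_seq[OF Z C(2,1)]) (rule univ)
  then obtain s where s: "\<forall>j. \<forall>z\<in>?Z. s j z \<in> univ M" "ind_seq L M ?Z s"
    "\<forall>p\<in>fm_over L (UNIV \<times> ?Z) C.
      (\<forall>g. strict_mono g \<longrightarrow> satp M (\<lambda>(j, z). rows_ext a (g j) z) p) \<longrightarrow> satp M (\<lambda>(j, z). s j z) p"
    by (elim exE conjE)
  have const: "s i (Inr c) = c" if c: "c \<in> C" for i c
  proof -
    let ?p = "Eq (Var (Inl (i, Inr c))) (Var (Inr c))"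
    have "?p \<in> fm_over L (UNIV \<times> ?Z) C" using c by (intro Eq_var_param_over) auto
    moreover have "satp M (\<lambda>(j, z). rows_ext a (g j) z) ?p" for g
      by (simp add: satp_Eq_var_param)
    ultimately have "satp M (\<lambda>(j, z). s j z) ?p" using s(3) by blast
    then show ?thesis by (simp add: satp_Eq_var_param)
  qed
  define b where "b = (\<lambda>(i, j) x. s i (Inl (j, x)))"
  have "fam b" using s(1) by (auto simp: family_in_def b_def)
  moreover have "rows_ind L M C X b"
    unfolding rows_ind_def
    by (rule ind_seq_reindex[OF s(2), of id]) (auto simp: b_def const)
  moreover have "true_of b p"
    if p: "p \<in> array_fm" and thin: "\<forall>g. strict_mono g \<longrightarrow> true_of (\<lambda>q. a (thin_rows g q)) p" for p
  proof -
    define f :: "(nat \<times> nat) \<times> 'x \<Rightarrow> nat \<times> ((nat \<times> 'x) + 'm)"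
      where "f = (\<lambda>((i, j), x). (i, Inl (j, x)))"
    have inf: "infinite (UNIV :: (nat \<times> ((nat \<times> 'x) + 'm)) set)"
      by (rule infinite_UNIV_prod1) simp
    have over: "ren p (map_sum f id) \<in> fm_over L (UNIV \<times> ?Z) C"
      by (rule ren_map_over[OF p]) (auto simp: f_def)
    have "satp M (\<lambda>(j, z). rows_ext a (g j) z) (ren p (map_sum f id))" if g: "strict_mono g" for g
    proof -
      have "(\<lambda>v. (\<lambda>(j, z). rows_ext a (g j) z) (f v)) = (\<lambda>(q, x). a (thin_rows g q) x)"
        by (auto simp: f_def thin_rows_def)
      then show ?thesis using thin g unfolding satp_ren_map[OF inf] true_of_def by simp
    qed
    then have "satp M (\<lambda>(j, z). s j z) (ren p (map_sum f id))" using s(3) over by blast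
    moreover have "(\<lambda>v. (\<lambda>(j, z). s j z) (f v)) = (\<lambda>(q, x). b q x)"
      by (auto simp: f_def b_def)
    ultimately show ?thesis unfolding satp_ren_map[OF inf] true_of_def by simp
  qed
  ultimately show ?thesis by (intro exI[of _ b]) simp
qed

lemma ex_mutually_ind_below:
  assumes a: "fam a"
  shows "\<exists>b. fam b \<and> based a b \<and> (\<forall>i<n. row_ind L M C X i b)"
proof (induction n)
  case 0
  then show ?case using a based_refl by (intro exI[of _ a]) simp
next
  case (Suc n)
  then obtain b where b: "fam b" "based a b" "\<And>i. i < n \<Longrightarrow> row_ind L M C X i b" by blast
  from row_step[OF b(1), of n] obtain b' where b': "fam b'" "row_ind L M C X n b'"
    "\<forall>p\<in>array_fm. (\<forall>g. strict_mono g \<longrightarrow> true_of (\<lambda>q. b (thin_row n g q)) p) \<longrightarrow> true_of b' p"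
    by (elim exE conjE)
  have "based a b'"
    by (rule based_transfer[OF b(2), where th = "thin_row n"]) (use b'(3) array_emb_thin_row in auto)
  moreover have "row_ind L M C X i b'" if "i < Suc n" for i
  proof (cases "i = n")
    case False
    then have i: "row_ind L M C X i b" using b(3) that by simp
    from row_ind_type_definable[of i] obtain \<Theta> where \<Theta>_fm: "\<Theta> \<subseteq> array_fm"
      and "\<forall>a. fam a \<longrightarrow> ((\<forall>p\<in>\<Theta>. true_of a p) \<longleftrightarrow> row_ind L M C X i a)" by (elim exE conjE)
    note \<Theta> = this(2)[THEN spec, THEN mp]
    \<comment> \<open>Truth in all thinnings of row \<open>n\<close> is the condition under which
      \<open>row_step\<close> passes a formula on.\<close>
    have "true_of (\<lambda>q. b (thin_row n g q)) p" if "p \<in> \<Theta>" for p g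
      using \<Theta>[OF fam_comp[OF b(1), of "thin_row n g"]] row_ind_thin_row[OF i False] that by blast
    then have "true_of b' p" if "p \<in> \<Theta>" for p using b'(3) \<Theta>_fm that by blast
    then show ?thesis using \<Theta>[OF b'(1)] by blast
  qed (simp add: b'(2))
  ultimately show ?case using b'(1) by blast
qed

text \<open>Treating the rows in turn never finishes, but a finite set of requirements concerns only
  the rows below some \<open>n\<close>, and for these finitely many steps suffice.\<close>

lemma ex_mutually_ind:
  assumes a: "fam a"
  shows "\<exists>b. fam b \<and> based a b \<and> (\<forall>i. row_ind L M C X i b)"
proof -
  define defines_row where "defines_row i \<Theta> \<longleftrightarrow> \<Theta> \<subseteq> array_fm \<and>
    (\<forall>a. fam a \<longrightarrow> ((\<forall>p\<in>\<Theta>. true_of a p) \<longleftrightarrow> row_ind L M C X i a))" for i \<Theta>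
  have "\<exists>\<Theta>. defines_row i \<Theta>" for i unfolding defines_row_def by (rule row_ind_type_definable)
  then obtain \<Theta> where def_row: "\<And>i. defines_row i (\<Theta> i)" by metis
  have \<Theta>: "\<Theta> i \<subseteq> array_fm" "fam a \<Longrightarrow> (\<forall>p\<in>\<Theta> i. true_of a p) \<longleftrightarrow> row_ind L M C X i a" for i a
    using def_row[of i] unfolding defines_row_def by simp_all
  define \<Sigma> where "\<Sigma> = {p \<in> array_fm. \<forall>h. array_emb h \<longrightarrow> true_of (\<lambda>q. a (h q)) p}"
  have small: "small ((UNIV :: (nat \<times> nat) set) \<times> X)"
  proof -
    have "small (UNIV :: (nat \<times> nat) set)" using small_Times[OF small_nat small_nat] by simp
    then show ?thesis by (rule small_Times[OF _ X])
  qed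
  have over: "\<Sigma> \<union> (\<Union>i. \<Theta> i) \<subseteq> array_fm" using \<Theta>(1) unfolding \<Sigma>_def by blast
  have fin: "\<exists>e. e ` (UNIV \<times> X) \<subseteq> univ M \<and> (\<forall>p\<in>S. satp M e p)"
    if S: "finite S" "S \<subseteq> \<Sigma> \<union> (\<Union>i. \<Theta> i)" for S
  proof -
    have "\<exists>i. p \<in> \<Sigma> \<or> p \<in> \<Theta> i" if "p \<in> S" for p using that S(2) by blast
    then obtain I where I: "\<And>p. p \<in> S \<Longrightarrow> p \<in> \<Sigma> \<or> p \<in> \<Theta> (I p)" by metis
    have "finite (I ` S)" using S(1) by simp
    then obtain n where n: "\<And>p. p \<in> S \<Longrightarrow> I p < n" unfolding finite_nat_set_iff_bounded by blast
    obtain b where b: "fam b" "based a b" "\<And>i. i < n \<Longrightarrow> row_ind L M C X i b"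
      using ex_mutually_ind_below[OF a, of n] by blast
    have "true_of b p" if p: "p \<in> S" for p
    proof (cases "p \<in> \<Sigma>")
      case True
      then show ?thesis using b(2) unfolding based_def \<Sigma>_def by blast
    next
      case False
      then have "p \<in> \<Theta> (I p)" using I[OF p] by blast
      then show ?thesis using \<Theta>(2)[OF b(1), of "I p"] b(3)[OF n[OF p]] by blast
    qed
    then show ?thesis
      using famD[OF b(1)] by (intro exI[of _ "\<lambda>(q, x). b q x"]) (auto simp: true_of_def)
  qed
  have "\<exists>e. e ` (UNIV \<times> X) \<subseteq> univ M \<and> (\<forall>p\<in>\<Sigma> \<union> (\<Union>i. \<Theta> i). satp M e p)"
    by (rule small_saturation[OF small C(2,1) over]) (rule fin)
  then obtain e where e: "e ` (UNIV \<times> X) \<subseteq> univ M" "\<forall>p\<in>\<Sigma> \<union> (\<Union>i. \<Theta> i). satp M e p"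
    by (elim exE conjE)
  define b where "b q x = e (q, x)" for q x
  have true: "true_of b p \<longleftrightarrow> satp M e p" for p
    unfolding true_of_def b_def by (simp add: split_def)
  have "fam b" using e(1) by (auto simp: family_in_def b_def)
  moreover have "based a b" unfolding based_def true using e(2) unfolding \<Sigma>_def by blast
  moreover have "row_ind L M C X i b" for i
    using \<Theta>(2)[OF \<open>fam b\<close>, of i] e(2) unfolding true by blast
  ultimately show ?thesis by blast
qed

lemma ex_array_indiscernible:
  assumes a: "fam a"
  shows "\<exists>b. fam b \<and> based a b \<and> array_indiscernible L M C X b"
proof -
  obtain b where b: "fam b" "based a b" "\<And>i. row_ind L M C X i b" using ex_mutually_ind[OF a] by blast
  from rows_step[OF b(1)] obtain c where c: "fam c" "rows_ind L M C X c"
    "\<forall>p\<in>array_fm. (\<forall>g. strict_mono g \<longrightarrow> true_of (\<lambda>q. b (thin_rows g q)) p) \<longrightarrow> true_of c p"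
    by (elim exE conjE)
  have "based a c"
    by (rule based_transfer[OF b(2), where th = thin_rows]) (use c(3) array_emb_thin_rows in auto)
  moreover have "row_ind L M C X i c" for i
  proof -
    from row_ind_type_definable[of i] obtain \<Theta> where \<Theta>_fm: "\<Theta> \<subseteq> array_fm"
      and "\<forall>a. fam a \<longrightarrow> ((\<forall>p\<in>\<Theta>. true_of a p) \<longleftrightarrow> row_ind L M C X i a)" by (elim exE conjE)
    note \<Theta> = this(2)[THEN spec, THEN mp]
    \<comment> \<open>Row \<open>i\<close> of the thinned array is row \<open>g i\<close> of
      \<open>b\<close>, with \<open>g i\<close> unbounded, so this uses the indiscernibility of all
      rows of \<open>b\<close>.\<close>
    have "true_of (\<lambda>q. b (thin_rows g q)) p" if "p \<in> \<Theta>" "strict_mono g" for p g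
      using \<Theta>[OF fam_comp[OF b(1), of "thin_rows g"]] row_ind_thin_rows[OF b(3) that(2)] that(1) by blast
    then have "true_of c p" if "p \<in> \<Theta>" for p using c(3) \<Theta>_fm that by blast
    then show ?thesis using \<Theta>[OF c(1)] by blast
  qed
  then have "array_indiscernible L M C X c" by (rule ind_array_imp_indiscernible[OF c(2)])
  ultimately show ?thesis using c(1) by blast
qed

text \<open>A self-embedding keeps the quantifier-free type of \<open>\<eta>\<close>, so a formula
  of the EM-type, read at the places \<open>\<eta>\<close>, is true in all reindexings of
  \<open>a\<close>.\<close>

lemma based_imp_EM_based:
  assumes ab: "based a b"
  shows "EM_ar_based L M C X a b"
  unfolding EM_based_def
proof (clarify)
  fix \<Delta> p and \<eta> :: "(nat \<times> nat) list"
  assume "(qftp L_ar array \<eta>, p) \<in> EM L_ar array L M C X a"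
  then obtain \<theta> where \<theta>: "qftp L_ar array \<eta> = qftp L_ar array \<theta>" "p \<in> fm_over L ({..<length \<theta>} \<times> X) C"
    "\<forall>\<nu>\<in>lists (univ array). qftp L_ar array \<nu> = qftp L_ar array \<theta> \<longrightarrow> satp M (tuple_at a \<nu>) p"
    unfolding EM_def by blast
  have inf: "infinite (UNIV :: ((nat \<times> nat) \<times> 'x) set)" by (intro infinite_UNIV_prod1) simp
  have p: "p \<in> fm_over L ({..<length \<eta>} \<times> X) C" using \<theta>(2) qftp_array_eqD(1)[OF \<theta>(1)] by simp
  define f where "f = (\<lambda>(k, x :: 'x). (\<eta> ! k, x))"
  have sat: "true_of c (ren p (map_sum f id)) \<longleftrightarrow> satp M (tuple_at c \<eta>) p" for c
  proof -
    have "(\<lambda>v. (\<lambda>(q, x). c q x) (f v)) = tuple_at c \<eta>" by (auto simp: f_def tuple_at_def)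
    then show ?thesis unfolding true_of_def satp_ren_map[OF inf] by simp
  qed
  have "true_of (\<lambda>q. a (h q)) (ren p (map_sum f id))" if h: "array_emb h" for h
  proof -
    have "qftp L_ar array (map h \<eta>) = qftp L_ar array \<theta>" using qftp_map_array_emb[OF h] \<theta>(1) by simp
    moreover have "map h \<eta> \<in> lists (univ array)" by (simp add: array_def)
    ultimately have "satp M (tuple_at a (map h \<eta>)) p" using \<theta>(3) by blast
    moreover have "satp M (tuple_at a (map h \<eta>)) p \<longleftrightarrow> satp M (tuple_at (\<lambda>q. a (h q)) \<eta>) p"
      by (rule satp_cong_over[OF p]) (auto simp: tuple_at_def)
    ultimately show ?thesis unfolding sat by simp
  qed
  moreover have "ren p (map_sum f id) \<in> array_fm" by (rule ren_map_over[OF p]) (auto simp: f_def)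
  ultimately have "true_of b (ren p (map_sum f id))" using ab unfolding based_def by blast
  then show "satp M (tuple_at b \<eta>) p" unfolding sat .
qed

end

theorem theorem1p3:
  fixes L :: "('f, 'r) lang"
    and T :: "('f, 'r) hsentence set"
    and \<kappa> :: "'k rel"
    and M :: "('f, 'r, 'm) struct"
    and C :: "'m set"
    and X :: "'x set"
    and a :: "nat \<times> nat \<Rightarrow> 'x \<Rightarrow> 'm"
  assumes "positive_theory L T"
    and "monster L T \<kappa> M"
    and "thick L \<kappa> M"
    and "C \<subseteq> univ M" and "|C| <o \<kappa>"
    and "|X| <o \<kappa>"
    and "family_in M X a UNIV"
  shows "\<exists>b :: nat \<times> nat \<Rightarrow> 'x \<Rightarrow> 'm. family_in M X b UNIV \<and>
    array_indiscernible L M C X b \<and> EM_ar_based L M C X a b"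
proof -
  interpret monster_model L T \<kappa> M using assms(1,2) by unfold_locales
  interpret thick_array L T \<kappa> M C X
    using assms(3-6) by unfold_locales (simp_all add: small_def)
  obtain b where "family_in M X b UNIV" "based a b" "array_indiscernible L M C X b"
    using ex_array_indiscernible[OF assms(7)] by blast
  then show ?thesis using based_imp_EM_based by blast
qed

end
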